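(* Let $(J,p,\Sigma)$ be a fibered triple and, for $i=1,2$, let $K_i:S^1\to S^3$ be a classical knot such that $K_i$ is in $\overline{S^3\backslash V(J)}$. For $i=1,2$, suppose that $(K_i;J,\Sigma)$ is in special Seifert form (so that $\mathrm{lk}(J,K_i)=0$). Let $\hat{K}_1,\hat{K}_2$ be virtual covers of $K_1,K_2$, respectively, relative to $(J,p,\Sigma)$. If there is a smooth ambient isotopy $H:S^3\times I\to S^3$ taking $K_1$ to $K_2$ such that $H_t|_{V(J)}=\mathrm{id}_{V(J)}$ for all $t\in I$, then $\hat{K}_1$ and $\hat{K}_2$ are equivalent as virtual knots.
   Context: Knots are smooth embeddings of $S^1$; a classical knot is a knot in $S^3$; $I=[0,1]$; $V(J)$ is a closed regular neighborhood of $J$, and "$K$ is in $\overline{S^3\backslash V(J)}$" means in particular $V(J)\cap \mathrm{im}(K)=\emptyset$. Virtual knots. A virtual knot is an equivalence class of virtual knot diagrams under planar isotopy and the extended Reidemeister moves; equivalently, a stable equivalence class of knots in $\Sigma'\times I$ with $\Sigma'$ a compact oriented surface (not necessarily closed), where stable equivalence is generated by ambient isotopy fixing $\partial(\Sigma'\times I)$ pointwise, orientation preserving homeomorphisms of surfaces, and stabilization/destabilization. (Stabilization: cut $\Sigma'\times I$ along $\sigma\times I$ disjoint from the knot, where $\sigma$ is a smooth embedded one-dimensional submanifold of $\Sigma'$; if $\sigma\approx S^1$, cap off each copy of $\sigma\times I$ with a thickened disk $D^2\times I$; discard components not containing the knot. Destabilization is the inverse.) Fibered triple. A knot $J\subset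 S^3$ is fibered if $\overline{S^3\backslash V(J)}$ fibers locally trivially over $S^1$. A fibered triple $(J,p,\Sigma)$ consists of a fibered knot $J$, a given fibration $p:\overline{S^3\backslash V(J)}\to S^1$ and a fiber $\Sigma=p^{-1}(z_0)$, $z_0\in S^1$. The fiber $\Sigma$ is considered a Seifert surface of $J$ by identifying $J$ with $V(J)\cap\Sigma=\partial\Sigma$. Virtual cover. Let $K$ be a knot in $\overline{S^3\backslash V(J)}$ with $\mathrm{lk}(J,K)=0$. Let $\pi_J:M_J\to\overline{S^3\backslash V(J)}$ be the infinite cyclic cover; there is an orientation preserving homeomorphism $M_J\approx\Sigma\times(0,1)$. Let $K'$ be a knot in $M_J$ with $\pi_J\circ K'=K$, regarded as a knot in $\Sigma\times I$ via $\Sigma\times(0,1)\hookrightarrow\Sigma\times I$. The virtual knot $\hat K$ representing the stable equivalence class of $K'$ is called a virtual cover of $K$ relative to $(J,p,\Sigma)$. Special Seifert form. Let $L=J\sqcup K$ be a two component link in an orientable compact connected 3-manifold $M$ and $\Sigma$ a Seifert surface of $J$ (embedded compact orientable surface with $\partial\Sigma=\mathrm{im}(J)$). $L$ is in special Seifert form, denoted $(K;J,\Sigma)$, if there are 3-cells $B_1,\dots,B_n$ in $M$, each $B_i$ in a coordinate neighborhood of some point $z_i\in\mathrm{int}(\Sigma)$, such that for all $i$: (1) $B_i\cap\Sigma$ is a closed disk $D_i\subset\mathrm{int}(\Sigma)$; (2) $B_i\cap K$ consists of two disjoint arcs $a_{i_1},a_{i_2}$ in $\partial B_i$; (3) $(a_{i_1}\cup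 a_{i_2})\cap D_i$ is the set of endpoints of $a_{i_1},a_{i_2}$, and the interiors of the two arcs lie in different components of $B_i\backslash D_i$; (4) $K\subset\Sigma\cup\bigcup_i B_i$; (5) $K\cap\Sigma$ is a union of finitely many pairwise disjoint closed intervals.
   Formalization: The identification of M_J with Σ×(0,1) in a virtual cover is taken smooth and compatible with p (each Σ×{t} lies over one fiber, the angle increasing in t); with arbitrary orientation preserving homeomorphisms the virtual cover is not well defined and the claim fails. *)

theory Defs
  imports "HOL-Analysis.Analysis"
begin

section \<open>Smooth maps between subsets of Euclidean spaces\<close>

primrec Ck_on :: "nat \<Rightarrow> ('a::euclidean_space \<Rightarrow> 'b::euclidean_space) \<Rightarrow> 'a set \<Rightarrow> bool" where
  "Ck_on 0 f U \<longleftrightarrow> continuous_on U f"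
| "Ck_on (Suc k) f U \<longleftrightarrow>
     (\<forall>x\<in>U. f differentiable (at x)) \<and> (\<forall>v. Ck_on k (\<lambda>x. frechet_derivative f (at x) v) U)"

text \<open>
  \<^const>\<open>Ck_on\<close> is only meaningful on open sets. On an arbitrary set, smoothness means local
  extendability to a smooth map on an open set. This covers manifolds with boundary or corners,
  such as \<open>S \<times> [0,1]\<close> for a surface \<open>S\<close> with boundary.
\<close>

definition smooth_on :: "'a::euclidean_space set \<Rightarrow> ('a \<Rightarrow> 'b::euclidean_space) \<Rightarrow> bool" where
  "smooth_on A f \<longleftrightarrow>
     (\<forall>x\<in>A. \<exists>U F. open U \<and> x \<in> U \<and> (\<forall>k. Ck_on k F U) \<and> (\<forall>y\<in>U \<inter> A. F y = f y))"

definition diffeomorphism ::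
  "'a::euclidean_space set \<Rightarrow> 'b::euclidean_space set \<Rightarrow> ('a \<Rightarrow> 'b) \<Rightarrow> ('b \<Rightarrow> 'a) \<Rightarrow> bool" where
  "diffeomorphism A B f g \<longleftrightarrow>
     smooth_on A f \<and> smooth_on B g \<and> f ` A = B \<and> g ` B = A \<and>
     (\<forall>x\<in>A. g (f x) = x) \<and> (\<forall>y\<in>B. f (g y) = y)"

definition smooth_embedding ::
  "'a::euclidean_space set \<Rightarrow> 'b::euclidean_space set \<Rightarrow> ('a \<Rightarrow> 'b) \<Rightarrow> bool" where
  "smooth_embedding A X f \<longleftrightarrow> f ` A \<subseteq> X \<and> (\<exists>g. diffeomorphism A (f ` A) f g)"

definition ambient_isotopy ::
  "'a::euclidean_space set \<Rightarrow> (real \<Rightarrow> 'a \<Rightarrow> 'a) \<Rightarrow> bool" where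
  "ambient_isotopy X H \<longleftrightarrow>
     smooth_on (X \<times> {0..1}) (\<lambda>(x, t). H t x) \<and>
     (\<forall>x\<in>X. H 0 x = x) \<and>
     (\<forall>t\<in>{0..1}. \<exists>g. diffeomorphism X X (H t) g)"


section \<open>Oriented surfaces\<close>

definition half_plane :: "(real^2) set" where
  "half_plane = {w. 0 \<le> w $ 2}"

definition local_param ::
  "'a::euclidean_space set \<Rightarrow> (real^2) set \<Rightarrow> (real^2 \<Rightarrow> 'a) \<Rightarrow> bool" where
  "local_param S W \<psi> \<longleftrightarrow>
     openin (top_of_set half_plane) W \<and> openin (top_of_set S) (\<psi> ` W) \<and>
     smooth_embedding W S \<psi>"

definition smooth_surface :: "'a::euclidean_space set \<Rightarrow> bool" where
  "smooth_surface S \<longleftrightarrow> (\<forall>x\<in>S. \<exists>W \<psi>. local_param S W \<psi> \<and> x \<in> \<psi> ` W)"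

definition surface_boundary :: "'a::euclidean_space set \<Rightarrow> 'a set" where
  "surface_boundary S = {x. \<exists>W \<psi> w. local_param S W \<psi> \<and> w \<in> W \<and> w $ 2 = 0 \<and> x = \<psi> w}"

type_synonym 'a atlas = "((real^2) set \<times> (real^2 \<Rightarrow> 'a)) set"

text \<open>
  The map \<open>C\<close> below is the derivative of \<open>\<eta>\<^sup>-\<^sup>1 \<circ> f \<circ> \<psi>\<close> in local coordinates. The set \<open>X\<close> is
  meant to be open in the surface with atlas \<open>\<A>\<close>, so that it does not matter how \<open>f\<close> behaves
  outside of \<open>X\<close>.
\<close>

definition orientation_preserving_on ::
  "'a::euclidean_space set \<Rightarrow> ('a \<Rightarrow> 'b::euclidean_space) \<Rightarrow> 'a atlas \<Rightarrow> 'b atlas \<Rightarrow> bool" where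
  "orientation_preserving_on X f \<A> \<B> \<longleftrightarrow>
     (\<forall>(W, \<psi>)\<in>\<A>. \<forall>(W', \<eta>)\<in>\<B>. \<forall>w\<in>W. \<forall>w'\<in>W'. \<psi> w \<in> X \<and> f (\<psi> w) = \<eta> w' \<longrightarrow>
        (\<exists>A B C. ((f \<circ> \<psi>) has_derivative A) (at w within W) \<and>
                 (\<eta> has_derivative B) (at w' within W') \<and>
                 linear C \<and> A = B \<circ> C \<and> det (matrix C) > 0))"

definition oriented_surface :: "'a::euclidean_space set \<Rightarrow> 'a atlas \<Rightarrow> bool" where
  "oriented_surface S \<A> \<longleftrightarrow>
     (\<forall>(W, \<psi>)\<in>\<A>. local_param S W \<psi>) \<and> (\<Union>(W, \<psi>)\<in>\<A>. \<psi> ` W) = S \<and>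
     orientation_preserving_on S (\<lambda>x. x) \<A> \<A>"


section \<open>Stable equivalence of knots in thickened surfaces; virtual knots\<close>

abbreviation unit_circle :: "complex set" where
  "unit_circle \<equiv> sphere 0 1"

text \<open>
  Every compact orientable surface embeds smoothly in Euclidean 4-space, and diffeomorphisms are
  among the generating moves. Hence no stable equivalence class is lost by taking surfaces to be
  subsets of \<^typ>\<open>real^4\<close>. The space \<^typ>\<open>real^4\<close> plays no role beyond that of a universe: the
  notions below depend on a surface only up to diffeomorphism.
\<close>

type_synonym surface_knot =
  "(real^4) set \<times> (real^4) atlas \<times> (complex \<Rightarrow> (real^4) \<times> real)"

definition knot_in_thickened_surface :: "surface_knot \<Rightarrow> bool" where
  "knot_in_thickened_surface = (\<lambda>(S, \<A>, K).
     compact S \<and> oriented_surface S \<A> \<and> smooth_embedding unit_circle (S \<times> {0..1}) K)"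

definition isotopic_in_thickened_surface :: "surface_knot \<Rightarrow> surface_knot \<Rightarrow> bool" where
  "isotopic_in_thickened_surface = (\<lambda>(S, \<A>, K) (S', \<A>', K').
     S' = S \<and> \<A>' = \<A> \<and>
     (\<exists>H. ambient_isotopy (S \<times> {0..1}) H \<and>
          (\<forall>t\<in>{0..1}. \<forall>x \<in> surface_boundary S \<times> {0..1} \<union> S \<times> {0, 1}. H t x = x) \<and>
          (\<forall>z\<in>unit_circle. H 1 (K z) = K' z)))"

definition related_by_surface_diffeomorphism :: "surface_knot \<Rightarrow> surface_knot \<Rightarrow> bool" where
  "related_by_surface_diffeomorphism = (\<lambda>(S, \<A>, K) (S', \<A>', K').
     (\<exists>f g. diffeomorphism S S' f g \<and> orientation_preserving_on S f \<A> \<A>' \<and>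
            (\<forall>z\<in>unit_circle. K' z = (f (fst (K z)), snd (K z)))))"

text \<open>
  The surface \<open>C\<close> is the result of cutting \<open>S\<close> along \<open>\<sigma>\<close>, and \<open>c\<close> is the map that glues the two
  copies \<open>\<tau>\<^sub>1\<close>, \<open>\<tau>\<^sub>2\<close> of \<open>\<sigma>\<close> back together. Cutting along an arc creates corners, which are
  rounded in \<open>C\<close>; this is why \<open>c\<close> is only required to be a homeomorphism, not a diffeomorphism,
  on \<open>\<tau>\<^sub>1\<close> and \<open>\<tau>\<^sub>2\<close>.
\<close>

definition cut_surface ::
  "(real^4) set \<Rightarrow> (real^4) set \<Rightarrow> (real^4) set \<Rightarrow> (real^4) set \<Rightarrow> (real^4) set
     \<Rightarrow> (real^4 \<Rightarrow> real^4) \<Rightarrow> bool" where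
  "cut_surface S \<sigma> C \<tau>\<^sub>1 \<tau>\<^sub>2 c \<longleftrightarrow>
     compact C \<and> smooth_surface C \<and> continuous_on C c \<and>
     \<tau>\<^sub>1 \<subseteq> surface_boundary C \<and> \<tau>\<^sub>2 \<subseteq> surface_boundary C \<and> \<tau>\<^sub>1 \<inter> \<tau>\<^sub>2 = {} \<and>
     (\<exists>d. homeomorphism \<tau>\<^sub>1 \<sigma> c d) \<and> (\<exists>d. homeomorphism \<tau>\<^sub>2 \<sigma> c d) \<and>
     (\<exists>d. diffeomorphism (C - (\<tau>\<^sub>1 \<union> \<tau>\<^sub>2)) (S - \<sigma>) c d)"

definition properly_embedded_arc :: "(real^4) set \<Rightarrow> (real^4) set \<Rightarrow> bool" where
  "properly_embedded_arc S \<sigma> \<longleftrightarrow>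
     (\<exists>\<gamma>::real \<Rightarrow> real^4. smooth_embedding {0..1} S \<gamma> \<and> \<sigma> = \<gamma> ` {0..1} \<and>
        (\<forall>t\<in>{0..1}. \<gamma> t \<in> surface_boundary S \<longleftrightarrow> t = 0 \<or> t = 1))"

definition embedded_circle :: "(real^4) set \<Rightarrow> (real^4) set \<Rightarrow> bool" where
  "embedded_circle S \<sigma> \<longleftrightarrow>
     (\<exists>\<gamma>. smooth_embedding unit_circle (S - surface_boundary S) \<gamma> \<and> \<sigma> = \<gamma> ` unit_circle)"

definition disc_with_boundary :: "(real^4) set \<Rightarrow> (real^4) set \<Rightarrow> bool" where
  "disc_with_boundary D \<tau> \<longleftrightarrow>
     (\<exists>d e. diffeomorphism (cball (0::complex) 1) D d e \<and> d ` unit_circle = \<tau>)"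

text \<open>
  In the definition below \<open>Q\<close> is the surface after cutting and capping off, and \<open>S'\<close> consists of
  those components of \<open>Q\<close> over which the knot lies. The equation for \<open>K\<close>, where \<open>c\<close> avoids \<open>\<sigma>\<close>,
  says that \<open>K\<close> is disjoint from \<open>\<sigma> \<times> [0,1]\<close> and that \<open>K'\<close> is the same knot viewed in the
  new thickened surface.
\<close>

definition stabilization :: "surface_knot \<Rightarrow> surface_knot \<Rightarrow> bool" where
  "stabilization = (\<lambda>(S, \<A>, K) (S', \<A>', K').
     (\<exists>\<sigma> C \<tau>\<^sub>1 \<tau>\<^sub>2 c Q.
        cut_surface S \<sigma> C \<tau>\<^sub>1 \<tau>\<^sub>2 c \<and>
        (properly_embedded_arc S \<sigma> \<and> Q = C \<or>
         embedded_circle S \<sigma> \<and>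
         (\<exists>D\<^sub>1 D\<^sub>2. disc_with_boundary D\<^sub>1 \<tau>\<^sub>1 \<and> disc_with_boundary D\<^sub>2 \<tau>\<^sub>2 \<and>
            D\<^sub>1 \<inter> C = \<tau>\<^sub>1 \<and> D\<^sub>2 \<inter> C = \<tau>\<^sub>2 \<and> D\<^sub>1 \<inter> D\<^sub>2 = {} \<and> Q = C \<union> D\<^sub>1 \<union> D\<^sub>2)) \<and>
        compact Q \<and> smooth_surface Q \<and>
        S' = \<Union>{P \<in> components Q. P \<inter> fst ` K' ` unit_circle \<noteq> {}} \<and>
        orientation_preserving_on (S' \<inter> (C - (\<tau>\<^sub>1 \<union> \<tau>\<^sub>2))) c \<A>' \<A> \<and>
        (\<forall>z\<in>unit_circle. fst (K' z) \<in> C - (\<tau>\<^sub>1 \<union> \<tau>\<^sub>2) \<and>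
                         K z = (c (fst (K' z)), snd (K' z)))))"

inductive stable_move :: "surface_knot \<Rightarrow> surface_knot \<Rightarrow> bool" where
  isotopy: "stable_move k k'"
    if "knot_in_thickened_surface k" "knot_in_thickened_surface k'"
       "isotopic_in_thickened_surface k k'"
| diffeo: "stable_move k k'"
    if "knot_in_thickened_surface k" "knot_in_thickened_surface k'"
       "related_by_surface_diffeomorphism k k'"
| stab: "stable_move k k'"
    if "knot_in_thickened_surface k" "knot_in_thickened_surface k'"
       "stabilization k k'"

text \<open>
  The equivalence closure makes the inverse of each move, in particular destabilization,
  available.
\<close>

definition stably_equivalent :: "surface_knot \<Rightarrow> surface_knot \<Rightarrow> bool" where
  "stably_equivalent = equivclp stable_move"

type_synonym virtual_knot = "surface_knot set"

definition virtual_knot_of :: "surface_knot \<Rightarrow> virtual_knot" where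
  "virtual_knot_of k = {k'. stably_equivalent k k'}"


section \<open>Fibered triples\<close>

abbreviation S3 :: "(real^4) set" where
  "S3 \<equiv> sphere 0 1"

definition classical_knot :: "(complex \<Rightarrow> real^4) \<Rightarrow> bool" where
  "classical_knot K \<longleftrightarrow> smooth_embedding unit_circle S3 K"

definition closed_regular_neighborhood :: "(complex \<Rightarrow> real^4) \<Rightarrow> (real^4) set \<Rightarrow> bool" where
  "closed_regular_neighborhood J V \<longleftrightarrow> V \<subseteq> S3 \<and>
     (\<exists>\<phi> \<phi>'. diffeomorphism (unit_circle \<times> cball (0::complex) 1) V \<phi> \<phi>' \<and>
             (\<forall>z\<in>unit_circle. \<phi> (z, 0) = J z))"

definition exterior :: "(real^4) set \<Rightarrow> (real^4) set" where
  "exterior V = closure (S3 - V)"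

definition smooth_fibration_over_circle :: "(real^4) set \<Rightarrow> (real^4 \<Rightarrow> complex) \<Rightarrow> bool" where
  "smooth_fibration_over_circle E p \<longleftrightarrow>
     smooth_on E p \<and> p ` E = unit_circle \<and>
     (\<forall>z\<in>unit_circle. \<exists>U \<phi> \<phi>'. openin (top_of_set unit_circle) U \<and> z \<in> U \<and>
        diffeomorphism {x\<in>E. p x \<in> U} (U \<times> {x\<in>E. p x = z}) \<phi> \<phi>' \<and>
        (\<forall>x\<in>E. p x \<in> U \<longrightarrow> fst (\<phi> x) = p x))"

text \<open>
  Here \<open>V\<close> is the chosen closed regular neighborhood of \<open>J\<close>. The last clause is what allows one
  to identify \<open>J\<close> with \<open>V \<inter> \<Sigma> = \<partial>\<Sigma>\<close>: the two curves cobound an embedded annulus in \<open>V\<close> that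
  extends \<open>\<Sigma>\<close> to a surface bounded by \<open>J\<close>.
\<close>

definition fibered_triple ::
  "(complex \<Rightarrow> real^4) \<Rightarrow> (real^4) set \<Rightarrow> (real^4 \<Rightarrow> complex) \<Rightarrow> (real^4) set \<Rightarrow> bool" where
  "fibered_triple J V p \<Sigma> \<longleftrightarrow>
     classical_knot J \<and> closed_regular_neighborhood J V \<and>
     smooth_fibration_over_circle (exterior V) p \<and>
     (\<exists>z\<^sub>0\<in>unit_circle. \<Sigma> = {x \<in> exterior V. p x = z\<^sub>0}) \<and>
     compact \<Sigma> \<and> (\<exists>\<A>. oriented_surface \<Sigma> \<A>) \<and> surface_boundary \<Sigma> = V \<inter> \<Sigma> \<and>
     (\<exists>\<alpha> :: complex \<times> real \<Rightarrow> real^4. smooth_embedding (unit_circle \<times> {0..1}) V \<alpha> \<and>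
        (\<forall>z\<in>unit_circle. \<alpha> (z, 0) = J z) \<and>
        (\<lambda>z. \<alpha> (z, 1)) ` unit_circle = V \<inter> \<Sigma> \<and>
        (\<forall>z\<in>unit_circle. \<forall>s\<in>{0..<1}. \<alpha> (z, s) \<notin> exterior V))"


section \<open>Virtual covers\<close>

text \<open>
  The infinite cyclic cover: a connected regular covering on whose fibers the deck transformation
  group, given by the action \<open>\<tau>\<close> of the integers, is simply transitive. The smooth structure of
  \<open>M\<close> is the one lifted from \<open>E\<close>.
\<close>

definition infinite_cyclic_cover ::
  "'m::euclidean_space set \<Rightarrow> ('m \<Rightarrow> 'e::euclidean_space) \<Rightarrow> 'e set \<Rightarrow> bool" where
  "infinite_cyclic_cover M \<pi> E \<longleftrightarrow>
     covering_space M \<pi> E \<and> connected M \<and>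
     (\<forall>x\<in>M. \<exists>U g. openin (top_of_set M) U \<and> x \<in> U \<and> openin (top_of_set E) (\<pi> ` U) \<and>
                   diffeomorphism U (\<pi> ` U) \<pi> g) \<and>
     (\<exists>\<tau> :: int \<Rightarrow> 'm \<Rightarrow> 'm.
        (\<forall>n. continuous_on M (\<tau> n) \<and> \<tau> n ` M \<subseteq> M \<and> (\<forall>x\<in>M. \<pi> (\<tau> n x) = \<pi> x)) \<and>
        (\<forall>x\<in>M. \<tau> 0 x = x) \<and> (\<forall>m n. \<forall>x\<in>M. \<tau> (m + n) x = \<tau> m (\<tau> n x)) \<and>
        (\<forall>x\<in>M. \<forall>y\<in>M. \<pi> x = \<pi> y \<longrightarrow> (\<exists>!n. \<tau> n x = y)))"

text \<open>
  For a local diffeomorphism \<open>g\<close> from \<open>S \<times> (0,1)\<close> to the 3-sphere. The product carries the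
  product orientation (surface first), the 3-sphere the boundary orientation of the unit ball
  (outward normal first).
\<close>

definition orientation_preserving_to_S3 ::
  "(real^4) atlas \<Rightarrow> ((real^4) \<times> real \<Rightarrow> real^4) \<Rightarrow> bool" where
  "orientation_preserving_to_S3 \<A> g \<longleftrightarrow>
     (\<forall>(W, \<psi>)\<in>\<A>. \<forall>w\<in>W. \<forall>t\<in>{0<..<1}.
        (\<exists>D. ((\<lambda>(u, s). g (\<psi> u, s)) has_derivative D) (at (w, t) within W \<times> {0<..<1}) \<and>
             det (vector [g (\<psi> w, t), D (axis 1 1, 0), D (axis 2 1, 0), D (0, 1)] :: real^4^4) > 0))"

text \<open>
  The identification \<open>h : M \<approx> \<Sigma> \<times> (0,1)\<close> of the infinite cyclic cover (with the orientation lifted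
  from the 3-sphere) is the one provided by the fibration: \<open>\<Sigma> \<times> {t}\<close> is a lift of the fiber over
  \<open>cis (\<theta> t)\<close>, with \<open>\<theta>\<close> increasing. This determines which of the two orientations of \<open>\<Sigma>\<close> is
  used; the other one is obtained by composing \<open>p\<close> with complex conjugation. Some condition of this
  kind is needed: an arbitrary orientation preserving homeomorphism may reverse both \<open>\<Sigma>\<close> and
  \<open>(0,1)\<close>, which changes the virtual knot. The existence of the closed lift \<open>K'\<close>
  means that \<open>K\<close> has linking number zero with \<open>J\<close>.
\<close>

definition fibered_identification ::
  "(real^4 \<Rightarrow> complex) \<Rightarrow> (real^4) set \<Rightarrow> (real^4) atlas \<Rightarrow> 'm::euclidean_space set \<Rightarrow>
     ('m \<Rightarrow> real^4) \<Rightarrow> ('m \<Rightarrow> (real^4) \<times> real) \<Rightarrow> bool" where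
  "fibered_identification p \<Sigma> \<A> M \<pi> h \<longleftrightarrow>
     (\<exists>h'. diffeomorphism M (\<Sigma> \<times> {0<..<1}) h h' \<and>
           orientation_preserving_to_S3 \<A> (\<pi> \<circ> h') \<and>
           (\<exists>\<theta>. strict_mono_on {0<..<1} \<theta> \<and> continuous_on {0<..<1} \<theta> \<and>
                (\<forall>x\<in>\<Sigma>. \<forall>t\<in>{0<..<1}. p (\<pi> (h' (x, t))) = cis (\<theta> t))))"

definition virtual_cover ::
  "(real^4) set \<Rightarrow> (real^4 \<Rightarrow> complex) \<Rightarrow> (real^4) set \<Rightarrow> (complex \<Rightarrow> real^4) \<Rightarrow>
     virtual_knot \<Rightarrow> bool" where
  "virtual_cover V p \<Sigma> K \<kappa> \<longleftrightarrow>
     (\<exists>(M :: ((real^4) \<times> real) set) \<pi> \<A> h K'.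
        infinite_cyclic_cover M \<pi> (exterior V) \<and>
        oriented_surface \<Sigma> \<A> \<and> fibered_identification p \<Sigma> \<A> M \<pi> h \<and>
        smooth_embedding unit_circle M K' \<and> (\<forall>z\<in>unit_circle. \<pi> (K' z) = K z) \<and>
        \<kappa> = virtual_knot_of (\<Sigma>, \<A>, h \<circ> K'))"


section \<open>Special Seifert form\<close>

definition seifert_surface :: "(real^4) set \<Rightarrow> (real^4) set \<Rightarrow> bool" where
  "seifert_surface \<Sigma> j \<longleftrightarrow>
     \<Sigma> \<subseteq> S3 \<and> compact \<Sigma> \<and> (\<exists>\<A>. oriented_surface \<Sigma> \<A>) \<and> surface_boundary \<Sigma> = j"

definition in_coordinate_neighborhood :: "(real^4) set \<Rightarrow> real^4 \<Rightarrow> bool" where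
  "in_coordinate_neighborhood B z \<longleftrightarrow>
     (\<exists>U (O3 :: (real^3) set) f g. openin (top_of_set S3) U \<and> z \<in> U \<and> B \<subseteq> U \<and> open O3 \<and>
        diffeomorphism U O3 f g)"

text \<open>A condition on one of the 3-cells \<open>B\<^sub>i\<close>, with \<open>k\<close> the image of the knot.\<close>

definition crossing_cell :: "(real^4) set \<Rightarrow> (real^4) set \<Rightarrow> (real^4) set \<Rightarrow> bool" where
  "crossing_cell k \<Sigma> B \<longleftrightarrow>
     B \<subseteq> S3 \<and> B homeomorphic (cball 0 1 :: (real^3) set) \<and>
     (\<exists>z \<in> \<Sigma> - surface_boundary \<Sigma>. in_coordinate_neighborhood B z) \<and>
     (B \<inter> \<Sigma>) homeomorphic (cball 0 1 :: complex set) \<and>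
     B \<inter> \<Sigma> \<subseteq> \<Sigma> - surface_boundary \<Sigma> \<and>
     (\<exists>a\<^sub>1 a\<^sub>2 :: real \<Rightarrow> real^4. arc a\<^sub>1 \<and> arc a\<^sub>2 \<and>
        path_image a\<^sub>1 \<inter> path_image a\<^sub>2 = {} \<and>
        path_image a\<^sub>1 \<union> path_image a\<^sub>2 \<subseteq> top_of_set S3 frontier_of B \<and>
        B \<inter> k = path_image a\<^sub>1 \<union> path_image a\<^sub>2 \<and>
        (path_image a\<^sub>1 \<union> path_image a\<^sub>2) \<inter> (B \<inter> \<Sigma>) =
          {pathstart a\<^sub>1, pathfinish a\<^sub>1, pathstart a\<^sub>2, pathfinish a\<^sub>2} \<and>
        (\<exists>C\<^sub>1 \<in> components (B - \<Sigma>). \<exists>C\<^sub>2 \<in> components (B - \<Sigma>). C\<^sub>1 \<noteq> C\<^sub>2 \<and>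
           a\<^sub>1 ` {0<..<1} \<subseteq> C\<^sub>1 \<and> a\<^sub>2 ` {0<..<1} \<subseteq> C\<^sub>2))"

text \<open>
  The ambient 3-manifold is the 3-sphere; \<open>j\<close> and \<open>k\<close> are the images of the two components of
  the link.
\<close>

definition special_seifert_form ::
  "(real^4) set \<Rightarrow> (real^4) set \<Rightarrow> (real^4) set \<Rightarrow> bool" where
  "special_seifert_form k j \<Sigma> \<longleftrightarrow>
     j \<inter> k = {} \<and> seifert_surface \<Sigma> j \<and>
     (\<exists>(n::nat) B. (\<forall>i\<in>{1..n}. crossing_cell k \<Sigma> (B i)) \<and>
        k \<subseteq> \<Sigma> \<union> (\<Union>i\<in>{1..n}. B i)) \<and>
     (\<exists>\<I>. finite \<I> \<and> pairwise disjnt \<I> \<and> \<Union>\<I> = k \<inter> \<Sigma> \<and>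
          (\<forall>I\<in>\<I>. I homeomorphic {0..1::real}))"

end

theory Submission
  imports Defs
begin

text \<open>
  The isotopy fixes \<open>V\<close>, so it lifts to the infinite cyclic cover \<open>\<Sigma> \<times> (0,1)\<close> of the exterior and
  moves the given lift of \<open>K\<^sub>1\<close> to a lift of \<open>K\<^sub>2\<close> away from the boundary. Near the knot the lifted
  isotopy extends to ambient isotopies of \<open>\<Sigma> \<times> [0,1]\<close>. No vector field is integrated for this: each
  point follows the isotopy for a time given by a bump function, which for short times is a
  diffeomorphism close to the identity.

  The two covers with their identifications with \<open>\<Sigma> \<times> (0,1)\<close> differ by a diffeomorphism over the
  exterior. Both identifications respect the fibration, hence this diffeomorphism maps levels to
  levels. Up to an isotopy near the knot it is the product of an orientation preserving
  diffeomorphism of \<open>\<Sigma>\<close> with the identity, which is one of the moves of stable equivalence.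
\<close>

section \<open>Calculus of smooth maps on open sets\<close>

text \<open>A virtual cover depends on the chosen covering space, on its identification with the
  product and on the chosen lift. So even two virtual covers of one and the same knot must be
  compared, and the isotopy is only half of the matter.

  The comparison rests on the height, a real-valued lift of \<open>p\<close> to the product. A deck
  transformation shifts it by a multiple of 2 pi, and compactness of the exterior forces the shift
  of the generator to be nonzero. Hence a point of the cover is determined by its image in the
  exterior and its height, so that a map between two covers is pinned down by one constant height
  difference.

  On the isotopy side the obstacle is that the lift lives on the open product, while a move must fix
  both ends and the boundary of the surface. Cutting off solves this for short times only, and
  connectedness of the time interval joins the steps. That the moving knot stays away from the
  boundary of the surface is a topological fact: by invariance of domain, no point over an open
  subset of the 3-sphere is a boundary point.\<close>

lemma Ck_on_mono: "Ck_on k f U \<Longrightarrow> V \<subseteq> U \<Longrightarrow> Ck_on k f V"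
  by (induction k arbitrary: f) (auto intro: continuous_on_subset)

lemma has_derivative_frechet_if_Ck_Suc:
  "Ck_on (Suc k) f U \<Longrightarrow> x \<in> U \<Longrightarrow> (f has_derivative frechet_derivative f (at x)) (at x)"
  unfolding Ck_on.simps(2) using frechet_derivative_works by blast

lemma Ck_on_frechet_derivative:
  "Ck_on (Suc k) f U \<Longrightarrow> Ck_on k (\<lambda>x. frechet_derivative f (at x) v) U"
  unfolding Ck_on.simps(2) by blast

lemma Ck_on_cong:
  assumes "open U" "\<And>x. x \<in> U \<Longrightarrow> f x = g x" "Ck_on k f U"
  shows "Ck_on k g U"
  using assms(2,3)
proof (induction k arbitrary: f g)
  case 0
  then show ?case using continuous_on_cong by force
next
  case (Suc k)
  have d: "(g has_derivative frechet_derivative f (at x)) (at x)" if "x \<in> U" for x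
    using has_derivative_frechet_if_Ck_Suc[OF Suc.prems(2) that] assms(1) that Suc.prems(1)
    by (rule has_derivative_transform_within_open)
  have "Ck_on k (\<lambda>x. frechet_derivative g (at x) v) U" for v
    by (rule Suc.IH[OF _ Ck_on_frechet_derivative[OF Suc.prems(2)]])
      (use frechet_derivative_at[OF d] in simp)
  then show ?case
    unfolding Ck_on.simps(2) using d differentiableI by blast
qed

text \<open>Derivatives at points of an open set are unique, so any explicit formula may stand in
  for \<open>frechet_derivative\<close>. Most inductions on the order of smoothness below use this
  form.\<close>

lemma Ck_on_Suc_intro:
  assumes "open U" "\<And>x. x \<in> U \<Longrightarrow> (f has_derivative f' x) (at x)"
    and "\<And>v. Ck_on k (\<lambda>x. f' x v) U"
  shows "Ck_on (Suc k) f U"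
proof -
  have "Ck_on k (\<lambda>x. frechet_derivative f (at x) v) U" for v
    by (rule Ck_on_cong[OF assms(1) _ assms(3)[of v]])
      (use frechet_derivative_at[OF assms(2)] in simp)
  then show ?thesis
    unfolding Ck_on.simps(2) using assms(2) differentiableI by blast
qed

lemma Ck_on_imp_continuous: "Ck_on k f U \<Longrightarrow> continuous_on U f"
  by (cases k) (auto simp: differentiable_imp_continuous_within continuous_at_imp_continuous_on)

lemma Ck_on_Suc_imp: "Ck_on (Suc k) f U \<Longrightarrow> Ck_on k f U"
proof (induction k arbitrary: f)
  case 0 then show ?case using Ck_on_imp_continuous[OF 0] by simp
next
  case (Suc k)
  then show ?case unfolding Ck_on.simps(2) by blast
qed

lemma Ck_on_const: "Ck_on k (\<lambda>x. c) U"
proof (induction k arbitrary: c)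
  case (Suc k)
  then show ?case by (simp add: frechet_derivative_const)
qed simp

lemma Ck_on_bounded_linear_compose:
  assumes "open U" "bounded_linear L" "Ck_on k f U"
  shows "Ck_on k (\<lambda>x. L (f x)) U"
  using assms(3)
proof (induction k arbitrary: f)
  case 0
  then show ?case
    using bounded_linear.continuous_on[OF assms(2)] by (simp add: o_def)
next
  case (Suc k)
  show ?case
  proof (rule Ck_on_Suc_intro[OF assms(1)])
    fix x assume "x \<in> U"
    then have "(f has_derivative frechet_derivative f (at x)) (at x)"
      using Suc.prems by (simp add: frechet_derivative_works)
    then show "((\<lambda>x. L (f x)) has_derivative (\<lambda>v. L (frechet_derivative f (at x) v))) (at x)"
      by (rule bounded_linear.has_derivative[OF assms(2)])
  qed (use Suc in auto)
qed

lemma Ck_on_ident: "open U \<Longrightarrow> Ck_on k (\<lambda>x. x) U"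
proof (cases k)
  case (Suc j)
  assume "open U"
  then show ?thesis unfolding Suc
    by (rule Ck_on_Suc_intro[where f' = "\<lambda>x v. v"]) (auto simp: Ck_on_const)
qed simp

lemma Ck_on_bounded_linear: "open U \<Longrightarrow> bounded_linear L \<Longrightarrow> Ck_on k L U"
  using Ck_on_bounded_linear_compose[OF _ _ Ck_on_ident] by blast

lemma Ck_on_add:
  assumes "open U" "Ck_on k f U" "Ck_on k g U"
  shows "Ck_on k (\<lambda>x. f x + g x) U"
  using assms(2,3)
proof (induction k arbitrary: f g)
  case 0 then show ?case by (auto intro: continuous_intros)
next
  case (Suc k)
  show ?case
  proof (rule Ck_on_Suc_intro[OF assms(1)])
    fix x assume "x \<in> U"
    then show "((\<lambda>x. f x + g x) has_derivative
        (\<lambda>v. frechet_derivative f (at x) v + frechet_derivative g (at x) v)) (at x)"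
      using Suc.prems by (intro has_derivative_add has_derivative_frechet_if_Ck_Suc)
  qed (use Suc in auto)
qed

lemma Ck_on_sum:
  assumes "open U" "\<And>i. i \<in> I \<Longrightarrow> Ck_on k (f i) U"
  shows "Ck_on k (\<lambda>x. \<Sum>i\<in>I. f i x) U"
  using assms(2)
  by (induction I rule: infinite_finite_induct) (auto simp: Ck_on_const Ck_on_add[OF assms(1)])

lemma Ck_on_bounded_bilinear:
  assumes "open U" "bounded_bilinear B" "Ck_on k f U" "Ck_on k g U"
  shows "Ck_on k (\<lambda>x. B (f x) (g x)) U"
  using assms(3,4)
proof (induction k arbitrary: f g)
  case 0 then show ?case using bounded_bilinear.continuous_on[OF assms(2)] by simp
next
  case (Suc k)
  show ?case
  proof (rule Ck_on_Suc_intro[OF assms(1)])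
    fix x assume "x \<in> U"
    then show "((\<lambda>x. B (f x) (g x)) has_derivative
        (\<lambda>v. B (f x) (frechet_derivative g (at x) v) + B (frechet_derivative f (at x) v) (g x))) (at x)"
      using Suc.prems by (intro bounded_bilinear.FDERIV[OF assms(2)] has_derivative_frechet_if_Ck_Suc)
  next
    fix v
    show "Ck_on k (\<lambda>x. B (f x) (frechet_derivative g (at x) v) + B (frechet_derivative f (at x) v) (g x)) U"
      using Suc.prems
      by (intro Ck_on_add assms(1) Suc.IH Ck_on_frechet_derivative) (auto intro: Ck_on_Suc_imp simp del: Ck_on.simps)
  qed
qed

lemmas Ck_on_scaleR = Ck_on_bounded_bilinear[OF _ bounded_bilinear_scaleR]
lemmas Ck_on_mult = Ck_on_bounded_bilinear[OF _ bounded_bilinear_mult]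

lemma linear_basis_expansion:
  fixes f :: "'a::euclidean_space \<Rightarrow> 'b::real_vector"
  assumes "linear f" shows "f w = (\<Sum>b\<in>Basis. (w \<bullet> b) *\<^sub>R f b)"
  by (subst euclidean_representation[of w, symmetric])
    (simp add: linear_sum[OF assms] linear_scale[OF assms] del: euclidean_representation)

lemma Ck_on_compose:
  assumes "open U" "open V" "f ` U \<subseteq> V" "Ck_on k f U" "Ck_on k g V"
  shows "Ck_on k (\<lambda>x. g (f x)) U"
  using assms(4,5)
proof (induction k arbitrary: g)
  case 0
  then show ?case using continuous_on_compose2[OF _ _ assms(3)] by simp
next
  case (Suc k)
  let ?f' = "\<lambda>x. frechet_derivative f (at x)" and ?g' = "\<lambda>x. frechet_derivative g (at x)"
  have g': "(g has_derivative ?g' y) (at y)" if "y \<in> V" for y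
    using Suc.prems(2) that by (rule has_derivative_frechet_if_Ck_Suc)
  have f': "(f has_derivative ?f' x) (at x)" if "x \<in> U" for x
    using Suc.prems(1) that by (rule has_derivative_frechet_if_Ck_Suc)
  have fk: "Ck_on k f U" using Suc.prems(1) by (rule Ck_on_Suc_imp)
  show ?case
  proof (rule Ck_on_Suc_intro[OF assms(1)])
    fix x assume x: "x \<in> U"
    \<comment> \<open>The chain rule produces a direction \<open>?f' x v\<close> that varies with
      \<open>x\<close>, whereas \<open>Ck_on\<close> speaks of derivatives in fixed directions.
      Expanding in the basis turns the varying direction into scalar coefficients.\<close>
    have *: "?g' (f x) w = (\<Sum>b\<in>Basis. (w \<bullet> b) *\<^sub>R ?g' (f x) b)" for w
      using has_derivative_linear[OF g'] x assms(3) by (intro linear_basis_expansion) auto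
    have "((\<lambda>x. g (f x)) has_derivative (\<lambda>v. ?g' (f x) (?f' x v))) (at x)"
      using diff_chain_at[OF f'[OF x] g'] x assms(3) by (auto simp: o_def)
    then show "((\<lambda>x. g (f x)) has_derivative (\<lambda>v. \<Sum>b\<in>Basis. (?f' x v \<bullet> b) *\<^sub>R ?g' (f x) b)) (at x)"
      by (subst (asm) *)
  next
    fix v
    show "Ck_on k (\<lambda>x. \<Sum>b\<in>Basis. (?f' x v \<bullet> b) *\<^sub>R ?g' (f x) b) U"
    proof (intro Ck_on_sum Ck_on_scaleR assms(1))
      fix b :: 'b assume "b \<in> Basis"
      show "Ck_on k (\<lambda>x. ?f' x v \<bullet> b) U"
        by (intro Ck_on_bounded_linear_compose[OF assms(1) bounded_linear_inner_left]
            Ck_on_frechet_derivative[OF Suc.prems(1)])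
      show "Ck_on k (\<lambda>x. ?g' (f x) b) U"
        by (intro Suc.IH fk Ck_on_frechet_derivative[OF Suc.prems(2)])
    qed
  qed
qed

lemma Ck_on_Pair:
  assumes "open U" "Ck_on k f U" "Ck_on k g U"
  shows "Ck_on k (\<lambda>x. (f x, g x)) U"
proof -
  have "Ck_on k (\<lambda>x. (f x, 0) + (0, g x)) U"
    by (intro Ck_on_add Ck_on_bounded_linear_compose[where L = "\<lambda>x. (x, 0)"]
        Ck_on_bounded_linear_compose[where L = "\<lambda>x. (0, x)"] assms bounded_linear_Pair
        bounded_linear_ident bounded_linear_zero)
  then show ?thesis by simp
qed

lemma Ck_on_local:
  assumes "\<And>x. x \<in> U \<Longrightarrow> \<exists>V. open V \<and> x \<in> V \<and> Ck_on k f V"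
  shows "Ck_on k f U"
  using assms
proof (induction k arbitrary: f)
  case 0
  have "isCont f x" if "x \<in> U" for x
    using 0[OF that] by (auto simp: continuous_on_eq_continuous_at)
  then show ?case by (simp add: continuous_at_imp_continuous_on)
next
  case (Suc k)
  have "Ck_on k (\<lambda>x. frechet_derivative f (at x) v) U" for v
  proof (rule Suc.IH)
    fix x assume "x \<in> U"
    then obtain V where "open V" "x \<in> V" "Ck_on (Suc k) f V" using Suc.prems by blast
    then show "\<exists>V. open V \<and> x \<in> V \<and> Ck_on k (\<lambda>x. frechet_derivative f (at x) v) V"
      unfolding Ck_on.simps(2) by blast
  qed
  moreover have "f differentiable at x" if "x \<in> U" for x
    using Suc.prems[OF that] unfolding Ck_on.simps(2) by blast
  ultimately show ?case unfolding Ck_on.simps(2) by blast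
qed

text \<open>
  This is how smoothness of inverse maps is obtained: the derivative of an inverse map factors
  through the map itself.
\<close>

lemma smooth_bootstrap:
  assumes "open U" "open V" "g ` V \<subseteq> U" "continuous_on V g"
    and "\<And>y. y \<in> V \<Longrightarrow> (g has_derivative P (g y)) (at y)"
    and "\<And>k v. Ck_on k (\<lambda>x. P x v) U"
  shows "Ck_on k g V"
proof (induction k)
  case (Suc k)
  show ?case
    by (rule Ck_on_Suc_intro[where f' = "\<lambda>y. P (g y)"])
      (use assms(2,5,6) Suc in \<open>auto intro: Ck_on_compose[OF assms(2,1,3)] simp del: Ck_on.simps\<close>)
qed (use assms in simp)

text \<open>The derivative of \<open>inverse\<close> is minus its own square, a polynomial in the
  function itself, so bootstrapping applies.\<close>

lemma smooth_inverse_real: "Ck_on k (\<lambda>x::real. inverse x) (- {0})"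
proof (rule smooth_bootstrap[where P = "\<lambda>y v. - (v * y ^ 2)" and U = "UNIV"])
  show "((\<lambda>x. inverse x) has_derivative (\<lambda>v. - (v * (inverse y)\<^sup>2))) (at y)" if "y \<in> - {0}" for y :: real
    using that by (auto intro!: derivative_eq_intros simp: power2_eq_square)
  have *: "(\<lambda>x. - (v * x\<^sup>2)) = (\<lambda>x. (-v) * (x * x))" for v :: real by (auto simp: power2_eq_square)
  show "Ck_on k (\<lambda>x. - (v * x\<^sup>2)) UNIV" for k and v :: real
    unfolding * by (intro Ck_on_mult Ck_on_const Ck_on_ident) auto
qed (auto intro!: continuous_intros open_delete simp: Compl_eq_Diff_UNIV)

text \<open>Inversion of linear maps is smooth, shown without determinants. The resolvent identity
  gives continuity and the derivative \<open>- P x (D (P x v) x w)\<close>, which is again built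
  from \<open>P\<close> and smooth data. Induction on the order then closes.\<close>

lemma smooth_inverse_family:
  fixes f' :: "'a::euclidean_space \<Rightarrow> 'b::euclidean_space \<Rightarrow> 'c::euclidean_space"
  assumes U: "open U"
    and f': "\<And>k v. Ck_on k (\<lambda>x. f' x v) U" "\<And>x. x \<in> U \<Longrightarrow> linear (f' x)"
    and P: "\<And>x. x \<in> U \<Longrightarrow> linear (P x)" "\<And>x v. x \<in> U \<Longrightarrow> norm (P x v) \<le> M * norm v"
    and inv: "\<And>x v. x \<in> U \<Longrightarrow> f' x (P x v) = v" "\<And>x v. x \<in> U \<Longrightarrow> P x (f' x v) = v"
  shows "Ck_on k (\<lambda>x. P x v) U"
proof -
  define D where "D i x = frechet_derivative (\<lambda>x. f' x i) (at x)" for i x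
  have D: "((\<lambda>x. f' x v) has_derivative D v x) (at x)" if "x \<in> U" for v x
    using f'(1)[of "Suc 0" v] that by (simp add: D_def frechet_derivative_works)
  have DC: "Ck_on k (\<lambda>x. D v x w) U" for k v w
    using f'(1)[of "Suc k" v] by (simp add: D_def)
  \<comment> \<open>The resolvent identity. With the uniform bound \<open>M\<close> it reduces
    continuity of the inverses to continuity of \<open>f'\<close>.\<close>
  have diff: "P x v - P y v = - P x (f' x (P y v) - f' y (P y v))" if "x \<in> U" "y \<in> U" for x y v
    using that by (simp add: linear_diff[OF P(1)] inv)
  have M: "0 \<le> M" if "x \<in> U" "w \<noteq> 0" for x and w :: 'c
    using order_trans[OF norm_ge_zero P(2)[OF that(1), of w]] that(2)
    by (simp add: zero_le_mult_iff)
  have cont: "continuous_on U (\<lambda>x. P x v)" for v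
    unfolding continuous_on_eq_continuous_at[OF U] continuous_at
  proof
    fix y assume y: "y \<in> U"
    have "((\<lambda>x. M * norm (f' x (P y v) - f' y (P y v))) \<longlongrightarrow> M * norm (f' y (P y v) - f' y (P y v))) (at y)"
      using Ck_on_imp_continuous[OF f'(1)[of 0]] y U
      by (intro tendsto_intros) (auto simp: continuous_on_eq_continuous_at continuous_at)
    then have lim: "((\<lambda>x. M * norm (f' x (P y v) - f' y (P y v))) \<longlongrightarrow> 0) (at y)" by simp
    have "((\<lambda>x. P x v - P y v) \<longlongrightarrow> 0) (at y)"
    proof (rule Lim_null_comparison[OF _ lim])
      show "\<forall>\<^sub>F x in at y. norm (P x v - P y v) \<le> M * norm (f' x (P y v) - f' y (P y v))"
        using eventually_at_in_open'[OF U y]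
        by eventually_elim (use y in \<open>simp add: diff P(2)\<close>)
    qed
    then show "((\<lambda>x. P x v) \<longlongrightarrow> P y v) (at y)"
      using LIM_zero_iff by blast
  qed
  have der: "((\<lambda>x. P x v) has_derivative (\<lambda>w. - P y (D (P y v) y w))) (at y)" if y: "y \<in> U" for y v
  proof -
    let ?R = "\<lambda>x. f' x (P y v)" and ?R' = "D (P y v) y"
    have R: "(?R has_derivative ?R') (at y)" using D[OF y] .
    have Rlin: "bounded_linear ?R'" using R by (rule has_derivative_bounded_linear)
    obtain K where K: "\<And>w. norm (?R' w) \<le> norm w * K"
      using bounded_linear.bounded[OF Rlin] by blast
    have Pb: "norm (P x u - P y u) \<le> (\<Sum>b\<in>Basis. norm (P x b - P y b)) * norm u" if "x \<in> U" for x u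
    proof -
      have "P x u - P y u = (\<Sum>b\<in>Basis. (u \<bullet> b) *\<^sub>R (P x b - P y b))"
        by (subst linear_basis_expansion[OF P(1)[OF that]], subst linear_basis_expansion[OF P(1)[OF y]])
          (simp add: sum_subtractf scaleR_diff_right)
      then have "norm (P x u - P y u) \<le> (\<Sum>b\<in>Basis. norm (P x b - P y b) * norm u)"
        by (auto intro!: sum_norm_le mult_right_mono Basis_le_norm simp: mult.commute)
      then show ?thesis by (simp add: sum_distrib_right)
    qed
    have lim1: "((\<lambda>x. norm (?R x - ?R y - ?R' (x - y)) / norm (x - y)) \<longlongrightarrow> 0) (at y)"
      using R unfolding has_derivative_iff_norm by blast
    have lim2: "((\<lambda>x. \<Sum>b\<in>Basis. norm (P x b - P y b)) \<longlongrightarrow> (\<Sum>b\<in>Basis. norm (P y b - P y b))) (at y)"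
      using cont y U by (intro tendsto_intros) (auto simp: continuous_on_eq_continuous_at continuous_at)
    have lim: "((\<lambda>x. M * (norm (?R x - ?R y - ?R' (x - y)) / norm (x - y)) +
        (\<Sum>b\<in>Basis. norm (P x b - P y b)) * K) \<longlongrightarrow> M * 0 + (\<Sum>b\<in>Basis. norm (P y b - P y b)) * K) (at y)"
      by (intro tendsto_intros lim1 lim2)
    have "((\<lambda>x. norm (P x v - P y v - (- P y (?R' (x - y)))) / norm (x - y)) \<longlongrightarrow> 0) (at y)"
    proof (rule Lim_null_comparison)
      show "((\<lambda>x. M * (norm (?R x - ?R y - ?R' (x - y)) / norm (x - y)) +
        (\<Sum>b\<in>Basis. norm (P x b - P y b)) * K) \<longlongrightarrow> 0) (at y)" using lim by simp
      show "\<forall>\<^sub>F x in at y. norm (norm (P x v - P y v - (- P y (?R' (x - y)))) / norm (x - y)) \<le>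
          M * (norm (?R x - ?R y - ?R' (x - y)) / norm (x - y)) + (\<Sum>b\<in>Basis. norm (P x b - P y b)) * K"
        using eventually_at_in_open[OF U y]
      proof eventually_elim
        case (elim x)
        then have x: "x \<in> U" "x \<noteq> y" by auto
        let ?S = "\<Sum>b\<in>Basis. norm (P x b - P y b)"
        \<comment> \<open>The error splits in two: the first part is small by differentiability of
          \<open>f'\<close>, the second because \<open>P x\<close> tends to \<open>P y\<close> on
          every basis vector, hence uniformly on bounded vectors.\<close>
        have "P x v - P y v - (- P y (?R' (x - y))) =
            - P x (?R x - ?R y - ?R' (x - y)) - (P x (?R' (x - y)) - P y (?R' (x - y)))"
          by (simp only: diff[OF x(1) y, of v] linear_diff[OF P(1)[OF x(1)]]) simp
        then have "norm (P x v - P y v - (- P y (?R' (x - y)))) \<le>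
            norm (P x (?R x - ?R y - ?R' (x - y))) + norm (P x (?R' (x - y)) - P y (?R' (x - y)))"
          by (metis norm_minus_cancel norm_triangle_ineq4)
        also have "\<dots> \<le> M * norm (?R x - ?R y - ?R' (x - y)) + ?S * norm (?R' (x - y))"
          by (intro add_mono P(2) Pb x)
        also have "\<dots> \<le> M * norm (?R x - ?R y - ?R' (x - y)) + ?S * (norm (x - y) * K)"
          by (intro add_left_mono mult_left_mono K sum_nonneg norm_ge_zero)
        finally show ?case using x by (simp add: field_simps)
      qed
    qed
    moreover have "bounded_linear (\<lambda>w. - P y (?R' w))"
      using Rlin linear_conv_bounded_linear P(1)[OF y] bounded_linear_compose bounded_linear_minus by blast
    ultimately show ?thesis by (simp add: has_derivative_iff_norm)
  qed
  \<comment> \<open>The direction \<open>P x v\<close> inside \<open>D\<close> varies with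
    \<open>x\<close>. Expanding twice in the basis leaves only functions with fixed arguments, to
    which the induction hypothesis applies.\<close>
  have expand: "- P x (D (P x v) x w) =
      (\<Sum>b\<in>Basis. (P x v \<bullet> b) *\<^sub>R (\<Sum>c\<in>Basis. (- (D b x w \<bullet> c)) *\<^sub>R P x c))" if x: "x \<in> U" for x v w
  proof -
    have "((\<lambda>y. f' y u) has_derivative (\<lambda>w. \<Sum>b\<in>Basis. (u \<bullet> b) *\<^sub>R D b x w)) (at x)" for u
    proof (rule has_derivative_transform_within_open[OF _ U x])
      show "((\<lambda>y. \<Sum>b\<in>Basis. (u \<bullet> b) *\<^sub>R f' y b) has_derivative (\<lambda>w. \<Sum>b\<in>Basis. (u \<bullet> b) *\<^sub>R D b x w)) (at x)"
        by (intro has_derivative_sum has_derivative_scaleR_right D x)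
      show "(\<Sum>b\<in>Basis. (u \<bullet> b) *\<^sub>R f' y b) = f' y u" if "y \<in> U" for y
        by (rule linear_basis_expansion[OF f'(2)[OF that], symmetric])
    qed
    then have e: "D u x = (\<lambda>w. \<Sum>b\<in>Basis. (u \<bullet> b) *\<^sub>R D b x w)" for u
      using D[OF x] has_derivative_unique by blast
    have p: "P x u = (\<Sum>c\<in>Basis. (u \<bullet> c) *\<^sub>R P x c)" for u
      by (rule linear_basis_expansion[OF P(1)[OF x]])
    have "P x (D (P x v) x w) = (\<Sum>b\<in>Basis. (P x v \<bullet> b) *\<^sub>R P x (D b x w))"
      by (subst e) (simp add: linear_sum[OF P(1)] linear_scale[OF P(1)] x)
    also have "\<dots> = (\<Sum>b\<in>Basis. (P x v \<bullet> b) *\<^sub>R (\<Sum>c\<in>Basis. (D b x w \<bullet> c) *\<^sub>R P x c))"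
      by (subst p[of "D _ x w"]) simp
    finally show ?thesis by (simp add: sum_negf scaleR_minus_left)
  qed
  show ?thesis
  proof (induction k arbitrary: v)
    case 0 then show ?case using cont by simp
  next
    case (Suc k)
    show ?case
    proof (rule Ck_on_Suc_intro[OF U der])
      fix w
      have "Ck_on k (\<lambda>x. \<Sum>b\<in>Basis. (P x v \<bullet> b) *\<^sub>R (\<Sum>c\<in>Basis. (- (D b x w \<bullet> c)) *\<^sub>R P x c)) U"
        by (intro Ck_on_sum Ck_on_scaleR U Suc
            Ck_on_bounded_linear_compose[OF U bounded_linear_minus[OF bounded_linear_inner_left]] DC
            Ck_on_bounded_linear_compose[OF U bounded_linear_inner_left]) 
      then show "Ck_on k (\<lambda>x. - P x (D (P x v) x w)) U"
        by (rule Ck_on_cong[OF U, rotated]) (simp add: expand)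
    qed
  qed
qed

section \<open>Smooth maps on arbitrary sets\<close>

lemma smooth_onE:
  assumes "smooth_on A f" "x \<in> A"
  obtains U F where "open U" "x \<in> U" "\<forall>k. Ck_on k F U" "\<forall>y\<in>U \<inter> A. F y = f y"
proof -
  have "\<exists>U F. open U \<and> x \<in> U \<and> (\<forall>k. Ck_on k F U) \<and> (\<forall>y\<in>U \<inter> A. F y = f y)"
    using assms unfolding smooth_on_def by (rule bspec)
  then show ?thesis by (elim exE conjE) (rule that)
qed

lemma smooth_onI:
  assumes "\<And>x. x \<in> A \<Longrightarrow> \<exists>U F. open U \<and> x \<in> U \<and> (\<forall>k. Ck_on k F U) \<and> (\<forall>y\<in>U \<inter> A. F y = f y)"
  shows "smooth_on A f"
  unfolding smooth_on_def using assms by (rule ballI)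

lemma smooth_on_open:
  assumes "open U" "\<And>k. Ck_on k f U" "A \<subseteq> U"
  shows "smooth_on A f"
proof (rule smooth_onI)
  fix x assume "x \<in> A"
  show "\<exists>U F. open U \<and> x \<in> U \<and> (\<forall>k. Ck_on k F U) \<and> (\<forall>y\<in>U \<inter> A. F y = f y)"
    using assms \<open>x \<in> A\<close> by (intro exI[of _ U] exI[of _ f]) auto
qed

lemma smooth_on_subset:
  assumes "smooth_on A f" "B \<subseteq> A"
  shows "smooth_on B f"
proof (rule smooth_onI)
  fix x assume "x \<in> B"
  then have "x \<in> A" using assms(2) by blast
  obtain U F where
    "open U" "x \<in> U" "\<forall>k. Ck_on k F U" "\<forall>y\<in>U \<inter> A. F y = f y"
    by (rule smooth_onE[OF assms(1) \<open>x \<in> A\<close>])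
  then show "\<exists>U F. open U \<and> x \<in> U \<and> (\<forall>k. Ck_on k F U) \<and> (\<forall>y\<in>U \<inter> B. F y = f y)"
    using assms(2) by (intro exI[of _ U] exI[of _ F]) auto
qed

lemma smooth_on_cong:
  assumes "smooth_on A f" "\<And>x. x \<in> A \<Longrightarrow> f x = g x"
  shows "smooth_on A g"
proof (rule smooth_onI)
  fix x assume "x \<in> A"
  obtain U F where
    "open U" "x \<in> U" "\<forall>k. Ck_on k F U" "\<forall>y\<in>U \<inter> A. F y = f y"
    by (rule smooth_onE[OF assms(1) \<open>x \<in> A\<close>])
  then show "\<exists>U F. open U \<and> x \<in> U \<and> (\<forall>k. Ck_on k F U) \<and> (\<forall>y\<in>U \<inter> A. F y = g y)"
    using assms(2) by (intro exI[of _ U] exI[of _ F]) auto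
qed

lemma smooth_on_local:
  assumes "\<And>x. x \<in> A \<Longrightarrow> \<exists>W. openin (top_of_set A) W \<and> x \<in> W \<and> smooth_on W f"
  shows "smooth_on A f"
proof (rule smooth_onI)
  fix x assume "x \<in> A"
  then obtain W where W: "openin (top_of_set A) W" "x \<in> W" "smooth_on W f" using assms by blast
  obtain S where S: "open S" "W = A \<inter> S" using W(1) by (auto simp: openin_open)
  obtain U F where F: "open U" "x \<in> U" "\<forall>k. Ck_on k F U" "\<forall>y\<in>U \<inter> W. F y = f y"
    by (rule smooth_onE[OF W(3,2)])
  show "\<exists>U F. open U \<and> x \<in> U \<and> (\<forall>k. Ck_on k F U) \<and> (\<forall>y\<in>U \<inter> A. F y = f y)"
    using F S W(2) by (intro exI[of _ "U \<inter> S"] exI[of _ F]) (auto intro: Ck_on_mono[of _ F U])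
qed

lemma smooth_on_imp_continuous_on:
  assumes "smooth_on A f" shows "continuous_on A f"
  unfolding continuous_on_eq_continuous_within
proof
  fix x assume x: "x \<in> A"
  obtain U F where F: "open U" "x \<in> U" "\<forall>k. Ck_on k F U" "\<forall>y\<in>U \<inter> A. F y = f y"
    by (rule smooth_onE[OF assms x])
  then have "continuous (at x within A) F"
    by (metis Ck_on_imp_continuous continuous_at_imp_continuous_at_within continuous_on_eq_continuous_at)
  moreover have "\<forall>\<^sub>F y in at x within A. F y = f y"
    unfolding eventually_at_topological using F by blast
  moreover have "F x = f x" using F x by blast
  ultimately show "continuous (at x within A) f"
    unfolding continuous_within using Lim_transform_eventually[of F "F x" "at x within A" f] by simp
qed

lemma smooth_on_has_derivative:
  assumes "smooth_on A f" "x \<in> A"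
  obtains D where "(f has_derivative D) (at x within A)"
proof -
  obtain U F where F: "open U" "x \<in> U" "\<forall>k. Ck_on k F U" "\<forall>y\<in>U \<inter> A. F y = f y"
    by (rule smooth_onE[OF assms])
  have "(F has_derivative frechet_derivative F (at x)) (at x within A)"
    using has_derivative_frechet_if_Ck_Suc[OF F(3)[rule_format] F(2)] by (rule has_derivative_at_withinI)
  moreover have "\<forall>\<^sub>F y in at x within A. F y = f y"
    unfolding eventually_at_topological using F(1,2,4) by blast
  moreover have "F x = f x" using F(2,4) assms(2) by blast
  ultimately have "(f has_derivative frechet_derivative F (at x)) (at x within A)"
    using assms(2) by (rule has_derivative_transform_eventually)
  then show ?thesis by (rule that)
qed

lemma smooth_on_compose:
  assumes "smooth_on B g" "smooth_on A f" "f ` A \<subseteq> B"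
  shows "smooth_on A (\<lambda>x. g (f x))"
proof (rule smooth_onI)
  fix x assume x: "x \<in> A"
  obtain U F where F: "open U" "x \<in> U" "\<forall>k. Ck_on k F U" "\<forall>y\<in>U \<inter> A. F y = f y"
    by (rule smooth_onE[OF assms(2) x])
  have fx: "f x \<in> B" using assms(3) x by blast
  obtain V G where G: "open V" "f x \<in> V" "\<forall>k. Ck_on k G V" "\<forall>y\<in>V \<inter> B. G y = g y"
    by (rule smooth_onE[OF assms(1) fx])
  let ?W = "F -` V \<inter> U"
  have "open ?W"
    using continuous_open_preimage[OF Ck_on_imp_continuous[OF F(3)[rule_format, of 0]] F(1) G(1)] by (simp add: Int_commute)
  moreover have "Ck_on k (\<lambda>x. G (F x)) ?W" for k
    by (rule Ck_on_compose[OF calculation G(1) _ Ck_on_mono[OF F(3)[rule_format]] G(3)[rule_format]]) auto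
  moreover have "x \<in> ?W" "\<forall>y\<in>?W \<inter> A. G (F y) = g (f y)"
    using F(2,4) G(2,4) assms(3) x by auto
  ultimately show "\<exists>U F. open U \<and> x \<in> U \<and> (\<forall>k. Ck_on k F U) \<and> (\<forall>y\<in>U \<inter> A. F y = g (f y))"
    by (intro exI[of _ ?W] exI[of _ "\<lambda>x. G (F x)"]) simp
qed

lemma smooth_on_const: "smooth_on A (\<lambda>x. c)"
  by (rule smooth_on_open[of UNIV]) (auto intro: Ck_on_const)

lemma smooth_on_bounded_linear: "bounded_linear L \<Longrightarrow> smooth_on A L"
  by (rule smooth_on_open[of UNIV]) (auto intro: Ck_on_bounded_linear)

lemma smooth_on_ident: "smooth_on A (\<lambda>x. x)"
  by (rule smooth_on_bounded_linear[OF bounded_linear_ident])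

lemma smooth_on_fst: "smooth_on A f \<Longrightarrow> smooth_on A (\<lambda>x. fst (f x))"
  by (rule smooth_on_compose[OF smooth_on_bounded_linear[OF bounded_linear_fst]]) auto

lemma smooth_on_snd: "smooth_on A f \<Longrightarrow> smooth_on A (\<lambda>x. snd (f x))"
  by (rule smooth_on_compose[OF smooth_on_bounded_linear[OF bounded_linear_snd]]) auto

lemma smooth_on_Pair:
  assumes "smooth_on A f" "smooth_on A g"
  shows "smooth_on A (\<lambda>x. (f x, g x))"
proof (rule smooth_onI)
  fix x assume x: "x \<in> A"
  obtain U F where F: "open U" "x \<in> U" "\<forall>k. Ck_on k F U" "\<forall>y\<in>U \<inter> A. F y = f y"
    by (rule smooth_onE[OF assms(1) x])
  obtain V G where G: "open V" "x \<in> V" "\<forall>k. Ck_on k G V" "\<forall>y\<in>V \<inter> A. G y = g y"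
    by (rule smooth_onE[OF assms(2) x])
  have "Ck_on k (\<lambda>x. (F x, G x)) (U \<inter> V)" for k
    using F(1,3) G(1,3) by (intro Ck_on_Pair Ck_on_mono[of k F U "U \<inter> V"] Ck_on_mono[of k G V "U \<inter> V"]) auto
  then show "\<exists>U F. open U \<and> x \<in> U \<and> (\<forall>k. Ck_on k F U) \<and> (\<forall>y\<in>U \<inter> A. F y = (f y, g y))"
    using F(1,2,4) G(1,2,4) by (intro exI[of _ "U \<inter> V"] exI[of _ "\<lambda>x. (F x, G x)"]) auto
qed

lemma smooth_on_bilinear:
  assumes "bounded_bilinear B" "smooth_on A f" "smooth_on A g"
  shows "smooth_on A (\<lambda>x. B (f x) (g x))"
proof -
  have "smooth_on UNIV (\<lambda>z. B (fst z) (snd z))"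
    by (rule smooth_on_open[of UNIV])
      (auto intro: Ck_on_bounded_bilinear[OF _ assms(1)] Ck_on_bounded_linear bounded_linear_fst bounded_linear_snd)
  from smooth_on_compose[OF this smooth_on_Pair[OF assms(2,3)]] show ?thesis by simp
qed

lemmas smooth_on_mult = smooth_on_bilinear[OF bounded_bilinear_mult]

lemma smooth_on_add:
  assumes "smooth_on A f" "smooth_on A g"
  shows "smooth_on A (\<lambda>x. f x + g x)"
  using smooth_on_compose[OF smooth_on_bounded_linear[OF
    bounded_linear_add[OF bounded_linear_fst bounded_linear_snd]] smooth_on_Pair[OF assms] subset_UNIV]
  by simp

lemma smooth_on_diff:
  assumes "smooth_on A f" "smooth_on A g"
  shows "smooth_on A (\<lambda>x. f x - g x)"
  using smooth_on_compose[OF smooth_on_bounded_linear[OF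
    bounded_linear_sub[OF bounded_linear_fst bounded_linear_snd]] smooth_on_Pair[OF assms] subset_UNIV]
  by simp

lemmas smooth_on_intros = smooth_on_const smooth_on_ident smooth_on_fst smooth_on_snd
  smooth_on_Pair smooth_on_mult smooth_on_add smooth_on_diff

section \<open>Diffeomorphisms and embeddings\<close>

lemma
  assumes "diffeomorphism A B f g"
  shows diffeomorphism_smooth: "smooth_on A f" and diffeomorphism_smooth_inverse: "smooth_on B g"
    and diffeomorphism_image: "f ` A = B" and diffeomorphism_inverse_image: "g ` B = A"
    and diffeomorphism_inverse: "x \<in> A \<Longrightarrow> g (f x) = x"
    and diffeomorphism_inverse': "y \<in> B \<Longrightarrow> f (g y) = y"
  using assms by (auto simp: diffeomorphism_def)

lemma diffeomorphismI:
  assumes "smooth_on A f" "smooth_on B g" "f ` A \<subseteq> B" "g ` B \<subseteq> A"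
    and "\<And>x. x \<in> A \<Longrightarrow> g (f x) = x" "\<And>y. y \<in> B \<Longrightarrow> f (g y) = y"
  shows "diffeomorphism A B f g"
proof -
  have "B \<subseteq> f ` A" "A \<subseteq> g ` B"
    using assms(3-6) by force+
  then show ?thesis using assms unfolding diffeomorphism_def by blast
qed

lemma diffeomorphism_sym: "diffeomorphism A B f g \<Longrightarrow> diffeomorphism B A g f"
  unfolding diffeomorphism_def by auto

lemma diffeomorphism_imp_homeomorphism: "diffeomorphism A B f g \<Longrightarrow> homeomorphism A B f g"
  unfolding diffeomorphism_def homeomorphism_def by (auto dest: smooth_on_imp_continuous_on)

lemma diffeomorphism_compose:
  assumes "diffeomorphism A B f g" "diffeomorphism B C f' g'"
  shows "diffeomorphism A C (f' \<circ> f) (g \<circ> g')"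
proof -
  have "smooth_on A (\<lambda>x. f' (f x))" "smooth_on C (\<lambda>x. g (g' x))"
    using assms by (auto simp: diffeomorphism_def intro: smooth_on_compose[of B])
  moreover have "f' ` f ` A = C" "g ` g' ` C = A" using assms by (simp_all add: diffeomorphism_def)
  moreover have "f x \<in> B" "g' y \<in> B" if "x \<in> A" "y \<in> C" for x y
    using assms that by (auto simp: diffeomorphism_def)
  moreover have "\<forall>x\<in>A. g (g' (f' (f x))) = x" "\<forall>y\<in>C. f' (f (g (g' y))) = y"
    using assms by (auto simp: diffeomorphism_def)
  ultimately show ?thesis
    unfolding diffeomorphism_def by (simp add: o_def flip: image_image)
qed

lemma diffeomorphism_restrict:
  "diffeomorphism A B f g \<Longrightarrow> A' \<subseteq> A \<Longrightarrow> diffeomorphism A' (f ` A') f g"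
  unfolding diffeomorphism_def
  by (auto intro: smooth_on_subset[of A] smooth_on_subset[OF _ image_mono] simp: subset_iff image_iff)

lemma smooth_embedding_compose:
  assumes "smooth_embedding A X k" "diffeomorphism X Y f g" "Y \<subseteq> Z"
  shows "smooth_embedding A Z (f \<circ> k)"
proof -
  obtain l where "diffeomorphism A (k ` A) k l" and kX: "k ` A \<subseteq> X"
    using assms(1) unfolding smooth_embedding_def by blast
  then have "diffeomorphism A (f ` k ` A) (f \<circ> k) (l \<circ> g)"
    using diffeomorphism_compose diffeomorphism_restrict[OF assms(2) kX] by blast
  moreover have "(f \<circ> k) ` A \<subseteq> Z"
    using kX assms(2,3) unfolding diffeomorphism_def by auto
  ultimately show ?thesis unfolding smooth_embedding_def by (auto simp: image_comp)
qed

lemma smooth_embedding_cong: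
  assumes "smooth_embedding A X f" "\<And>z. z \<in> A \<Longrightarrow> f z = g z"
  shows "smooth_embedding A X g"
proof -
  obtain h where h: "f ` A \<subseteq> X" "diffeomorphism A (f ` A) f h"
    using assms(1) unfolding smooth_embedding_def by blast
  have img: "g ` A = f ` A" using assms(2) by auto
  have "smooth_on A g" using h(2) assms(2) by (auto simp: diffeomorphism_def intro: smooth_on_cong)
  then have "diffeomorphism A (g ` A) g h"
    using h(2) assms(2) unfolding img diffeomorphism_def by simp
  then show ?thesis unfolding smooth_embedding_def using h(1) img by auto
qed

section \<open>Bump functions\<close>

text \<open>For \<open>p = 1\<close> this is the standard function \<open>exp (- 1/x)\<close>,
  extended by 0. The polynomial parameter makes the family closed under differentiation.\<close>

definition flat :: "real poly \<Rightarrow> real \<Rightarrow> real" where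
  "flat p x = (if x \<le> 0 then 0 else poly p (inverse x) * exp (- inverse x))"

lemma poly_exp_tendsto_0: "((\<lambda>y. poly p y * exp (- y)) \<longlongrightarrow> 0) at_top" for p :: "real poly"
proof -
  have "((\<lambda>y. \<Sum>i\<le>degree p. coeff p i * (y ^ i / exp y)) \<longlongrightarrow> (\<Sum>i\<le>degree p. coeff p i * 0)) at_top"
    by (intro tendsto_intros tendsto_power_div_exp_0)
  then show ?thesis by (simp add: poly_altdef sum_distrib_right exp_minus divide_inverse mult.assoc)
qed

text \<open>In the variable \<open>y = 1/x\<close> differentiation acts on
  \<open>p(y) exp(-y)\<close> by \<open>- y^2 d/dy\<close>, which yields the polynomial
  \<open>(p - p') y^2\<close>. Only the origin needs a limit argument.\<close>

lemma flat_has_derivative: "(flat p has_real_derivative flat ((p - pderiv p) * monom 1 2) x) (at x)"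
proof -
  consider "x < 0" | "x > 0" | "x = 0" by linarith
  then show ?thesis
  proof cases
    case 1
    have "((\<lambda>x. 0) has_real_derivative 0) (at x)" by simp
    then have "(flat p has_real_derivative 0) (at x)"
      by (rule has_field_derivative_transform_within_open[of _ _ _ "{..<0}"])
        (use 1 in \<open>auto simp: flat_def\<close>)
    then show ?thesis using 1 by (simp add: flat_def)
  next
    case 2
    have "((\<lambda>x. poly p (inverse x) * exp (- inverse x)) has_real_derivative
        flat ((p - pderiv p) * monom 1 2) x) (at x)"
      using 2 by (auto intro!: derivative_eq_intros DERIV_chain2[OF poly_DERIV]
          simp: flat_def poly_monom power2_eq_square algebra_simps)
    then show ?thesis
      by (rule has_field_derivative_transform_within_open[of _ _ _ "{0<..}"])
        (use 2 in \<open>auto simp: flat_def\<close>)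
  next
    case 3
    \<comment> \<open>The difference quotient at 0 is \<open>y p(y) exp(-y)\<close> for
      \<open>y = 1/h\<close>; the extra factor \<open>y\<close> is \<open>monom 1 1\<close>.\<close>
    have "((\<lambda>x. (poly (p * monom 1 1) (inverse x) * exp (- inverse x))) \<longlongrightarrow> 0) (at_right (0::real))"
      using poly_exp_tendsto_0[of "p * monom 1 1"] filterlim_inverse_at_top_right
      by (rule filterlim_compose)
    then have r: "((\<lambda>h. (flat p (0 + h) - flat p 0) / h) \<longlongrightarrow> 0) (at_right 0)"
      by (rule Lim_transform_eventually)
        (auto simp: eventually_at_right_less flat_def poly_monom divide_inverse mult.commute
          intro!: eventually_at_rightI[of 0 1])
    have l: "((\<lambda>h. (flat p (0 + h) - flat p 0) / h) \<longlongrightarrow> 0) (at_left 0)"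
      by (rule Lim_transform_eventually[OF tendsto_const])
        (auto simp: flat_def intro!: eventually_at_leftI[of "-1" 0])
    from l r have "((\<lambda>h. (flat p (0 + h) - flat p 0) / h) \<longlongrightarrow> 0) (at 0)"
      by (rule filterlim_split_at)
    then show ?thesis using 3 by (simp add: DERIV_def flat_def)
  qed
qed

lemma smooth_flat: "Ck_on k (flat p) UNIV"
proof (induction k arbitrary: p)
  case 0
  show ?case using DERIV_continuous[OF flat_has_derivative] continuous_at_imp_continuous_on
    by (simp add: continuous_at_imp_continuous_on)
next
  case (Suc k)
  show ?case
    by (rule Ck_on_Suc_intro[OF _ flat_has_derivative[unfolded has_field_derivative_def]])
      (auto intro!: Ck_on_mult Suc Ck_on_const)
qed

text \<open>Since \<^term>\<open>flat 1\<close> vanishes on the negative axis, this is constant on both \<open>x \<le> 0\<close> and \<open>x \<ge> 1\<close>.\<close>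

definition smooth_step :: "real \<Rightarrow> real" where
  "smooth_step x = 1 - exp 1 * flat 1 (1 - exp 1 * flat 1 x)"

lemma smooth_step_smooth: "Ck_on k smooth_step UNIV"
proof -
  have "Ck_on k (\<lambda>x. 1 + (- exp 1) * flat 1 (1 + (- exp 1) * flat 1 x)) UNIV"
    by (intro Ck_on_add Ck_on_const Ck_on_mult open_UNIV smooth_flat
        Ck_on_compose[where g = "flat 1" and V = UNIV]) auto
  then show ?thesis by (simp add: smooth_step_def[abs_def])
qed

lemma flat_1_mono: "x \<le> y \<Longrightarrow> flat 1 x \<le> flat 1 y"
  by (auto simp: flat_def)

lemma smooth_step_0: "x \<le> 0 \<Longrightarrow> smooth_step x = 0"
  by (simp add: smooth_step_def flat_def flip: exp_add)

lemma smooth_step_1: assumes "x \<ge> 1" shows "smooth_step x = 1"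
proof -
  \<comment> \<open>The factor \<open>exp 1\<close> normalizes \<open>flat 1 1 = exp (-1)\<close> to
    1. For \<open>x \<ge> 1\<close> the inner argument is therefore at most 0.\<close>
  have "1 \<le> exp 1 * flat 1 x"
    using flat_1_mono[OF assms] by (simp add: flat_def exp_minus field_simps split: if_splits)
  then show ?thesis by (simp add: smooth_step_def) (simp add: flat_def)
qed

lemma smooth_step_range: "smooth_step x \<in> {0..1}"
proof -
  have "0 \<le> flat 1 y" for y by (simp add: flat_def)
  moreover have "flat 1 (1 - exp 1 * flat 1 x) \<le> flat 1 1"
    using calculation by (intro flat_1_mono) auto
  ultimately show ?thesis
    by (auto simp: smooth_step_def) (simp add: flat_def exp_minus field_simps)
qed

text \<open>The closed set \<open>D\<close> is part of the result because its complement is open: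
  there, a map cut off by \<open>b\<close> is the identity, and smoothness can be glued.\<close>

lemma smooth_bump:
  fixes C U :: "'a::euclidean_space set"
  assumes "compact C" "open U" "C \<subseteq> U"
  obtains b :: "'a \<Rightarrow> real" and D where "\<And>k. Ck_on k b UNIV" "\<And>x. b x \<in> {0..1}"
    "\<And>x. x \<in> C \<Longrightarrow> b x = 1" "closed D" "D \<subseteq> U" "\<And>x. x \<notin> D \<Longrightarrow> b x = 0"
proof -
  have "\<exists>r>0. cball c r \<subseteq> U" if "c \<in> C" for c
    using assms that open_contains_cball by blast
  then obtain r where r: "\<And>c. c \<in> C \<Longrightarrow> r c > 0" "\<And>c. c \<in> C \<Longrightarrow> cball c (r c) \<subseteq> U" by metis
  have "C \<subseteq> (\<Union>c\<in>C. ball c (r c / 2))" using r(1) by force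
  then obtain F where F: "F \<subseteq> C" "finite F" "C \<subseteq> (\<Union>c\<in>F. ball c (r c / 2))"
    using compactE_image[OF assms(1), of C "\<lambda>c. ball c (r c / 2)"] by auto
  \<comment> \<open>The argument is 1 at distance \<open>r/2\<close> from the centre, since
    \<open>r^2 - r^2/4 = 3 r^2/4\<close>, and 0 at distance \<open>r\<close>. So \<open>b c\<close>
    is 1 on the half ball and 0 off the full ball.\<close>
  define b where "b c y = smooth_step (((r c)\<^sup>2 - (y - c) \<bullet> (y - c)) * (4 / (3 * (r c)\<^sup>2)))" for c y
  have b_smooth: "Ck_on k (b c) UNIV" for k c
    unfolding b_def diff_conv_add_uminus
    by (intro Ck_on_compose[OF _ _ _ _ smooth_step_smooth] Ck_on_mult Ck_on_const Ck_on_add Ck_on_ident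
        Ck_on_bounded_linear_compose[OF _ bounded_linear_minus[OF bounded_linear_ident]]
        Ck_on_bounded_bilinear[OF _ bounded_bilinear_inner] open_UNIV) auto
  have b1: "b c y = 1" if "c \<in> F" "y \<in> ball c (r c / 2)" for c y
  proof -
    have rc: "r c > 0" using that F r by auto
    have "(y - c) \<bullet> (y - c) \<le> (r c / 2)\<^sup>2"
      using that rc unfolding power2_norm_eq_inner[symmetric]
      by (intro power_mono) (auto simp: dist_norm norm_minus_commute)
    then have "1 \<le> ((r c)\<^sup>2 - (y - c) \<bullet> (y - c)) * (4 / (3 * (r c)\<^sup>2))"
      using rc by (simp add: field_simps)
    then show ?thesis unfolding b_def by (rule smooth_step_1)
  qed
  have b0: "b c y = 0" if "c \<in> F" "y \<notin> cball c (r c)" for c y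
  proof -
    have rc: "r c > 0" using that F r by auto
    have "(r c)\<^sup>2 \<le> (y - c) \<bullet> (y - c)"
      using that rc unfolding power2_norm_eq_inner[symmetric]
      by (intro power_mono) (auto simp: dist_norm norm_minus_commute)
    then have "((r c)\<^sup>2 - (y - c) \<bullet> (y - c)) * (4 / (3 * (r c)\<^sup>2)) \<le> 0"
      by (intro mult_nonpos_nonneg) auto
    then show ?thesis unfolding b_def by (rule smooth_step_0)
  qed
  have b_range: "b c y \<in> {0..1}" for c y unfolding b_def by (rule smooth_step_range)
  \<comment> \<open>One minus the product of the complements is 1 wherever one of the bumps is 1 and
    0 where all of them vanish. No normalization as in a partition of unity is needed.\<close>
  let ?b = "\<lambda>y. 1 - (\<Prod>c\<in>F. (1 - b c y))"
  have "Ck_on k (\<lambda>y. \<Prod>c\<in>F. (1 - b c y)) UNIV" for k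
    using F(2)
  proof (induction F rule: finite_induct)
    case (insert c F)
    have "Ck_on k (\<lambda>y. (1 + (-1) * b c y) * (\<Prod>c\<in>F. (1 - b c y))) UNIV"
      by (intro Ck_on_mult Ck_on_add Ck_on_const b_smooth insert.IH open_UNIV)
    then show ?case using insert.hyps by simp
  qed (simp add: Ck_on_const)
  then have "Ck_on k (\<lambda>y. 1 + (-1) * (\<Prod>c\<in>F. (1 - b c y))) UNIV" for k
    by (intro Ck_on_mult Ck_on_add Ck_on_const open_UNIV)
  then have s: "Ck_on k ?b UNIV" for k by simp
  show ?thesis
  proof (rule that[OF s, of "\<Union>c\<in>F. cball c (r c)"])
    show "?b y \<in> {0..1}" for y
      using b_range by (auto intro!: prod_nonneg prod_le_1)
    show "?b y = 1" if "y \<in> C" for y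
    proof -
      obtain c where "c \<in> F" "y \<in> ball c (r c / 2)" using F(3) \<open>y \<in> C\<close> by blast
      then have "(\<Prod>c\<in>F. (1 - b c y)) = 0" using F(2) b1 by (auto intro!: prod_zero bexI[of _ c])
      then show ?thesis by simp
    qed
    show "closed (\<Union>c\<in>F. cball c (r c))" using F(2) by auto
    show "(\<Union>c\<in>F. cball c (r c)) \<subseteq> U" using r(2) F(1) by blast
    show "?b y = 0" if "y \<notin> (\<Union>c\<in>F. cball c (r c))" for y
      using that b0 by auto
  qed
qed

section \<open>Maps close to the identity\<close>

text \<open>Mean value inequality on a convex set. A Lipschitz constant of \<open>F - id\<close>
  below 1 is what makes \<open>F\<close> injective; 1/2 is a convenient choice.\<close>

lemma near_identity_lipschitz:
  fixes F :: "'a::euclidean_space \<Rightarrow> 'a"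
  assumes "convex U" "Ck_on (Suc 0) F U"
    and bound: "\<And>x w. x \<in> U \<Longrightarrow> norm (frechet_derivative F (at x) w - w) \<le> norm w / 2"
    and xy: "x \<in> U" "y \<in> U"
  shows "norm ((F x - x) - (F y - y)) \<le> norm (x - y) / 2"
proof -
  have "norm ((F x - x) - (F y - y)) \<le> 1/2 * norm (x - y)"
  proof (rule differentiable_bound[OF assms(1) _ _ xy])
    show "((\<lambda>x. F x - x) has_derivative (\<lambda>w. frechet_derivative F (at z) w - w)) (at z within U)"
      if "z \<in> U" for z
      by (rule has_derivative_diff[OF has_derivative_at_withinI[OF
            has_derivative_frechet_if_Ck_Suc[OF assms(2) that]] has_derivative_ident])
    show "onorm (\<lambda>w. frechet_derivative F (at z) w - w) \<le> 1/2" if "z \<in> U" for z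
      using bound[OF that] by (intro onorm_bound) auto
  qed
  then show ?thesis by simp
qed

text \<open>An inverse function theorem with a prescribed domain, the whole convex set
  \<open>U\<close>: injectivity comes from the contraction estimate, openness of the image from
  invariance of domain, and smoothness of the inverse from bootstrapping with the inverse
  derivatives.\<close>

lemma near_identity_inverse:
  fixes F :: "'a::euclidean_space \<Rightarrow> 'a"
  assumes U: "open U" "convex U" and F: "\<And>k. Ck_on k F U"
    and bound: "\<And>x w. x \<in> U \<Longrightarrow> norm (frechet_derivative F (at x) w - w) \<le> norm w / 2"
  obtains G where "\<And>x. x \<in> U \<Longrightarrow> G (F x) = x" "open (F ` U)" "\<And>k. Ck_on k G (F ` U)"
proof -
  let ?F' = "\<lambda>x. frechet_derivative F (at x)"
  have F': "(F has_derivative ?F' x) (at x)" if "x \<in> U" for x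
    using F that by (rule has_derivative_frechet_if_Ck_Suc)
  have lin: "linear (?F' x)" if "x \<in> U" for x
    using F'[OF that] by (rule has_derivative_linear)
  have lower: "norm w \<le> 2 * norm (?F' x w)" if "x \<in> U" for x w
    using bound[OF that, of w] norm_triangle_ineq2[of w "?F' x w"] by (simp add: norm_minus_commute)
  have inj: "inj_on F U"
  proof (rule inj_onI)
    fix x y assume "x \<in> U" "y \<in> U" "F x = F y"
    then have "norm (y - x) \<le> norm (x - y) / 2"
      using near_identity_lipschitz[OF U(2) F bound, of x y] by simp
    then show "x = y" by (simp add: norm_minus_commute)
  qed
  define G where "G = the_inv_into U F"
  have GF: "G (F x) = x" if "x \<in> U" for x
    unfolding G_def using inj that by (rule the_inv_into_f_f)
  have contF: "continuous_on U F" using F by (rule Ck_on_imp_continuous)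
  have op: "open (F ` U)" by (rule invariance_of_domain[OF contF U(1) inj])
  have contG: "continuous_on (F ` U) G"
    by (rule continuous_on_inverse_open[OF U(1) contF]) (auto simp: GF)
  define P where "P x = inv (?F' x)" for x
  have inj': "inj (?F' x)" if "x \<in> U" for x
    unfolding linear_injective_0[OF lin[OF that]]
  proof (intro allI impI)
    fix w assume "?F' x w = 0"
    then show "w = 0" using lower[OF that, of w] by simp
  qed
  have bij': "bij (?F' x)" if "x \<in> U" for x
    using linear_injective_imp_surjective[OF lin inj'] inj' that by (simp add: bij_def)
  have P1: "?F' x (P x w) = w" "P x (?F' x w) = w" if "x \<in> U" for x w
    using bij'[OF that] by (simp_all add: P_def bij_is_surj surj_f_inv_f bij_is_inj)
  have Plin: "linear (P x)" if "x \<in> U" for x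
    unfolding P_def using inj_linear_imp_inv_linear[OF lin inj'] that by blast
  have Pbound: "norm (P x w) \<le> 2 * norm w" if "x \<in> U" for x w
    using lower[OF that, of "P x w"] P1(1)[OF that] by simp
  have Psmooth: "Ck_on k (\<lambda>x. P x v) U" for k v
    by (rule smooth_inverse_family[OF U(1) Ck_on_frechet_derivative[OF F] lin Plin Pbound P1])
  have GC: "Ck_on k G (F ` U)" for k
  proof (rule smooth_bootstrap[OF U(1) op _ contG _ Psmooth])
    show "G ` F ` U \<subseteq> U" using GF by auto
    fix y assume y: "y \<in> F ` U"
    then have "G y \<in> U" using GF by auto
    show "(G has_derivative P (G y)) (at y)"
    proof (rule has_derivative_inverse_basic[where g = G and y = y and T = "F ` U", OF F'[OF \<open>G y \<in> U\<close>] _ _ _ op y])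
      show "bounded_linear (P (G y))"
        using Plin[OF \<open>G y \<in> U\<close>] by (rule linear_conv_bounded_linear[THEN iffD1])
      show "P (G y) \<circ> ?F' (G y) = id"
        using P1(2)[OF \<open>G y \<in> U\<close>] by auto
      show "continuous (at y) G"
        using contG y continuous_on_eq_continuous_at[OF op] by blast
    qed (use GF in auto)
  qed
  show ?thesis by (rule that[OF GF op GC])
qed

text \<open>\<open>N\<close> may have boundary or corners, so the estimate on derivatives is stated
  for a smooth extension of \<open>\<Phi> _ v\<close> to a full ball. The radius serves all small
  \<open>v\<close> at once.\<close>

lemma near_identity_local:
  fixes \<Phi> :: "'a::euclidean_space \<Rightarrow> real \<Rightarrow> 'a"
  assumes "smooth_on (N \<times> J) (\<lambda>(y, v). \<Phi> y v)" "0 \<in> J" "\<And>y. y \<in> N \<Longrightarrow> \<Phi> y 0 = y" and c: "c \<in> N"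
  obtains r where "r > 0" "\<And>v. v \<in> J \<Longrightarrow> \<bar>v\<bar> < r \<Longrightarrow> \<exists>F. (\<forall>k. Ck_on k F (ball c r)) \<and>
     (\<forall>x\<in>ball c r. \<forall>w. norm (frechet_derivative F (at x) w - w) \<le> norm w / 2) \<and>
     (\<forall>x\<in>ball c r \<inter> N. F x = \<Phi> x v)"
proof -
  have "(c, 0) \<in> N \<times> J" using assms by simp
  obtain U G where G: "open U" "(c, 0) \<in> U" "\<forall>k. Ck_on k G U"
      "\<forall>y\<in>U \<inter> (N \<times> J). G y = (\<lambda>(y, v). \<Phi> y v) y"
    by (rule smooth_onE[OF assms(1) \<open>(c, 0) \<in> N \<times> J\<close>])
  have split: "\<exists>r>0. ball c r \<times> ball (0::real) r \<subseteq> W" if W: "open W" "(c, 0) \<in> W" for W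
  proof -
    obtain A B where "open A" "open B" "c \<in> A" "0 \<in> B" "A \<times> B \<subseteq> W"
      using W by (auto elim: open_prod_elim)
    moreover then obtain r s where "r > 0" "ball c r \<subseteq> A" "s > 0" "ball 0 s \<subseteq> B"
      by (meson open_contains_ball)
    ultimately show ?thesis
      by (intro exI[of _ "min r s"]) (auto simp: subset_iff)
  qed
  obtain r0 where r0: "r0 > 0" "ball c r0 \<times> ball 0 r0 \<subseteq> U" using split[OF G(1,2)] by blast
  let ?W = "ball c r0 \<times> ball (0::real) r0"
  have oW: "open ?W" by (intro open_Times) auto
  have GC: "Ck_on k G ?W" for k using G(3) r0(2) Ck_on_mono by blast
  let ?G' = "\<lambda>z. frechet_derivative G (at z)"
  have G': "(G has_derivative ?G' z) (at z)" if "z \<in> ?W" for z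
    using GC that by (rule has_derivative_frechet_if_Ck_Suc)
  \<comment> \<open>The change of the derivative in direction \<open>b\<close> between time 0 and
    the time of \<open>z\<close>. It is continuous and vanishes at time 0, so the sum over the basis
    stays below 1/2 near \<open>(c, 0)\<close>.\<close>
  define A where "A b z = ?G' z (b, 0) - ?G' (fst z, 0) (b, 0)" for b z
  have contG': "continuous_on ?W (\<lambda>z. ?G' z (b, 0))" for b
    using Ck_on_imp_continuous[OF Ck_on_frechet_derivative[OF GC]] .
  have "continuous_on ?W (\<lambda>z. ?G' (fst z, 0) (b, 0))" for b
    by (rule continuous_on_compose2[OF contG', where f = "\<lambda>z. (fst z, 0)"])
      (use r0 in \<open>auto intro!: continuous_intros\<close>)
  then have contA: "continuous_on ?W (\<lambda>z. \<Sum>b\<in>Basis. norm (A b z))"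
    unfolding A_def by (intro continuous_intros contG')
  let ?V = "?W \<inter> (\<lambda>z. \<Sum>b\<in>Basis. norm (A b z)) -` {..<1/2}"
  have "open ?V" using continuous_open_preimage[OF contA oW] by auto
  moreover have "(c, 0) \<in> ?V" using r0 by (simp add: A_def)
  ultimately obtain r where r: "r > 0" "ball c r \<times> ball 0 r \<subseteq> ?V" using split by blast
  show ?thesis
  proof (rule that[OF r(1)])
    fix v assume v: "v \<in> J" "\<bar>v\<bar> < r"
    \<comment> \<open>The extension \<open>G\<close> need not be the identity at time 0 outside
      \<open>N\<close>, so \<open>G (_, v)\<close> itself could be far from the identity there.
      Subtracting \<open>G (y, 0)\<close> corrects this and changes nothing on \<open>N\<close>,
      where \<open>G (y, 0) = y\<close>.\<close>
    define F where "F y = y + (G (y, v) - G (y, 0))" for y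
    have inW: "(x, v) \<in> ?V" "(x, 0) \<in> ?V" if "x \<in> ball c r" for x
      using r r0(1) that v by (auto simp: subset_iff)
    have slice: "Ck_on k (\<lambda>y. G (y, s)) (ball c r)" if "s = v \<or> s = 0" for k s
      by (rule Ck_on_compose[OF open_ball oW _ _ GC, where f = "\<lambda>y. (y, s)"])
        (use that inW in \<open>auto intro!: Ck_on_Pair Ck_on_const Ck_on_ident\<close>)
    have FC: "Ck_on k F (ball c r)" for k
    proof -
      have "Ck_on k (\<lambda>y. y + (G (y, v) + - G (y, 0))) (ball c r)"
        by (intro Ck_on_add Ck_on_ident open_ball slice
            Ck_on_bounded_linear_compose[OF _ bounded_linear_minus[OF bounded_linear_ident]]) auto
      then show ?thesis by (simp add: F_def[abs_def])
    qed
    have FN: "F x = \<Phi> x v" if "x \<in> ball c r \<inter> N" for x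
    proof -
      have "G (x, v) = \<Phi> x v" "G (x, 0) = x"
        using G(4) inW[of x] that v r0(2) assms(2,3) by (auto simp: subset_iff)
      then show ?thesis by (simp add: F_def)
    qed
    have "norm (frechet_derivative F (at x) w - w) \<le> norm w / 2" if x: "x \<in> ball c r" for x w
    proof -
      have sl: "((\<lambda>y. G (y, s)) has_derivative (\<lambda>w. ?G' (x, s) (w, 0))) (at x)" if "s = v \<or> s = 0" for s
        using has_derivative_compose[OF has_derivative_Pair[OF has_derivative_ident has_derivative_const] G']
          inW[OF x] that by auto
      have "(F has_derivative (\<lambda>w. w + (?G' (x, v) (w, 0) - ?G' (x, 0) (w, 0)))) (at x)"
        unfolding F_def[abs_def] by (intro has_derivative_add has_derivative_diff has_derivative_ident sl) auto
      then have "frechet_derivative F (at x) = (\<lambda>w. w + (?G' (x, v) (w, 0) - ?G' (x, 0) (w, 0)))"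
        by (rule frechet_derivative_at[symmetric])
      then have "frechet_derivative F (at x) w - w = ?G' (x, v) (w, 0) - ?G' (x, 0) (w, 0)" by simp
      also have "\<dots> = (\<Sum>b\<in>Basis. (w \<bullet> b) *\<^sub>R A b (x, v))"
      proof -
        have "?G' z (w, 0) = (\<Sum>b\<in>Basis. (w \<bullet> b) *\<^sub>R ?G' z (b, 0))" if "z \<in> ?W" for z
        proof -
          have "linear (\<lambda>w. ?G' z (w, 0))"
            using linear_compose[OF _ has_derivative_linear[OF G'[OF that]], of "\<lambda>w. (w, 0)"]
            by (simp add: o_def linear_iff)
          then show ?thesis by (rule linear_basis_expansion)
        qed
        then show ?thesis using inW[OF x]
          by (simp add: A_def sum_subtractf scaleR_diff_right)
      qed
      also have "norm \<dots> \<le> (\<Sum>b\<in>Basis. norm (A b (x, v)) * norm w)"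
        by (auto intro!: sum_norm_le mult_right_mono Basis_le_norm simp: mult.commute)
      also have "\<dots> = (\<Sum>b\<in>Basis. norm (A b (x, v))) * norm w" by (simp add: sum_distrib_right)
      also have "\<dots> \<le> 1/2 * norm w"
        using inW(1)[OF x] by (intro mult_right_mono) auto
      finally show ?thesis by simp
    qed
    then show "\<exists>F. (\<forall>k. Ck_on k F (ball c r)) \<and>
       (\<forall>x\<in>ball c r. \<forall>w. norm (frechet_derivative F (at x) w - w) \<le> norm w / 2) \<and>
       (\<forall>x\<in>ball c r \<inter> N. F x = \<Phi> x v)"
      using FC FN by blast
  qed
qed

text \<open>Smallness of \<open>v\<close> gives injectivity and a smooth inverse, but not
  surjectivity, since nothing is assumed about \<open>N\<close> beyond compactness. Surjectivity is
  therefore a premise, to be met by a separate argument.\<close>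

lemma near_identity_diffeomorphism:
  fixes \<Phi> :: "'a::euclidean_space \<Rightarrow> real \<Rightarrow> 'a"
  assumes N: "compact N" and J: "compact J" "0 \<in> J"
    and \<Phi>: "smooth_on (N \<times> J) (\<lambda>(y, v). \<Phi> y v)" "\<And>y. y \<in> N \<Longrightarrow> \<Phi> y 0 = y"
  obtains \<delta> where "\<delta> > 0" "\<And>v. v \<in> J \<Longrightarrow> \<bar>v\<bar> < \<delta> \<Longrightarrow> (\<lambda>y. \<Phi> y v) ` N = N \<Longrightarrow>
      \<exists>g. diffeomorphism N N (\<lambda>y. \<Phi> y v) g"
proof -
  let ?loc = "\<lambda>c r v. \<exists>F. (\<forall>k. Ck_on k F (ball c r)) \<and>
     (\<forall>x\<in>ball c r. \<forall>w. norm (frechet_derivative F (at x) w - w) \<le> norm w / 2) \<and>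
     (\<forall>x\<in>ball c r \<inter> N. F x = \<Phi> x v)"
  have "\<exists>r>0. \<forall>v\<in>J. \<bar>v\<bar> < r \<longrightarrow> ?loc c r v" if "c \<in> N" for c
    by (rule near_identity_local[OF \<Phi>(1) J(2) \<Phi>(2) that]) blast+
  then obtain r where r: "\<And>c. c \<in> N \<Longrightarrow> r c > 0"
      "\<And>c v. c \<in> N \<Longrightarrow> v \<in> J \<Longrightarrow> \<bar>v\<bar> < r c \<Longrightarrow> ?loc c (r c) v"
    by metis
  have "N \<subseteq> (\<Union>c\<in>N. ball c (r c / 2))" using r(1) by force
  then obtain C where C: "C \<subseteq> N" "finite C" "N \<subseteq> (\<Union>c\<in>C. ball c (r c / 2))"
    using compactE_image[OF N, of N "\<lambda>c. ball c (r c / 2)"] by auto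
  \<comment> \<open>A common lower bound for the finitely many radii. The 1 keeps the minimum
    defined when \<open>N\<close> is empty.\<close>
  define \<rho> where "\<rho> = Min (insert 1 (r ` C))"
  have \<rho>: "\<rho> > 0" "\<And>c. c \<in> C \<Longrightarrow> \<rho> \<le> r c"
    unfolding \<rho>_def using C(1,2) r(1) by (auto simp: subset_iff)
  have "uniformly_continuous_on (N \<times> J) (\<lambda>(y, v). \<Phi> y v)"
    by (intro compact_uniformly_continuous compact_Times N J smooth_on_imp_continuous_on \<Phi>)
  then obtain d where d: "d > 0" "\<And>z z'. z \<in> N \<times> J \<Longrightarrow> z' \<in> N \<times> J \<Longrightarrow> dist z' z < d \<Longrightarrow>
      dist ((\<lambda>(y, v). \<Phi> y v) z') ((\<lambda>(y, v). \<Phi> y v) z) < \<rho> / 4"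
    unfolding uniformly_continuous_on_def using \<rho>(1) by (metis zero_less_divide_iff zero_less_numeral)
  have near: "norm (\<Phi> y v - y) < \<rho> / 4" if "y \<in> N" "v \<in> J" "\<bar>v\<bar> < d" for y v
    using d(2)[of "(y, 0)" "(y, v)"] that J(2) \<Phi>(2) by (simp add: dist_Pair_Pair dist_norm)
  show ?thesis
  proof (rule that[of "min d \<rho>"])
    show "min d \<rho> > 0" using d \<rho> by simp
    fix v assume v: "v \<in> J" "\<bar>v\<bar> < min d \<rho>" and surj: "(\<lambda>y. \<Phi> y v) ` N = N"
    have loc: "?loc c (r c) v" if "c \<in> C" for c
      using r(2)[of c v] that C(1) v \<rho>(2)[OF that] by auto
    have inj: "inj_on (\<lambda>y. \<Phi> y v) N"
    proof (rule inj_onI)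
      fix x y assume xy: "x \<in> N" "y \<in> N" "\<Phi> x v = \<Phi> y v"
      \<comment> \<open>Points with equal images differ by two displacements, each below
        \<open>\<rho>/4\<close>. As one of them lies in a half ball, both lie in the full ball,
        where the contraction estimate applies.\<close>
      have "norm (x - y) = norm ((\<Phi> y v - y) - (\<Phi> x v - x))" using xy(3) by simp
      also have "\<dots> \<le> norm (\<Phi> y v - y) + norm (\<Phi> x v - x)" by (rule norm_triangle_ineq4)
      also have "\<dots> < \<rho> / 2" using near[of x v] near[of y v] xy v by simp
      finally have close: "norm (x - y) < \<rho> / 2" .
      obtain c where c: "c \<in> C" "x \<in> ball c (r c / 2)" using C(3) xy(1) by blast
      moreover have "r c > 0" using r(1) C(1) c(1) by blast
      ultimately have "x \<in> ball c (r c)" "y \<in> ball c (r c)"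
        using close \<rho>(2)[OF c(1)] dist_triangle[of c y x] by (auto simp: dist_norm norm_minus_commute)
      moreover obtain F where F: "\<forall>k. Ck_on k F (ball c (r c))"
          "\<forall>x\<in>ball c (r c). \<forall>w. norm (frechet_derivative F (at x) w - w) \<le> norm w / 2"
          "\<forall>x\<in>ball c (r c) \<inter> N. F x = \<Phi> x v" using loc[OF c(1)] by blast
      ultimately have "norm ((F x - x) - (F y - y)) \<le> norm (x - y) / 2"
        by (intro near_identity_lipschitz[of "ball c (r c)"]) auto
      moreover have "F x = F y" using F(3) xy \<open>x \<in> ball c (r c)\<close> \<open>y \<in> ball c (r c)\<close> by simp
      ultimately show "x = y" by (simp add: norm_minus_commute)
    qed
    have sm: "smooth_on N (\<lambda>y. \<Phi> y v)"
      using smooth_on_compose[OF \<Phi>(1) smooth_on_Pair[OF smooth_on_ident smooth_on_const[of _ v]], of N] v by force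
    define g where "g = the_inv_into N (\<lambda>y. \<Phi> y v)"
    have g1: "g (\<Phi> x v) = x" if "x \<in> N" for x
      unfolding g_def using inj that by (rule the_inv_into_f_f)
    have g2: "\<Phi> (g z) v = z" "g z \<in> N" if "z \<in> N" for z
      using that surj g1 by (metis (no_types, lifting) imageE)+
    have contg: "continuous_on N g"
      using continuous_on_inv[OF smooth_on_imp_continuous_on[OF sm] N, of g] g1 surj by simp
    have smg: "smooth_on N g"
    proof (rule smooth_onI)
      fix z assume z: "z \<in> N"
      obtain c where c: "c \<in> C" "g z \<in> ball c (r c / 2)" using C(3) g2(2)[OF z] by blast
      obtain F where F: "\<forall>k. Ck_on k F (ball c (r c))"
          "\<forall>x\<in>ball c (r c). \<forall>w. norm (frechet_derivative F (at x) w - w) \<le> norm w / 2"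
          "\<forall>x\<in>ball c (r c) \<inter> N. F x = \<Phi> x v" using loc[OF c(1)] by blast
      let ?B = "ball c (r c)"
      obtain G where G: "\<And>x. x \<in> ?B \<Longrightarrow> G (F x) = x" "open (F ` ?B)" "\<And>k. Ck_on k G (F ` ?B)"
        using near_identity_inverse[of ?B F] F by auto
      \<comment> \<open>The local inverse \<open>G\<close> of \<open>F\<close> agrees with
        \<open>g\<close> only where \<open>g\<close> takes values in the ball, so its domain is cut
        down to \<open>O'\<close>.\<close>
      have "openin (top_of_set N) (N \<inter> g -` ?B)"
        using contg by (rule continuous_openin_preimage_gen) auto
      then obtain O' where O': "open O'" "N \<inter> g -` ?B = N \<inter> O'" by (auto simp: openin_open)
      have gB: "g y \<in> ?B" "F (g y) = y" if "y \<in> O' \<inter> N" for y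
      proof -
        show gy: "g y \<in> ?B" using that O'(2) by blast
        then show "F (g y) = y" using F(3) g2 that by simp
      qed
      have "r c > 0" using r(1) C(1) c(1) by blast
      then have "g z \<in> ?B" using c(2) by simp
      then have "z \<in> O'" using z O'(2) by blast
      show "\<exists>U F. open U \<and> z \<in> U \<and> (\<forall>k. Ck_on k F U) \<and> (\<forall>y\<in>U \<inter> N. F y = g y)"
      proof (intro exI conjI allI ballI)
        show "open (F ` ?B \<inter> O')" using G(2) O'(1) by blast
        show "z \<in> F ` ?B \<inter> O'" using gB[of z] \<open>z \<in> O'\<close> z by (metis IntI imageI)
        show "Ck_on k G (F ` ?B \<inter> O')" for k using G(3) by (rule Ck_on_mono) blast
        show "G y = g y" if "y \<in> F ` ?B \<inter> O' \<inter> N" for y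
          using gB[of y] G(1)[of "g y"] that by simp
      qed
    qed
    have "g ` N = N" using g1 g2 surj by (auto simp: image_iff) (metis imageI)
    then have "diffeomorphism N N (\<lambda>y. \<Phi> y v) g"
      unfolding diffeomorphism_def using sm smg surj g1 g2 by simp
    then show "\<exists>g. diffeomorphism N N (\<lambda>y. \<Phi> y v) g" by blast
  qed
qed

section \<open>Isotopy extension\<close>

text \<open>\<open>T a b\<close> moves points from their positions at time \<open>a\<close> to those at time \<open>b\<close>.\<close>

locale transport =
  fixes X :: "'a::euclidean_space set" and T :: "real \<Rightarrow> real \<Rightarrow> 'a \<Rightarrow> 'a"
  assumes transport_in: "a \<in> {0..1} \<Longrightarrow> b \<in> {0..1} \<Longrightarrow> y \<in> X \<Longrightarrow> T a b y \<in> X"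
    and transport_id: "a \<in> {0..1} \<Longrightarrow> y \<in> X \<Longrightarrow> T a a y = y"
    and transport_trans: "a \<in> {0..1} \<Longrightarrow> b \<in> {0..1} \<Longrightarrow> c \<in> {0..1} \<Longrightarrow> y \<in> X \<Longrightarrow>
      T b c (T a b y) = T a c y"
    and transport_smooth: "a \<in> {0..1} \<Longrightarrow> smooth_on (X \<times> {0..1}) (\<lambda>(y, b). T a b y)"
    and transport_continuous: "a \<in> {0..1} \<Longrightarrow> y \<in> X \<Longrightarrow> continuous_on {0..1} (\<lambda>b. T b a y)"

lemma unit_interval_interpolate:
  assumes "a \<in> {0..1}" "v \<in> {- a..1 - a}" "l \<in> {0..1}"
  shows "a + v * l \<in> {0..1::real}"
proof -
  have "a + v * l = (1 - l) * a + l * (a + v)" by algebra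
  moreover have "(1 - l) * a + l * (a + v) \<le> (1 - l) * 1 + l * 1"
    using assms by (intro add_mono mult_left_mono) auto
  moreover have "0 \<le> (1 - l) * a" "0 \<le> l * (a + v)"
    using assms by simp_all
  ultimately show ?thesis by simp
qed

text \<open>
  The time-change trick that replaces integration of a cut-off vector field: a point \<open>y\<close> travels for
  time \<open>v \<lambda>(y)\<close> with a bump function \<open>\<lambda>\<close>. This is close to the identity for small \<open>v\<close>, hence
  injective, and it is surjective by the intermediate value theorem, applied to the travelling time.
\<close>

lemma (in transport) isotopy_extension_step:
  assumes N: "compact N" and X: "openin (top_of_set N) X"
    and P: "openin (top_of_set N) P" "P \<subseteq> X" and C: "compact C" "C \<subseteq> P" and a: "a \<in> {0..1}"
  obtains \<delta> where "\<delta> > 0" "\<And>b. b \<in> {0..1} \<Longrightarrow> \<bar>b - a\<bar> < \<delta> \<Longrightarrow>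
      \<exists>H. ambient_isotopy N H \<and> (\<forall>t\<in>{0..1}. \<forall>x\<in>N - P. H t x = x) \<and> (\<forall>x\<in>C. H 1 x = T a b x)"
proof -
  obtain U where U: "open U" "P = N \<inter> U" using P(1) by (auto simp: openin_open)
  obtain l :: "'a \<Rightarrow> real" and D where l: "\<And>k. Ck_on k l UNIV" "\<And>x. l x \<in> {0..1}"
      "\<And>x. x \<in> C \<Longrightarrow> l x = 1" "closed D" "D \<subseteq> U" "\<And>x. x \<notin> D \<Longrightarrow> l x = 0"
    using smooth_bump[OF C(1) U(1)] C(2) U(2) by blast
  have XN: "X \<subseteq> N" using X by (rule openin_imp_subset)
  let ?J = "{- a..1 - a}"
  \<comment> \<open>\<open>T\<close> is controlled on \<open>X\<close> only, while the isotopy must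
    be defined on the closed product \<open>N\<close>. The cut-off makes the two cases fit
    together.\<close>
  define \<Phi> where "\<Phi> y v = (if y \<in> X then T a (a + v * l y) y else y)" for y v
  have time: "a + v * l y \<in> {0..1}" if "v \<in> ?J" for v y
    using unit_interval_interpolate[OF a that l(2)] .
  have \<Phi>_off: "\<Phi> y v = y" if "y \<notin> D" for y v
    using that l(6) transport_id[OF a] by (simp add: \<Phi>_def)
  have sm: "smooth_on (N \<times> ?J) (\<lambda>(y, v). \<Phi> y v)"
  proof (rule smooth_on_local)
    \<comment> \<open>Two relatively open pieces cover the domain: \<open>X\<close>, where the
      transport formula is smooth, and the complement of \<open>D\<close>, where the map is the
      identity. They cover because \<open>D\<close> meets \<open>N\<close> only inside
      \<open>P\<close>.\<close>
    fix z assume z: "z \<in> N \<times> ?J"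
    show "\<exists>W. openin (top_of_set (N \<times> ?J)) W \<and> z \<in> W \<and> smooth_on W (\<lambda>(y, v). \<Phi> y v)"
    proof (cases "fst z \<in> X")
      case True
      have "smooth_on (X \<times> ?J) (\<lambda>z. l (fst z))"
        by (rule smooth_on_compose[OF smooth_on_open[OF open_UNIV l(1) subset_UNIV]])
          (auto intro: smooth_on_intros)
      then have "smooth_on (X \<times> ?J) (\<lambda>z. (fst z, a + snd z * l (fst z)))"
        by (intro smooth_on_intros)
      then have "smooth_on (X \<times> ?J) (\<lambda>z. (\<lambda>(y, b). T a b y) (fst z, a + snd z * l (fst z)))"
        by (rule smooth_on_compose[OF transport_smooth[OF a]]) (use time in auto)
      then have "smooth_on (X \<times> ?J) (\<lambda>(y, v). \<Phi> y v)"
        by (rule smooth_on_cong) (auto simp: \<Phi>_def)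
      moreover have "openin (top_of_set (N \<times> ?J)) (X \<times> ?J)"
        by (intro openin_Times X openin_subtopology_self)
      ultimately show ?thesis using z True by (intro exI[of _ "X \<times> ?J"]) (auto simp: mem_Times_iff)
    next
      case False
      then have "fst z \<notin> D" using z P(2) U(2) l(5) by (auto simp: mem_Times_iff)
      have "smooth_on ((N - D) \<times> ?J) (\<lambda>z. fst z)" by (intro smooth_on_intros)
      then have "smooth_on ((N - D) \<times> ?J) (\<lambda>(y, v). \<Phi> y v)"
        by (rule smooth_on_cong) (auto simp: \<Phi>_off)
      moreover have "openin (top_of_set (N \<times> ?J)) ((N - D) \<times> ?J)"
        using l(4) by (intro openin_Times openin_subtopology_self) (simp add: Diff_eq openin_open_Int open_Compl)
      ultimately show ?thesis using z \<open>fst z \<notin> D\<close> by (intro exI[of _ "(N - D) \<times> ?J"]) (auto simp: mem_Times_iff)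
    qed
  qed
  have \<Phi>_0: "\<Phi> y 0 = y" for y using transport_id[OF a] by (simp add: \<Phi>_def)
  have J0: "0 \<in> ?J" using a by simp
  obtain \<delta> where \<delta>: "\<delta> > 0" "\<And>v. v \<in> ?J \<Longrightarrow> \<bar>v\<bar> < \<delta> \<Longrightarrow> (\<lambda>y. \<Phi> y v) ` N = N \<Longrightarrow>
      \<exists>g. diffeomorphism N N (\<lambda>y. \<Phi> y v) g"
    using near_identity_diffeomorphism[OF N compact_Icc J0 sm \<Phi>_0] by blast
  have surj: "(\<lambda>y. \<Phi> y v) ` N = N" if v: "v \<in> ?J" for v
  proof (intro equalityI subsetI)
    fix z assume "z \<in> (\<lambda>y. \<Phi> y v) ` N"
    then show "z \<in> N" using XN transport_in[OF a time[OF v]] by (auto simp: \<Phi>_def)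
  next
    fix z assume z: "z \<in> N"
    show "z \<in> (\<lambda>y. \<Phi> y v) ` N"
    proof (cases "z \<in> X")
      case False
      then show ?thesis using z by (auto simp: \<Phi>_def image_iff)
    next
      case True
      have tm: "a + v * s \<in> {0..1}" if "s \<in> {0..1}" for s
        using unit_interval_interpolate[OF a v that] .
      \<comment> \<open>A preimage of \<open>z\<close> is sought among the points
        \<open>T (a + v * s) a z\<close>, which reach \<open>z\<close> after travelling for time
        \<open>v * s\<close>. Such a point works if its bump value is \<open>s\<close>, and
        \<open>h\<close>, being nonnegative at 0 and nonpositive at 1, has a zero.\<close>
      define h where "h s = l (T (a + v * s) a z) - s" for s
      have "continuous_on {0..1} (\<lambda>s. T (a + v * s) a z)"
        by (rule continuous_on_compose2[OF transport_continuous[OF a True], where f = "\<lambda>s. a + v * s"])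
          (use tm in \<open>auto intro!: continuous_intros\<close>)
      then have "continuous_on {0..1} (\<lambda>s. l (T (a + v * s) a z))"
        by (rule continuous_on_compose2[OF Ck_on_imp_continuous[OF l(1)]]) auto
      then have cont: "continuous_on {0..1} h" unfolding h_def by (intro continuous_intros)
      have "\<exists>s\<ge>0. s \<le> 1 \<and> h s = 0"
        by (rule IVT2'[OF _ _ _ cont]) (use l(2) in \<open>auto simp: h_def\<close>)
      then obtain s where s: "s \<in> {0..1}" "l (T (a + v * s) a z) = s" by (auto simp: h_def)
      let ?y = "T (a + v * s) a z"
      have y: "?y \<in> X" using transport_in[OF tm[OF s(1)] a True] .
      have "\<Phi> ?y v = T a (a + v * s) ?y" using y s(2) by (simp add: \<Phi>_def)
      also have "\<dots> = z"
        using transport_trans[OF tm[OF s(1)] a tm[OF s(1)] True] transport_id[OF tm[OF s(1)] True] by simp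
      finally show ?thesis using y XN by force
    qed
  qed
  show ?thesis
  proof (rule that[OF \<delta>(1)])
    fix b :: real assume b: "b \<in> {0..1}" "\<bar>b - a\<bar> < \<delta>"
    define H where "H u y = \<Phi> y (u * (b - a))" for u y
    have v: "u * (b - a) \<in> ?J" "\<bar>u * (b - a)\<bar> < \<delta>" if u: "u \<in> {0..1}" for u
    proof -
      have "a + (b - a) * u \<in> {0..1}" by (rule unit_interval_interpolate[OF a _ u]) (use a b in auto)
      then show "u * (b - a) \<in> ?J" by (simp add: algebra_simps)
      have "\<bar>u * (b - a)\<bar> \<le> 1 * \<bar>b - a\<bar>"
        using u unfolding abs_mult by (intro mult_right_mono) auto
      then show "\<bar>u * (b - a)\<bar> < \<delta>" using b(2) by simp
    qed
    have "ambient_isotopy N H"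
      unfolding ambient_isotopy_def
    proof (intro conjI ballI)
      have "smooth_on (N \<times> {0..1}) (\<lambda>z. (\<lambda>(y, v). \<Phi> y v) (fst z, snd z * (b - a)))"
        by (rule smooth_on_compose[OF sm]) (use v in \<open>auto intro!: smooth_on_intros\<close>)
      then show "smooth_on (N \<times> {0..1}) (\<lambda>(x, t). H t x)"
        by (rule smooth_on_cong) (auto simp: H_def)
      show "H 0 x = x" for x by (simp add: H_def \<Phi>_0)
      show "\<exists>g. diffeomorphism N N (H t) g" if "t \<in> {0..1}" for t
        using \<delta>(2)[OF v[OF that] surj[OF v(1)[OF that]]] unfolding H_def .
    qed
    moreover have "H t x = x" if "x \<in> N - P" for t x
    proof -
      have "x \<notin> D" using that U(2) l(5) by blast
      then show ?thesis by (simp add: H_def \<Phi>_off)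
    qed
    moreover have "H 1 x = T a b x" if "x \<in> C" for x
      using that l(3) C(2) P(2) by (auto simp: H_def \<Phi>_def)
    ultimately show "\<exists>H. ambient_isotopy N H \<and> (\<forall>t\<in>{0..1}. \<forall>x\<in>N - P. H t x = x) \<and> (\<forall>x\<in>C. H 1 x = T a b x)"
      by blast
  qed
qed

section \<open>Stable equivalence along a transport\<close>

lemma stably_equivalent_sym: "stably_equivalent k k' \<Longrightarrow> stably_equivalent k' k"
  unfolding stably_equivalent_def by (rule equivclp_sym)

lemma stably_equivalent_trans:
  "stably_equivalent k k' \<Longrightarrow> stably_equivalent k' k'' \<Longrightarrow> stably_equivalent k k''"
  unfolding stably_equivalent_def by (rule equivclp_trans)

lemma stable_move_stably_equivalent: "stable_move k k' \<Longrightarrow> stably_equivalent k k'"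
  unfolding stably_equivalent_def by (rule r_into_equivclp)

lemma virtual_knot_of_eqI: "stably_equivalent k k' \<Longrightarrow> virtual_knot_of k = virtual_knot_of k'"
  unfolding virtual_knot_of_def by (auto intro: stably_equivalent_trans stably_equivalent_sym)

lemma surface_boundary_subset: "surface_boundary S \<subseteq> S"
  unfolding surface_boundary_def local_param_def smooth_embedding_def by blast

text \<open>The extension step covers only times near a given one. Being joined by stable
  equivalence is an equivalence relation on times that holds locally, so connectedness of the unit
  interval gives it for times 0 and 1.\<close>

lemma stably_equivalent_transport:
  fixes S :: "(real^4) set" and k :: "complex \<Rightarrow> (real^4) \<times> real"
  assumes T: "transport (S \<times> {0<..<1}) T"
    and k: "knot_in_thickened_surface (S, A, k)"
    and int: "openin (top_of_set S) (S - surface_boundary S)"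
    and kX: "k ` unit_circle \<subseteq> S \<times> {0<..<1}"
    and track: "\<And>a z. a \<in> {0..1} \<Longrightarrow> z \<in> unit_circle \<Longrightarrow>
      T 0 a (k z) \<in> (S - surface_boundary S) \<times> {0<..<1}"
    and k': "\<And>z. z \<in> unit_circle \<Longrightarrow> k' z = T 0 1 (k z)"
  shows "knot_in_thickened_surface (S, A, k') \<and> stably_equivalent (S, A, k) (S, A, k')"
proof -
  interpret transport "S \<times> {0<..<1}" T by (rule T)
  let ?N = "S \<times> {0..1::real}" and ?X = "S \<times> {0<..<1::real}" and ?P = "(S - surface_boundary S) \<times> {0<..<1::real}"
  \<comment> \<open>The end cases are literally \<open>k\<close> and \<open>k'\<close>: a
    \<open>surface_knot\<close> contains a function on all complex numbers, while the assumptions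
    determine \<open>k'\<close> on the circle only.\<close>
  define K where "K a = (if a = 0 then k else if a = 1 then k' else (\<lambda>z. T 0 a (k z)))" for a
  have KT: "K a z = T 0 a (k z)" if z: "z \<in> unit_circle" for a z
  proof -
    have "k z \<in> S \<times> {0<..<1}" using kX z by blast
    from transport_id[OF _ this, of 0] show ?thesis by (simp add: K_def k'[OF z])
  qed
  define emb where "emb a \<longleftrightarrow> smooth_embedding unit_circle ?N (K a)" for a
  have S: "compact S" "oriented_surface S A" and k_emb: "smooth_embedding unit_circle ?N k"
    using k by (auto simp: knot_in_thickened_surface_def)
  have KX: "K a z \<in> ?X" if "a \<in> {0..1}" "z \<in> unit_circle" for a z
    using track[OF that] by (auto simp: KT[OF that(2)] mem_Times_iff)
  have K_trans: "T a b (K a z) = K b z" if "a \<in> {0..1}" "b \<in> {0..1}" "z \<in> unit_circle" for a b z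
  proof -
    have "k z \<in> ?X" using kX that(3) by blast
    from transport_trans[OF _ that(1,2) this, of 0] show ?thesis by (simp add: KT[OF that(3)])
  qed
  have k_cont: "continuous_on unit_circle k"
    using k_emb by (auto simp: smooth_embedding_def diffeomorphism_def intro: smooth_on_imp_continuous_on)
  have K_compact: "compact (K a ` unit_circle)" if "a \<in> {0..1}" for a
  proof (rule compact_continuous_image)
    have "continuous_on unit_circle (\<lambda>z. (\<lambda>(y, b). T 0 b y) (k z, a))"
      by (rule continuous_on_compose2[OF smooth_on_imp_continuous_on[OF transport_smooth]])
        (use that kX in \<open>auto intro!: continuous_intros k_cont\<close>)
    then show "continuous_on unit_circle (K a)" by (rule continuous_on_eq) (simp add: KT)
  qed auto
  have X: "openin (top_of_set ?N) ?X"
    by (intro openin_Times openin_subtopology_self) (auto intro: open_subset)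
  have P: "openin (top_of_set ?N) ?P"
    by (intro openin_Times int) (auto intro: open_subset)
  \<comment> \<open>That the intermediate curves are smooth embeddings is not known beforehand. The
    relation therefore carries this property along with stable equivalence.\<close>
  define R where "R a b \<longleftrightarrow> (emb a \<longleftrightarrow> emb b) \<and>
      (emb a \<longrightarrow> stably_equivalent (S, A, K a) (S, A, K b))" for a b
  have "R 0 1"
  proof (rule connected_equivalence_relation[of "{0..1}"])
    show "R b a" if "R a b" for a b
      using that stably_equivalent_sym unfolding R_def by blast
    show "R a c" if "R a b" "R b c" for a b c
      using that stably_equivalent_trans unfolding R_def by blast
  next
    fix a :: real assume a: "a \<in> {0..1}"
    have KP: "K a ` unit_circle \<subseteq> ?P" using track[OF a] by (intro image_subsetI) (simp only: KT)
    obtain \<delta> where \<delta>: "\<delta> > 0" "\<And>b. b \<in> {0..1} \<Longrightarrow> \<bar>b - a\<bar> < \<delta> \<Longrightarrow>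
      \<exists>H. ambient_isotopy ?N H \<and> (\<forall>t\<in>{0..1}. \<forall>x\<in>?N - ?P. H t x = x) \<and>
        (\<forall>x\<in>K a ` unit_circle. H 1 x = T a b x)"
      by (rule isotopy_extension_step[OF compact_Times[OF S(1) compact_Icc] X P _ K_compact[OF a] KP a]) blast+
    have "R a b" if "b \<in> {0..1} \<inter> ball a \<delta>" for b
    proof -
      have b: "b \<in> {0..1}" "\<bar>b - a\<bar> < \<delta>" using that by (auto simp: dist_real_def)
      obtain H where H: "ambient_isotopy ?N H" "\<And>t x. t \<in> {0..1} \<Longrightarrow> x \<in> ?N - ?P \<Longrightarrow> H t x = x"
          "\<And>x. x \<in> K a ` unit_circle \<Longrightarrow> H 1 x = T a b x"
        using \<delta>(2)[OF b] by blast
      have HK: "H 1 (K a z) = K b z" if "z \<in> unit_circle" for z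
        using H(3)[of "K a z"] K_trans[OF a b(1) that] that by simp
      obtain g where g: "diffeomorphism ?N ?N (H 1) g"
        using H(1) unfolding ambient_isotopy_def by force
      have gK: "g (K b z) = K a z" if "z \<in> unit_circle" for z
      proof -
        have "K a z \<in> ?N" using KX[OF a that] by (auto simp: mem_Times_iff)
        then have "g (H 1 (K a z)) = K a z" by (rule diffeomorphism_inverse[OF g])
        then show ?thesis by (simp only: HK[OF that])
      qed
      have ab: "emb b" if "emb a"
        using smooth_embedding_cong[OF smooth_embedding_compose[OF that[unfolded emb_def] g subset_refl]] HK
        unfolding emb_def by simp
      have ba: "emb a" if "emb b"
        using smooth_embedding_cong[OF smooth_embedding_compose[OF that[unfolded emb_def]
              diffeomorphism_sym[OF g] subset_refl]] gK
        unfolding emb_def by simp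
      have "stably_equivalent (S, A, K a) (S, A, K b)" if "emb a"
      proof (rule stable_move_stably_equivalent, rule stable_move.isotopy)
        show "knot_in_thickened_surface (S, A, K a)" "knot_in_thickened_surface (S, A, K b)"
          using that ab S by (auto simp: knot_in_thickened_surface_def emb_def)
        have "\<forall>t\<in>{0..1}. \<forall>x\<in>surface_boundary S \<times> {0..1} \<union> S \<times> {0, 1}. H t x = x"
          using H(2) surface_boundary_subset[of S] by (intro ballI) (auto intro!: H(2))
        then show "isotopic_in_thickened_surface (S, A, K a) (S, A, K b)"
          using H(1) HK unfolding isotopic_in_thickened_surface_def by blast
      qed
      then show ?thesis using ab ba unfolding R_def by blast
    qed
    then show "\<exists>W. openin (top_of_set {0..1}) W \<and> a \<in> W \<and> (\<forall>b\<in>W. R a b)"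
      using a \<delta>(1) by (intro exI[of _ "{0..1} \<inter> ball a \<delta>"]) (auto intro: openin_open_Int)
  qed auto
  moreover have "emb 0" using k_emb by (simp add: emb_def K_def)
  ultimately show ?thesis
    using S by (simp add: R_def emb_def K_def knot_in_thickened_surface_def)
qed

section \<open>Infinite cyclic covers of fibered exteriors\<close>

text \<open>The difference divided by 2 pi is continuous and integer-valued, hence constant on a
  connected set.\<close>

lemma cis_eq_shift:
  assumes Y: "connected Y" and c: "continuous_on Y \<alpha>" "continuous_on Y \<beta>"
    and eq: "\<And>y. y \<in> Y \<Longrightarrow> cis (\<alpha> y) = cis (\<beta> y)"
  shows "\<exists>m::int. \<forall>y\<in>Y. \<alpha> y = \<beta> y + 2 * pi * m"
proof -
  have ex: "\<exists>n::int. \<alpha> y = \<beta> y + 2 * pi * n" if "y \<in> Y" for y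
    using eq[OF that] by (simp add: complex_eq_iff flip: sin_cos_eq_iff)
  have "(\<lambda>y. (\<alpha> y - \<beta> y) / (2 * pi)) constant_on Y"
  proof (rule continuous_discrete_range_constant[OF Y])
    show "continuous_on Y (\<lambda>y. (\<alpha> y - \<beta> y) / (2 * pi))" by (intro continuous_intros c) auto
    fix x assume x: "x \<in> Y"
    show "\<exists>e>0. \<forall>y. y \<in> Y \<and> (\<alpha> y - \<beta> y) / (2 * pi) \<noteq> (\<alpha> x - \<beta> x) / (2 * pi) \<longrightarrow>
        e \<le> norm ((\<alpha> y - \<beta> y) / (2 * pi) - (\<alpha> x - \<beta> x) / (2 * pi))"
    proof (intro exI[of _ 1] conjI allI impI; (elim conjE)?)
      fix y assume y: "y \<in> Y" and ne: "(\<alpha> y - \<beta> y) / (2 * pi) \<noteq> (\<alpha> x - \<beta> x) / (2 * pi)"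
      obtain n m :: int where nm: "\<alpha> y = \<beta> y + 2 * pi * n" "\<alpha> x = \<beta> x + 2 * pi * m"
        using ex x y by blast
      have "(\<alpha> y - \<beta> y) / (2 * pi) = of_int n" "(\<alpha> x - \<beta> x) / (2 * pi) = of_int m"
        by (simp_all add: nm)
      moreover from this ne have "1 \<le> \<bar>n - m\<bar>" by auto
      ultimately show "1 \<le> norm ((\<alpha> y - \<beta> y) / (2 * pi) - (\<alpha> x - \<beta> x) / (2 * pi))"
        by (simp only: real_norm_def of_int_diff[symmetric] of_int_abs[symmetric])
    qed simp
  qed
  then obtain r where r: "\<And>y. y \<in> Y \<Longrightarrow> (\<alpha> y - \<beta> y) / (2 * pi) = r" unfolding constant_on_def by blast
  show ?thesis
  proof (cases "Y = {}")
    case False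
    then obtain x m where "x \<in> Y" and m: "\<alpha> x = \<beta> x + 2 * pi * of_int m" using ex by blast
    then have "r = of_int m" using r[of x] by simp
    then have "\<forall>y\<in>Y. \<alpha> y = \<beta> y + 2 * pi * of_int m" using r by (auto simp: field_simps)
    then show ?thesis by blast
  qed simp
qed

text \<open>An infinite cyclic cover of \<open>E\<close> after its identification with
  \<open>S \<times> (0,1)\<close>: \<open>q\<close> is the covering map and \<open>\<sigma>\<close>
  the deck action. The function \<open>\<theta>\<close> makes the interval coordinate a monotone
  reparametrization of a real-valued lift of \<open>p\<close>.\<close>

locale fibered_cover =
  fixes E :: "(real^4) set" and p :: "real^4 \<Rightarrow> complex" and S :: "(real^4) set"
    and q :: "(real^4) \<times> real \<Rightarrow> real^4" and \<theta> :: "real \<Rightarrow> real"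
    and \<sigma> :: "int \<Rightarrow> (real^4) \<times> real \<Rightarrow> (real^4) \<times> real"
  assumes cover: "covering_space (S \<times> {0<..<1}) q E"
    and conn: "connected (S \<times> {0<..<1::real})"
    and local_diffeo: "y \<in> S \<times> {0<..<1} \<Longrightarrow> \<exists>U g. openin (top_of_set (S \<times> {0<..<1})) U \<and> y \<in> U \<and>
        openin (top_of_set E) (q ` U) \<and> diffeomorphism U (q ` U) q g"
    and level: "y \<in> S \<times> {0<..<1} \<Longrightarrow> p (q y) = cis (\<theta> (snd y))"
    and \<theta>_mono: "strict_mono_on {0<..<1} \<theta>" and \<theta>_cont: "continuous_on {0<..<1} \<theta>"
    and \<sigma>_cont: "continuous_on (S \<times> {0<..<1}) (\<sigma> n)"
    and \<sigma>_in: "y \<in> S \<times> {0<..<1} \<Longrightarrow> \<sigma> n y \<in> S \<times> {0<..<1}"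
    and \<sigma>_q: "y \<in> S \<times> {0<..<1} \<Longrightarrow> q (\<sigma> n y) = q y"
    and \<sigma>_add: "y \<in> S \<times> {0<..<1} \<Longrightarrow> \<sigma> (m + n) y = \<sigma> m (\<sigma> n y)"
    and \<sigma>_transitive: "y \<in> S \<times> {0<..<1} \<Longrightarrow> y' \<in> S \<times> {0<..<1} \<Longrightarrow> q y = q y' \<Longrightarrow> \<exists>!n. \<sigma> n y = y'"
    and E_compact: "compact E" and S_nonempty: "S \<noteq> {}"
begin

abbreviation X :: "((real^4) \<times> real) set" where "X \<equiv> S \<times> {0<..<1}"

abbreviation height :: "(real^4) \<times> real \<Rightarrow> real" where "height y \<equiv> \<theta> (snd y)"

lemma q_in: "y \<in> X \<Longrightarrow> q y \<in> E"
  using covering_space_imp_surjective[OF cover] by blast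

lemma q_smooth: "smooth_on X q"
proof (rule smooth_on_local)
  fix y assume "y \<in> X"
  then obtain U g where "openin (top_of_set X) U" "y \<in> U" "diffeomorphism U (q ` U) q g"
    using local_diffeo by blast
  then show "\<exists>W. openin (top_of_set X) W \<and> y \<in> W \<and> smooth_on W q"
    unfolding diffeomorphism_def by blast
qed

lemma height_cont: "continuous_on X height"
  by (rule continuous_on_compose2[OF \<theta>_cont]) (auto intro!: continuous_intros)

lemma height_inj: "y \<in> X \<Longrightarrow> y' \<in> X \<Longrightarrow> height y = height y' \<Longrightarrow> snd y = snd y'"
  using strict_mono_on_imp_inj_on[OF \<theta>_mono] by (auto simp: mem_Times_iff dest: inj_onD)

lemma deck_shift: "\<exists>m::int. \<forall>y\<in>X. height (\<sigma> n y) = height y + 2 * pi * m"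
proof (rule cis_eq_shift[OF conn _ height_cont])
  show "continuous_on X (\<lambda>y. height (\<sigma> n y))"
    by (rule continuous_on_compose2[OF height_cont \<sigma>_cont]) (rule image_subsetI, rule \<sigma>_in)
  show "cis (height (\<sigma> n y)) = cis (height y)" if "y \<in> X" for y
    using level[OF that] level[OF \<sigma>_in[OF that]] \<sigma>_q[OF that] by simp
qed

text \<open>If points with equal image always had equal level, the nested open sets
  \<open>q (S \<times> (0,e))\<close> with \<open>e < 1\<close> would cover the compact
  \<open>E\<close>. For the largest \<open>e\<close> of a finite subcover, the points over that
  level could not be covered.\<close>

lemma not_all_deck_level:
  "\<exists>n. \<exists>y\<in>X. height (\<sigma> n y) \<noteq> height y"
proof (rule ccontr)
  assume "\<not> ?thesis"
  then have same: "snd y = snd y'" if "y \<in> X" "y' \<in> X" "q y = q y'" for y y'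
    using \<sigma>_transitive[OF that] height_inj[OF that(1,2)] that by metis
  let ?C = "(\<lambda>e. q ` (S \<times> {0<..<e})) ` {0<..<1::real}"
  have "openin (top_of_set E) c" if c: "c \<in> ?C" for c
  proof -
    obtain e where e: "0 < e" "e < 1" "c = q ` (S \<times> {0<..<e})" using c by auto
    have "openin (top_of_set X) (S \<times> {0<..<e})"
      using e by (intro openin_Times openin_subtopology_self) (auto intro: open_subset)
    then show ?thesis using covering_space_open_map[OF cover] e(3) by blast
  qed
  moreover have "E \<subseteq> \<Union>?C"
  proof
    fix x assume "x \<in> E"
    then obtain s t where st: "s \<in> S" "0 < t" "t < 1" "x = q (s, t)"
      using covering_space_imp_surjective[OF cover] by auto
    then have "x \<in> q ` (S \<times> {0<..<(t + 1) / 2})" by (auto intro!: imageI)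
    then show "x \<in> \<Union>?C" using st by (intro UN_I[of "(t + 1) / 2"]) auto
  qed
  ultimately obtain D where D: "D \<subseteq> ?C" "finite D" "E \<subseteq> \<Union>D"
    using E_compact unfolding compact_eq_openin_cover by meson
  then obtain I where I: "I \<subseteq> {0<..<1}" "finite I" "D = (\<lambda>e. q ` (S \<times> {0<..<e})) ` I"
    using finite_subset_image[OF D(2,1)] by blast
  \<comment> \<open>Inserting 1/2 keeps the maximum defined and inside the interval even if
    \<open>I\<close> is empty.\<close>
  define t where "t = Max (insert (1/2) I)"
  have t: "t \<in> {0<..<1}" "\<And>e. e \<in> I \<Longrightarrow> e \<le> t"
  proof -
    have "t \<in> insert (1/2) I" unfolding t_def using I(2) by (intro Max_in) auto
    then show "t \<in> {0<..<1}" using I(1) by auto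
    show "e \<le> t" if "e \<in> I" for e unfolding t_def using I(2) that by simp
  qed
  obtain s where s: "s \<in> S" using S_nonempty by blast
  have "q (s, t) \<in> \<Union>D" using D(3) q_in[of "(s, t)"] s t(1) by auto
  then obtain e y where "e \<in> I" "y \<in> S \<times> {0<..<e}" "q (s, t) = q y" using I(3) by auto
  then have "snd y < t" "y \<in> X" using t by (fastforce simp: mem_Times_iff)+
  then show False using same[of "(s, t)" y] \<open>q (s, t) = q y\<close> s t(1) by auto
qed

text \<open>
  A deck transformation shifts the height by a multiple of \<open>2 \<pi>\<close>, additively in the group element.
  If a nontrivial one preserved the height, all would, and the height would descend to the compact
  exterior although its range is an open interval.
\<close>

lemma level_injective:
  assumes "y \<in> X" "y' \<in> X" "q y = q y'" "height y = height y'"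
  shows "y = y'"
proof -
  obtain m :: "int \<Rightarrow> int" where m: "\<And>n y. y \<in> X \<Longrightarrow> height (\<sigma> n y) = height y + 2 * pi * m n"
    using deck_shift by metis
  obtain x where x: "x \<in> X" using S_nonempty by (force intro: that[of "(_, 1/2)"])
  have add: "m (i + j) = m i + m j" for i j
  proof -
    have "height x + 2 * pi * m (i + j) = height x + 2 * pi * m j + 2 * pi * m i"
      using m[OF x, of "i + j"] m[OF x, of j] m[OF \<sigma>_in[OF x], of i j] by (simp add: \<sigma>_add[OF x])
    then have "2 * pi * real_of_int (m (i + j)) = 2 * pi * (real_of_int (m i) + real_of_int (m j))"
      by (simp add: distrib_left)
    then have "real_of_int (m (i + j)) = real_of_int (m i + m j)" by simp
    then show ?thesis by linarith
  qed
  \<comment> \<open>The shift is a homomorphism from the integers to the integers, hence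
    multiplication by \<open>m 1\<close>. It is injective as soon as \<open>m 1\<close> is
    nonzero.\<close>
  have lin: "m n = n * m 1" for n
  proof (induction n rule: int_induct[of _ 0])
    case base then show ?case using add[of 0 0] by simp
  next
    case (step1 i) then show ?case using add[of i 1] by (simp add: algebra_simps)
  next
    case (step2 i) then show ?case using add[of "i - 1" 1] by (simp add: algebra_simps)
  qed
  obtain n where n: "\<sigma> n y = y'" using \<sigma>_transitive[OF assms(1-3)] by blast
  then have "m n = 0" using m[OF assms(1), of n] assms(4) by simp
  moreover have "m 1 \<noteq> 0"
  proof
    assume "m 1 = 0"
    then have "m i = 0" for i using lin[of i] by simp
    then show False using not_all_deck_level m by auto
  qed
  ultimately have "n = 0" using lin[of n] by simp
  \<comment> \<open>Transitivity provides some \<open>k\<close> with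
    \<open>\<sigma> k y = y\<close>; its shift is 0, which forces \<open>k = 0\<close>.\<close>
  moreover have "\<sigma> 0 y = y"
  proof -
    obtain k where k: "\<sigma> k y = y" using \<sigma>_transitive[OF assms(1,1)] by blast
    then have "m k = 0" using m[OF assms(1), of k] by simp
    then have "k = 0" using lin[of k] \<open>m 1 \<noteq> 0\<close> by simp
    then show ?thesis using k by simp
  qed
  ultimately show ?thesis using n by simp
qed

text \<open>Near each point \<open>f\<close> is a smooth local inverse of \<open>q\<close> applied
  to \<open>q \<circ> f\<close>, so a continuous lift of a smooth map is smooth.\<close>

lemma lift_smooth:
  fixes f :: "'z::euclidean_space \<Rightarrow> (real^4) \<times> real"
  assumes f: "continuous_on A f" "f ` A \<subseteq> X" and qf: "smooth_on A (\<lambda>z. q (f z))"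
  shows "smooth_on A f"
proof (rule smooth_on_local)
  fix a assume a: "a \<in> A"
  then obtain U g where U: "openin (top_of_set X) U" "f a \<in> U" "diffeomorphism U (q ` U) q g"
    using local_diffeo f(2) by blast
  let ?W = "A \<inter> f -` U"
  have "openin (top_of_set A) ?W"
    using continuous_openin_preimage[OF f(1) _ U(1)] f(2) by auto
  moreover have "smooth_on ?W f"
  proof (rule smooth_on_cong)
    show "smooth_on ?W (\<lambda>z. g (q (f z)))"
      by (rule smooth_on_compose[of "q ` U"])
        (use U(3) smooth_on_subset[OF qf] in \<open>auto simp: diffeomorphism_def\<close>)
  qed (use U(3) in \<open>auto simp: diffeomorphism_def\<close>)
  ultimately show "\<exists>W. openin (top_of_set A) W \<and> a \<in> W \<and> smooth_on W f"
    using a U(2) by blast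
qed

text \<open>Homotopy lifting with the parameter space of all triples \<open>(a, b, y)\<close>, which
  gives continuity in all variables at once. The laws of a transport hold downstairs and pass to the
  lift by uniqueness of lifts of paths.\<close>

lemma lifted_transport:
  assumes F: "smooth_on (E \<times> {0..1}) (\<lambda>(x, t). F t x)" "\<And>t x. t \<in> {0..1} \<Longrightarrow> x \<in> E \<Longrightarrow> F t x \<in> E"
    and L: "continuous_on (E \<times> {0..1}) (\<lambda>(x, t). L t x)" "\<And>t. t \<in> {0..1} \<Longrightarrow> smooth_on E (L t)"
      "\<And>t x. t \<in> {0..1} \<Longrightarrow> x \<in> E \<Longrightarrow> L t x \<in> E"
    and inv: "\<And>t x. t \<in> {0..1} \<Longrightarrow> x \<in> E \<Longrightarrow> F t (L t x) = x" "\<And>t x. t \<in> {0..1} \<Longrightarrow> x \<in> E \<Longrightarrow> L t (F t x) = x"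
  obtains T where "transport X T"
    "\<And>a b y. a \<in> {0..1} \<Longrightarrow> b \<in> {0..1} \<Longrightarrow> y \<in> X \<Longrightarrow> q (T a b y) = F b (L a (q y))"
proof -
  let ?I = "{0..1::real}"
  let ?U = "?I \<times> ?I \<times> X"
  \<comment> \<open>The path of the point \<open>q y\<close> from time \<open>a\<close> to time
    \<open>b\<close>, run in unit time. It starts at \<open>q y\<close>, so its lift can start at
    \<open>y\<close>; \<open>T a b y\<close> will be the end of the lift.\<close>
  define h where "h = (\<lambda>(\<tau>, a, b, y). F (a + \<tau> * (b - a)) (L a (q y)))"
  have time: "a + \<tau> * (b - a) \<in> ?I" if "a \<in> ?I" "b \<in> ?I" "\<tau> \<in> ?I" for a b \<tau>
    using unit_interval_interpolate[OF that(1) _ that(3), of "b - a"] that(1,2) by (simp add: mult.commute)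
  have contq: "continuous_on X q" using covering_space_imp_continuous[OF cover] .
  have contF: "continuous_on (E \<times> ?I) (\<lambda>(x, t). F t x)" by (rule smooth_on_imp_continuous_on[OF F(1)])
  have Lq: "continuous_on (?I \<times> ?U) (\<lambda>z. (\<lambda>(x, t). L t x) (q (snd (snd (snd z))), fst (snd z)))"
    by (rule continuous_on_compose2[OF L(1)])
      (auto intro!: continuous_intros continuous_on_compose2[OF contq] q_in)
  have "continuous_on (?I \<times> ?U) (\<lambda>z. (\<lambda>(x, t). F t x)
      ((\<lambda>(x, t). L t x) (q (snd (snd (snd z))), fst (snd z)), fst (snd z) + fst z * (fst (snd (snd z)) - fst (snd z))))"
    by (rule continuous_on_compose2[OF contF])
      (use time in \<open>auto intro!: continuous_intros Lq[unfolded split_def fst_conv snd_conv] L(3) q_in simp: split_def\<close>)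
  then have conth: "continuous_on (?I \<times> ?U) h"
    by (rule continuous_on_eq) (auto simp: h_def)
  obtain k where k: "continuous_on (?I \<times> ?U) k" "k \<in> ?I \<times> ?U \<rightarrow> X"
    "\<And>u. u \<in> ?U \<Longrightarrow> k (0, u) = snd (snd u)" "\<And>z. z \<in> ?I \<times> ?U \<Longrightarrow> h z = q (k z)"
  proof (rule covering_space_lift_homotopy[OF cover conth, of "\<lambda>u. snd (snd u)"])
    show "h \<in> ?I \<times> ?U \<rightarrow> E" using time F(2) L(3) q_in by (auto simp: h_def)
    show "h (0, u) = q (snd (snd u))" if "u \<in> ?U" for u
      using that inv(1) q_in by (auto simp: h_def)
    show "continuous_on ?U (\<lambda>u. snd (snd u))" by (intro continuous_intros)
  qed auto
  define T where "T a b y = k (1, a, b, y)" for a b y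
  have Tin: "T a b y \<in> X" if "a \<in> ?I" "b \<in> ?I" "y \<in> X" for a b y
    using k(2) that unfolding T_def by (auto simp: Pi_iff)
  have Tq: "q (T a b y) = F b (L a (q y))" if "a \<in> ?I" "b \<in> ?I" "y \<in> X" for a b y
    using k(4)[of "(1, a, b, y)"] that unfolding T_def by (simp add: h_def)
  have Tcont: "continuous_on ?U (\<lambda>(a, b, y). T a b y)"
  proof -
    have "continuous_on ?U (\<lambda>u. k (1, u))"
      by (rule continuous_on_compose2[OF k(1)]) (auto intro!: continuous_intros)
    then show ?thesis by (rule continuous_on_eq) (auto simp: T_def)
  qed
  have Tid: "T a a y = y" if a: "a \<in> ?I" and y: "y \<in> X" for a y
  proof -
    have "k (1, a, a, y) = y"
    proof (rule covering_space_lift_unique[OF cover, where T = ?I and a = 0 and f = "\<lambda>\<tau>. q y"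
          and ?g1.0 = "\<lambda>\<tau>. k (\<tau>, a, a, y)" and ?g2.0 = "\<lambda>\<tau>. y"])
      show "continuous_on ?I (\<lambda>\<tau>. k (\<tau>, a, a, y))"
        by (rule continuous_on_compose2[OF k(1)]) (use a y in \<open>auto intro!: continuous_intros\<close>)
      show "q y = q (k (\<tau>, a, a, y))" if "\<tau> \<in> ?I" for \<tau>
        using k(4)[of "(\<tau>, a, a, y)"] that a y inv(1) q_in by (simp add: h_def)
    qed (use k(2,3) a y q_in in \<open>auto simp: Pi_iff\<close>)
    then show ?thesis by (simp add: T_def)
  qed
  have Ttrans: "T b c (T a b y) = T a c y" if abc: "a \<in> ?I" "b \<in> ?I" "c \<in> ?I" "y \<in> X" for a b c y
  proof -
    have contT: "continuous_on ?I (\<lambda>c. T a c y)" if "a \<in> ?I" "y \<in> X" for a y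
      using continuous_on_compose2[OF Tcont, of ?I "\<lambda>c. (a, c, y)"] that by (force intro!: continuous_intros)
    show ?thesis
    \<comment> \<open>With \<open>c\<close> as the path parameter, both sides lift the same path
      \<open>F c (L a (q y))\<close>, and they agree at \<open>c = b\<close>.\<close>
    proof (rule covering_space_lift_unique[OF cover, where T = ?I and a = b and f = "\<lambda>c. F c (L a (q y))"
          and ?g1.0 = "\<lambda>c. T b c (T a b y)" and ?g2.0 = "\<lambda>c. T a c y"])
      show "T b b (T a b y) = T a b y" using Tid Tin abc by blast
      show "continuous_on ?I (\<lambda>c. F c (L a (q y)))"
        using continuous_on_compose2[OF contF, of ?I "\<lambda>c. (L a (q y), c)"] L(3) q_in abc
        by (force intro!: continuous_intros)
      show "F c (L a (q y)) = q (T b c (T a b y))" if "c \<in> ?I" for c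
        using Tq[OF abc(2) that Tin[OF abc(1,2,4)]] Tq[OF abc(1,2,4)] inv(2) L(3) q_in abc by simp
      show "F c (L a (q y)) = q (T a c y)" if "c \<in> ?I" for c using Tq that abc by simp
    qed (use abc Tin contT F(2) L(3) q_in in auto)
  qed
  have "transport X T"
  proof
    show "smooth_on (X \<times> ?I) (\<lambda>(y, b). T a b y)" if a: "a \<in> ?I" for a
    proof (rule lift_smooth)
      show "continuous_on (X \<times> ?I) (\<lambda>(y, b). T a b y)"
        using continuous_on_compose2[OF Tcont, of "X \<times> ?I" "\<lambda>z. (a, snd z, fst z)"] a
        by (force intro!: continuous_intros simp: split_def)
      show "(\<lambda>(y, b). T a b y) ` (X \<times> ?I) \<subseteq> X"
      proof (rule image_subsetI)
        fix z assume "z \<in> X \<times> ?I"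
        then have "T a (snd z) (fst z) \<in> X" by (intro Tin a) (auto simp: mem_Times_iff)
        then show "(\<lambda>(y, b). T a b y) z \<in> X" by (simp add: split_def)
      qed
      have "smooth_on (X \<times> ?I) (\<lambda>z. L a (q (fst z)))"
        by (rule smooth_on_compose[OF L(2)[OF a] smooth_on_compose[OF q_smooth smooth_on_fst[OF smooth_on_ident]]])
          (auto intro!: q_in)
      then have "smooth_on (X \<times> ?I) (\<lambda>z. (\<lambda>(x, t). F t x) (L a (q (fst z)), snd z))"
        by (intro smooth_on_compose[OF F(1)] smooth_on_intros)
          (use L(3)[OF a] q_in in auto)
      then show "smooth_on (X \<times> ?I) (\<lambda>z. q ((\<lambda>(y, b). T a b y) z))"
        by (rule smooth_on_cong) (use Tq[OF a] in auto)
    qed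
    show "continuous_on ?I (\<lambda>b. T b a y)" if "a \<in> ?I" "y \<in> X" for a y
      using continuous_on_compose2[OF Tcont, of ?I "\<lambda>b. (b, a, y)"] that by (force intro!: continuous_intros)
  qed (use Tin Tid Ttrans in auto)
  then show ?thesis using that Tq by blast
qed

end

section \<open>Comparison of two covers\<close>

context fibered_cover
begin

lemma deck_move:
  assumes "y \<in> X" "y' \<in> X" "q y = q y'"
  shows "\<exists>\<tau>. \<exists>m::int. \<tau> y = y' \<and>
    (\<forall>x\<in>X. \<tau> x \<in> X \<and> q (\<tau> x) = q x \<and> height (\<tau> x) = height x + 2 * pi * m)"
proof -
  obtain n where "\<sigma> n y = y'" using \<sigma>_transitive[OF assms] by blast
  moreover obtain m :: int where "\<forall>x\<in>X. height (\<sigma> n x) = height x + 2 * pi * m"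
    using deck_shift[of n] by blast
  ultimately show ?thesis
    by (intro exI[of _ "\<sigma> n"] exI[of _ m] conjI ballI \<sigma>_in \<sigma>_q) (assumption | erule bspec)+
qed

text \<open>A smooth local inverse of \<open>q\<close> gives the lift. Its height differs from
  \<open>\<eta>\<close> by an integer multiple of 2 pi, and by continuity this integer is constant
  near \<open>y\<close>.\<close>

lemma local_section:
  fixes f :: "'z::euclidean_space \<Rightarrow> real^4" and \<eta> :: "'z \<Rightarrow> real"
  assumes f: "smooth_on A f" "f ` A \<subseteq> E" and \<eta>: "continuous_on A \<eta>" "\<And>z. z \<in> A \<Longrightarrow> p (f z) = cis (\<eta> z)"
    and y: "y \<in> A" "y' \<in> X" "q y' = f y"
  shows "\<exists>W g. \<exists>m::int. openin (top_of_set A) W \<and> y \<in> W \<and> smooth_on W g \<and> g y = y' \<and>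
    (\<forall>z\<in>W. g z \<in> X \<and> q (g z) = f z \<and> height (g z) = \<eta> z + 2 * pi * m)"
proof -
  have ex: "\<exists>k::int. height x = \<eta> z + 2 * pi * k" if "z \<in> A" "x \<in> X" "q x = f z" for x z
    using level[OF that(2)] \<eta>(2)[OF that(1)] that(3)
    by (simp add: complex_eq_iff flip: sin_cos_eq_iff)
  obtain m :: int where m: "height y' = \<eta> y + 2 * pi * m" using ex[OF y] by blast
  obtain U g where U: "openin (top_of_set X) U" "y' \<in> U" "openin (top_of_set E) (q ` U)"
      "diffeomorphism U (q ` U) q g" using local_diffeo[OF y(2)] by blast
  have UX: "U \<subseteq> X" using U(1) by (rule openin_imp_subset)
  define W0 where "W0 = A \<inter> f -` (q ` U)"
  have W0: "openin (top_of_set A) W0"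
    unfolding W0_def by (rule continuous_openin_preimage[OF smooth_on_imp_continuous_on[OF f(1)] _ U(3)])
      (use f(2) in auto)
  have smg: "smooth_on W0 (\<lambda>z. g (f z))"
    by (rule smooth_on_compose[OF diffeomorphism_smooth_inverse[OF U(4)] smooth_on_subset[OF f(1)]])
      (auto simp: W0_def)
  have gU: "g (f z) \<in> U" "q (g (f z)) = f z" if "z \<in> W0" for z
    using that diffeomorphism_inverse_image[OF U(4)] diffeomorphism_inverse'[OF U(4)] by (auto simp: W0_def)
  have gX: "(\<lambda>z. g (f z)) ` W0 \<subseteq> X" using gU(1) UX by blast
  have d: "continuous_on W0 (\<lambda>z. height (g (f z)) - \<eta> z - 2 * pi * m)"
    by (intro continuous_intros continuous_on_compose2[OF height_cont smooth_on_imp_continuous_on[OF smg] gX]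
        continuous_on_subset[OF \<eta>(1)]) (auto simp: W0_def)
  \<comment> \<open>Any two multiples of 2 pi closer than 1 coincide, so radius 1 is small enough to
    fix the integer.\<close>
  define W where "W = W0 \<inter> (\<lambda>z. height (g (f z)) - \<eta> z - 2 * pi * m) -` ball 0 1"
  have "openin (top_of_set W0) W"
    unfolding W_def by (rule continuous_openin_preimage_gen[OF d]) auto
  then have W: "openin (top_of_set A) W" using W0 openin_trans by blast
  have gy: "g (f y) = y'" using diffeomorphism_inverse[OF U(4) U(2)] y(3) by simp
  show ?thesis
  proof (intro exI[of _ W] exI[of _ "\<lambda>z. g (f z)"] exI[of _ m] conjI ballI)
    show "openin (top_of_set A) W" "g (f y) = y'" by (fact W, fact gy)
    show "y \<in> W" using y U(2) gy m by (auto simp: W_def W0_def) (metis imageI)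
    show "smooth_on W (\<lambda>z. g (f z))" using smg by (rule smooth_on_subset) (auto simp: W_def)
    fix z assume z: "z \<in> W"
    then have "z \<in> W0" "z \<in> A" by (auto simp: W_def W0_def)
    show gfX: "g (f z) \<in> X" using gU(1)[OF \<open>z \<in> W0\<close>] UX by blast
    show "q (g (f z)) = f z" using gU(2)[OF \<open>z \<in> W0\<close>] .
    then obtain k :: int where k: "height (g (f z)) = \<eta> z + 2 * pi * k"
      using ex[OF \<open>z \<in> A\<close> gfX] by blast
    have "\<bar>2 * pi * k - 2 * pi * m\<bar> < 1" using z by (simp add: W_def k)
    moreover have "\<bar>real_of_int (k - m)\<bar> \<le> \<bar>2 * pi * k - 2 * pi * m\<bar>"
      using mult_right_mono[of 1 "2 * pi" "\<bar>real_of_int (k - m)\<bar>"] pi_gt3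
      by (simp add: abs_mult flip: right_diff_distrib)
    ultimately have "\<bar>k - m\<bar> < 1" by linarith
    then have "k = m" by simp
    then show "height (g (f z)) = \<eta> z + 2 * pi * m" using k by simp
  qed
qed

end

text \<open>
  The isomorphism of two infinite cyclic covers as a map over \<open>E\<close> that moves heights by a constant;
  level injectivity makes it unique, and connectedness of the cover makes it exist.
\<close>

lemma comparison_map:
  assumes c1: "fibered_cover E p S q1 \<theta>1 \<sigma>1" and c2: "fibered_cover E p S q2 \<theta>2 \<sigma>2"
    and y: "y1 \<in> S \<times> {0<..<1}" "y2 \<in> S \<times> {0<..<1}" "q2 y2 = q1 y1" "\<theta>2 (snd y2) = \<theta>1 (snd y1) + 2 * pi * of_int n"
  shows "\<exists>\<phi>. smooth_on (S \<times> {0<..<1}) \<phi> \<and> (\<forall>y\<in>S \<times> {0<..<1}. \<phi> y \<in> S \<times> {0<..<1} \<and>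
    q2 (\<phi> y) = q1 y \<and> \<theta>2 (snd (\<phi> y)) = \<theta>1 (snd y) + 2 * pi * of_int n)"
proof -
  interpret c1: fibered_cover E p S q1 \<theta>1 \<sigma>1 by (rule c1)
  interpret c2: fibered_cover E p S q2 \<theta>2 \<sigma>2 by (rule c2)
  let ?X = "S \<times> {0<..<1::real}"
  define R where "R y y' \<longleftrightarrow> y' \<in> ?X \<and> q2 y' = q1 y \<and> \<theta>2 (snd y') = \<theta>1 (snd y) + 2 * pi * of_int n" for y y'
  have lift: "\<exists>W g. \<exists>m::int. openin (top_of_set ?X) W \<and> y \<in> W \<and> smooth_on W g \<and> g y = y' \<and>
    (\<forall>z\<in>W. g z \<in> ?X \<and> q2 (g z) = q1 z \<and> \<theta>2 (snd (g z)) = \<theta>1 (snd z) + 2 * pi * of_int m)"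
    if "y \<in> ?X" "y' \<in> ?X" "q2 y' = q1 y" for y y'
  proof (rule c2.local_section[OF c1.q_smooth _ c1.height_cont c1.level that])
    show "q1 ` ?X \<subseteq> E" using c1.q_in by (rule image_subsetI)
  qed
  have ex: "\<exists>y'. R y y'" if "y \<in> ?X" for y
  proof (rule connected_induction_simple[OF c1.conn y(1) that])
    show "\<exists>y'. R y1 y'" using y unfolding R_def by blast
    fix x assume x: "x \<in> ?X"
    then have "q1 x \<in> q2 ` ?X"
      unfolding covering_space_imp_surjective[OF c2.cover] by (rule c1.q_in)
    then obtain x' where x': "x' \<in> ?X" "q2 x' = q1 x"
      by (elim imageE) (rule that, assumption, rule sym)
    from lift[OF x x'] obtain W g and m :: int where W: "openin (top_of_set ?X) W" "x \<in> W"
      and gW: "\<forall>z\<in>W. g z \<in> ?X \<and> q2 (g z) = q1 z \<and> \<theta>2 (snd (g z)) = \<theta>1 (snd z) + 2 * pi * of_int m"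
      by (elim exE conjE) (rule that)
    have Wg: "g z \<in> ?X" "q2 (g z) = q1 z" "\<theta>2 (snd (g z)) = \<theta>1 (snd z) + 2 * pi * of_int m"
      if "z \<in> W" for z using bspec[OF gW that] by (simp_all only:)
    \<comment> \<open>A deck transformation carries the local section at \<open>z\<close> to the
      given \<open>z'\<close> and shifts all heights by the same amount. It therefore corrects the
      height of the section at \<open>w\<close> as well.\<close>
    have "\<exists>w'. R w w'" if zw: "z \<in> W" "w \<in> W" "R z z'" for z w z'
    proof -
      have z': "z' \<in> ?X" "q2 z' = q1 z" "\<theta>2 (snd z') = \<theta>1 (snd z) + 2 * pi * of_int n"
        using zw(3) unfolding R_def by auto
      have "q2 (g z) = q2 z'" using Wg(2)[OF zw(1)] z'(2) by simp
      from c2.deck_move[OF Wg(1)[OF zw(1)] z'(1) this] obtain \<tau> and k :: int where \<tau>z: "\<tau> (g z) = z'"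
        and all: "\<forall>x\<in>?X. \<tau> x \<in> ?X \<and> q2 (\<tau> x) = q2 x \<and> \<theta>2 (snd (\<tau> x)) = \<theta>2 (snd x) + 2 * pi * of_int k"
        by (elim exE conjE) (rule that)
      have \<tau>: "\<tau> x \<in> ?X" "q2 (\<tau> x) = q2 x" "\<theta>2 (snd (\<tau> x)) = \<theta>2 (snd x) + 2 * pi * of_int k"
        if "x \<in> ?X" for x using bspec[OF all that] by (simp_all only:)
      have "2 * pi * real_of_int n = 2 * pi * real_of_int m + 2 * pi * real_of_int k"
        using \<tau>(3)[OF Wg(1)[OF zw(1)]] \<tau>z Wg(3)[OF zw(1)] z'(3) by simp
      then have "R w (\<tau> (g w))"
        unfolding R_def using \<tau>[OF Wg(1)[OF zw(2)]] Wg(2,3)[OF zw(2)] by simp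
      then show ?thesis by blast
    qed
    then show "\<exists>W. openin (top_of_set ?X) W \<and> x \<in> W \<and> (\<forall>z\<in>W. \<forall>w\<in>W. (\<exists>z'. R z z') \<longrightarrow> (\<exists>w'. R w w'))"
      using W by blast
  qed
  have uniq: "a = b" if "R y a" "R y b" for y a b
    using that unfolding R_def by (intro c2.level_injective) auto
  \<comment> \<open>The choice is no real choice: \<open>q2\<close> and the height determine the
    value. This is why \<open>\<phi>\<close> coincides locally with smooth sections.\<close>
  define \<phi> where "\<phi> y = (SOME y'. R y y')" for y
  have \<phi>: "R y (\<phi> y)" if "y \<in> ?X" for y
    unfolding \<phi>_def using ex[OF that] by (rule someI_ex)
  have "smooth_on ?X \<phi>"
  proof (rule smooth_on_local)
    fix x assume x: "x \<in> ?X"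
    have x': "\<phi> x \<in> ?X" "q2 (\<phi> x) = q1 x" "\<theta>2 (snd (\<phi> x)) = \<theta>1 (snd x) + 2 * pi * of_int n"
      using \<phi>[OF x] unfolding R_def by auto
    from lift[OF x x'(1,2)] obtain W g and m :: int where W: "openin (top_of_set ?X) W" "x \<in> W"
        "smooth_on W g" "g x = \<phi> x"
      and gW: "\<forall>z\<in>W. g z \<in> ?X \<and> q2 (g z) = q1 z \<and> \<theta>2 (snd (g z)) = \<theta>1 (snd z) + 2 * pi * of_int m"
      by (elim exE conjE) (rule that)
    have "2 * pi * real_of_int m = 2 * pi * real_of_int n" using bspec[OF gW W(2)] W(4) x'(3) by simp
    then have "R z (g z)" if "z \<in> W" for z
      unfolding R_def using bspec[OF gW that] by simp
    then have "g z = \<phi> z" if "z \<in> W" for z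
      using uniq \<phi> openin_imp_subset[OF W(1)] that by blast
    then show "\<exists>W. openin (top_of_set ?X) W \<and> x \<in> W \<and> smooth_on W \<phi>"
      using W(1,2) smooth_on_cong[OF W(3)] by blast
  qed
  moreover have "\<forall>y\<in>?X. \<phi> y \<in> ?X \<and> q2 (\<phi> y) = q1 y \<and> \<theta>2 (snd (\<phi> y)) = \<theta>1 (snd y) + 2 * pi * of_int n"
    using \<phi> unfolding R_def by blast
  ultimately show ?thesis by blast
qed

text \<open>The comparison maps for the height differences given by \<open>n\<close> and
  \<open>- n\<close> are mutually inverse: each composite preserves both the covering map and the
  height, hence is the identity.\<close>

lemma comparison_diffeomorphism:
  assumes c1: "fibered_cover E p S q1 \<theta>1 \<sigma>1" and c2: "fibered_cover E p S q2 \<theta>2 \<sigma>2"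
    and y: "y1 \<in> S \<times> {0<..<1}" "y2 \<in> S \<times> {0<..<1}" "q2 y2 = q1 y1"
  obtains \<phi> \<psi> and n :: int where "diffeomorphism (S \<times> {0<..<1}) (S \<times> {0<..<1}) \<phi> \<psi>" "\<phi> y1 = y2"
    "\<And>y. y \<in> S \<times> {0<..<1} \<Longrightarrow> q2 (\<phi> y) = q1 y"
    "\<And>y. y \<in> S \<times> {0<..<1} \<Longrightarrow> \<theta>2 (snd (\<phi> y)) = \<theta>1 (snd y) + 2 * pi * of_int n"
proof -
  interpret c1: fibered_cover E p S q1 \<theta>1 \<sigma>1 by (rule c1)
  interpret c2: fibered_cover E p S q2 \<theta>2 \<sigma>2 by (rule c2)
  let ?X = "S \<times> {0<..<1::real}"
  have "cis (\<theta>2 (snd y2)) = cis (\<theta>1 (snd y1))"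
    using c1.level[OF y(1)] c2.level[OF y(2)] y(3) by simp
  then have "\<exists>n::int. \<theta>2 (snd y2) = \<theta>1 (snd y1) + 2 * pi * of_int n"
    by (simp add: complex_eq_iff flip: sin_cos_eq_iff)
  then obtain n :: int where n: "\<theta>2 (snd y2) = \<theta>1 (snd y1) + 2 * pi * of_int n" by blast
  then have n': "\<theta>1 (snd y1) = \<theta>2 (snd y2) + 2 * pi * of_int (- n)" by simp
  from comparison_map[OF c1 c2 y n] obtain \<phi> where \<phi>0: "smooth_on ?X \<phi>"
    and \<phi>R: "\<forall>y\<in>?X. \<phi> y \<in> ?X \<and> q2 (\<phi> y) = q1 y \<and> \<theta>2 (snd (\<phi> y)) = \<theta>1 (snd y) + 2 * pi * of_int n"
    by (elim exE conjE) (rule that)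
  have \<phi>: "\<phi> y \<in> ?X" "q2 (\<phi> y) = q1 y" "\<theta>2 (snd (\<phi> y)) = \<theta>1 (snd y) + 2 * pi * of_int n"
    if "y \<in> ?X" for y using bspec[OF \<phi>R that] by (simp_all only:)
  from comparison_map[OF c2 c1 y(2,1) y(3)[symmetric] n'] obtain \<psi> where \<psi>0: "smooth_on ?X \<psi>"
    and \<psi>R: "\<forall>y\<in>?X. \<psi> y \<in> ?X \<and> q1 (\<psi> y) = q2 y \<and> \<theta>1 (snd (\<psi> y)) = \<theta>2 (snd y) + 2 * pi * of_int (- n)"
    by (elim exE conjE) (rule that)
  have \<psi>: "\<psi> y \<in> ?X" "q1 (\<psi> y) = q2 y" "\<theta>1 (snd (\<psi> y)) = \<theta>2 (snd y) + 2 * pi * of_int (- n)"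
    if "y \<in> ?X" for y using bspec[OF \<psi>R that] by (simp_all only:)
  have "\<psi> (\<phi> y) = y" if "y \<in> ?X" for y
    using \<phi>[OF that] \<psi>[OF \<phi>(1)[OF that]] that by (intro c1.level_injective) auto
  moreover have "\<phi> (\<psi> y) = y" if "y \<in> ?X" for y
    using \<psi>[OF that] \<phi>[OF \<psi>(1)[OF that]] that by (intro c2.level_injective) auto
  ultimately have "diffeomorphism ?X ?X \<phi> \<psi>"
    by (intro diffeomorphismI \<phi>0 \<psi>0 image_subsetI \<phi>(1) \<psi>(1))
  moreover have "\<phi> y1 = y2"
    using \<phi>[OF y(1)] y n by (intro c2.level_injective) auto
  ultimately show ?thesis using that \<phi>(2,3) by blast
qed

section \<open>Isotopies of a thickened surface that preserve the levels\<close>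

text \<open>Going from time \<open>a\<close> to time \<open>b\<close> means to undo the isotopy at
  time \<open>a\<close> and to apply it at time \<open>b\<close>. Intermediate times cancel, which
  is the composition law.\<close>

lemma conjugate_transport:
  assumes U: "\<And>a y. a \<in> {0..1} \<Longrightarrow> y \<in> X \<Longrightarrow> U a y \<in> X" and V: "\<And>a y. a \<in> {0..1} \<Longrightarrow> y \<in> X \<Longrightarrow> V a y \<in> X"
    and UV: "\<And>a y. a \<in> {0..1} \<Longrightarrow> y \<in> X \<Longrightarrow> U a (V a y) = y" and VU: "\<And>a y. a \<in> {0..1} \<Longrightarrow> y \<in> X \<Longrightarrow> V a (U a y) = y"
    and Us: "smooth_on (X \<times> {0..1}) (\<lambda>(y, b). U b y)" and Vs: "\<And>a. a \<in> {0..1} \<Longrightarrow> smooth_on X (V a)"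
    and Vc: "\<And>y. y \<in> X \<Longrightarrow> continuous_on {0..1} (\<lambda>a. V a y)"
  shows "transport X (\<lambda>a b y. U b (V a y))"
proof
  fix a :: real assume a: "a \<in> {0..1}"
  have "smooth_on (X \<times> {0..1}) (\<lambda>z. (\<lambda>(y, b). U b y) (V a (fst z), snd z))"
    by (rule smooth_on_compose[OF Us], intro smooth_on_Pair smooth_on_compose[OF Vs[OF a] smooth_on_fst[OF smooth_on_ident]] smooth_on_intros) (use V[OF a] in auto)
  then show "smooth_on (X \<times> {0..1}) (\<lambda>(y, b). U b (V a y))"
    by (rule smooth_on_cong) auto
  fix y assume y: "y \<in> X"
  have "continuous_on {0..1} (\<lambda>b. (\<lambda>(y, b). U b y) (V b y, a))"
    by (rule continuous_on_compose2[OF smooth_on_imp_continuous_on[OF Us]], intro continuous_intros Vc y)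
      (use V a y in auto)
  then show "continuous_on {0..1} (\<lambda>b. U a (V b y))" by simp
qed (use U V UV VU in auto)

lemma smooth_on_open_imp_Ck:
  assumes "smooth_on U f" "open U" shows "Ck_on k f U"
proof (rule Ck_on_local)
  fix x assume x: "x \<in> U"
  obtain W F where F: "open W" "x \<in> W" "\<forall>k. Ck_on k F W" "\<forall>y\<in>W \<inter> U. F y = f y"
    by (rule smooth_onE[OF assms(1) x])
  have "Ck_on k f (W \<inter> U)"
    by (rule Ck_on_cong[OF _ _ Ck_on_mono[OF F(3)[rule_format]]]) (use F assms(2) in auto)
  then show "\<exists>V. open V \<and> x \<in> V \<and> Ck_on k f V"
    using F(1,2) assms(2) x by (intro exI[of _ "W \<inter> U"]) auto
qed

text \<open>A convex combination of the identity with an increasing diffeomorphism of the interval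
  is again one, because its derivative is positive. The function \<open>\<rho> a\<close> is its
  inverse.\<close>

lemma increasing_diffeomorphism_interpolation:
  fixes s r :: "real \<Rightarrow> real"
  assumes s: "smooth_on {0<..<1} s" "\<And>t. t \<in> {0<..<1} \<Longrightarrow> s t \<in> {0<..<1}"
    and r: "smooth_on {0<..<1} r" "\<And>t. t \<in> {0<..<1} \<Longrightarrow> r t \<in> {0<..<1}"
    and rs: "\<And>t. t \<in> {0<..<1} \<Longrightarrow> r (s t) = t" "\<And>t. t \<in> {0<..<1} \<Longrightarrow> s (r t) = t"
    and mono: "strict_mono_on {0<..<1} s"
  shows "\<exists>\<rho>. (\<forall>a\<in>{0..1}. \<forall>t\<in>{0<..<1}. \<rho> a t \<in> {0<..<1} \<and>
      (1 - a) * \<rho> a t + a * s (\<rho> a t) = t \<and> \<rho> a ((1 - a) * t + a * s t) = t) \<and>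
    (\<forall>a\<in>{0..1}. smooth_on {0<..<1} (\<rho> a)) \<and>
    (\<forall>t\<in>{0<..<1}. continuous_on {0..1} (\<lambda>a. \<rho> a t))"
proof -
  let ?J = "{0<..<1::real}" and ?I = "{0..1::real}"
  define g where "g a t = (1 - a) * t + a * s t" for a t
  have sc: "continuous_on ?J s" by (rule smooth_on_imp_continuous_on[OF s(1)])
  have g_mono: "g a t < g a t'" if "a \<in> ?I" "t \<in> ?J" "t' \<in> ?J" "t < t'" for a t t'
  proof -
    have st: "s t < s t'" using mono that by (auto simp: strict_mono_on_def)
    show ?thesis
    proof (cases "a = 0")
      case False
      then have "a * s t < a * s t'" using that(1) st by simp
      moreover have "(1 - a) * t \<le> (1 - a) * t'" using that by (intro mult_left_mono) auto
      ultimately show ?thesis by (simp add: g_def)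
    qed (use that in \<open>simp add: g_def\<close>)
  qed
  have g_inj: "t = t'" if "a \<in> ?I" "t \<in> ?J" "t' \<in> ?J" "g a t = g a t'" for a t t'
    using g_mono[OF that(1-3)] g_mono[OF that(1,3,2)] that(4) by force
  have g_cont: "continuous_on ?J (g a)" for a unfolding g_def by (intro continuous_intros sc)
  have ex: "\<exists>u\<in>?J. g a u = t" if a: "a \<in> ?I" and t: "t \<in> ?J" for a t
  proof -
    \<comment> \<open>The two points bracket the solution: at the smaller one both the identity and
      \<open>s\<close> are at most \<open>t\<close>, at the larger one both are at least
      \<open>t\<close>, and so are their convex combinations.\<close>
    let ?lo = "min t (r t)" and ?hi = "max t (r t)"
    have J: "?lo \<in> ?J" "?hi \<in> ?J" using t r(2)[OF t] by auto
    have convex_le: "(1 - a) * u + a * v \<le> t" if "u \<le> t" "v \<le> t" for u v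
    proof -
      have "(1 - a) * u + a * v \<le> (1 - a) * t + a * t"
        using a that by (intro add_mono mult_left_mono) auto
      then show ?thesis by (simp add: algebra_simps)
    qed
    have convex_ge: "t \<le> (1 - a) * u + a * v" if "t \<le> u" "t \<le> v" for u v
    proof -
      have "(1 - a) * t + a * t \<le> (1 - a) * u + a * v"
        using a that by (intro add_mono mult_left_mono) auto
      then show ?thesis by (simp add: algebra_simps)
    qed
    have smono: "s u \<le> s v" if "u \<in> ?J" "v \<in> ?J" "u \<le> v" for u v
      using mono that by (auto simp: strict_mono_on_def le_less)
    have "s ?lo \<le> t" using smono[OF J(1) r(2)[OF t]] rs(2)[OF t] by simp
    then have lo: "g a ?lo \<le> t" unfolding g_def by (intro convex_le) auto
    have "t \<le> s ?hi" using smono[OF r(2)[OF t] J(2)] rs(2)[OF t] by simp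
    then have hi: "t \<le> g a ?hi" unfolding g_def by (intro convex_ge) auto
    have "continuous_on {?lo..?hi} (g a)"
      using J by (intro continuous_on_subset[OF g_cont]) auto
    moreover have "?lo \<le> ?hi" by auto
    ultimately obtain u where "?lo \<le> u" "u \<le> ?hi" "g a u = t" using IVT'[of "g a" ?lo t ?hi] lo hi by blast
    then show ?thesis using J by (intro bexI[of _ u]) auto
  qed
  define \<rho> where "\<rho> a t = (SOME u. u \<in> ?J \<and> g a u = t)" for a t
  have \<rho>: "\<rho> a t \<in> ?J" "g a (\<rho> a t) = t" if "a \<in> ?I" "t \<in> ?J" for a t
  proof -
    have "\<exists>u. u \<in> ?J \<and> g a u = t" using ex[OF that] by blast
    from someI_ex[OF this] show "\<rho> a t \<in> ?J" "g a (\<rho> a t) = t" by (simp_all add: \<rho>_def)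
  qed
  have gJ: "g a t \<in> ?J" if a: "a \<in> ?I" and t: "t \<in> ?J" for a t
    using convexD_alt[of ?J t "s t" a] s(2)[OF t] a t by (simp add: g_def)
  have \<rho>g: "\<rho> a (g a t) = t" if "a \<in> ?I" "t \<in> ?J" for a t
    using g_inj[OF that(1) \<rho>(1)[OF that(1) gJ[OF that]] that(2)] \<rho>(2)[OF that(1) gJ[OF that]] .
  have s_Ck: "Ck_on k s ?J" for k by (rule smooth_on_open_imp_Ck[OF s(1)]) auto
  define d where "d t = frechet_derivative s (at t) 1" for t
  have ds: "(s has_real_derivative d t) (at t)" if "t \<in> ?J" for t
  proof -
    have f: "(s has_derivative frechet_derivative s (at t)) (at t)"
      using has_derivative_frechet_if_Ck_Suc[OF s_Ck that] .
    have "frechet_derivative s (at t) = (\<lambda>x. x * d t)"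
    proof
      fix x
      show "frechet_derivative s (at t) x = x * d t"
        using linear_scale[OF has_derivative_linear[OF f], of x 1] by (simp add: d_def)
    qed
    then show ?thesis using f by (simp add: has_field_derivative_def mult.commute[of _ "d t"])
  qed
  have dpos: "d t > 0" if t: "t \<in> ?J" for t
  proof -
    have "d t \<ge> 0"
      using mono_on_imp_deriv_nonneg[OF strict_mono_on_imp_mono_on[OF mono] ds[OF t]] t by simp
    \<comment> \<open>Monotonicity alone allows a zero of the derivative. The chain rule for
      \<open>r (s x) = x\<close> excludes it.\<close>
    moreover have "d t \<noteq> 0"
    proof
      assume d0: "d t = 0"
      have "Ck_on (Suc 0) r ?J" by (rule smooth_on_open_imp_Ck[OF r(1)]) auto
      from has_derivative_frechet_if_Ck_Suc[OF this s(2)[OF t]]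
      have "((\<lambda>x. r (s x)) has_derivative (\<lambda>x. frechet_derivative r (at (s t)) (d t * x))) (at t)"
        by (rule has_derivative_compose[OF ds[OF t, unfolded has_field_derivative_def]])
      then have "((\<lambda>x. x) has_derivative (\<lambda>x. frechet_derivative r (at (s t)) (d t * x))) (at t)"
        by (rule has_derivative_transform_within_open[of _ _ _ _ ?J]) (use t rs in auto)
      from has_derivative_unique[OF this has_derivative_ident]
      have "frechet_derivative r (at (s t)) (d t * 1) = (1::real)" by meson
      moreover have "frechet_derivative r (at (s t)) 0 = 0"
        using \<open>Ck_on (Suc 0) r ?J\<close> s(2)[OF t]
        by (intro linear_0 has_derivative_linear[OF has_derivative_frechet_if_Ck_Suc])
      ultimately show False using d0 by simp
    qed
    ultimately show ?thesis by simp
  qed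
  have sm: "smooth_on ?J (\<rho> a)" if a: "a \<in> ?I" for a
  proof -
    define e where "e t = (1 - a) + a * d t" for t
    have epos: "e t > 0" if "t \<in> ?J" for t
      using a dpos[OF that] by (cases "a = 0") (auto simp: e_def intro: add_nonneg_pos)
    have e_Ck: "Ck_on k e ?J" for k
      unfolding e_def d_def using s_Ck[of "Suc k"]
      by (intro Ck_on_add Ck_on_mult Ck_on_const Ck_on_frechet_derivative) auto
    have img: "g a ` ?J = ?J"
      using gJ[OF a] ex[OF a] by blast
    have cont: "continuous_on ?J (\<rho> a)"
      using continuous_on_inverse_open[OF _ g_cont[of a], of "\<rho> a"] \<rho>g[OF a] img by auto
    have "Ck_on k (\<rho> a) ?J" for k
    proof (rule smooth_bootstrap[where U = ?J and P = "\<lambda>x v. v * inverse (e x)"])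
      show "\<rho> a ` ?J \<subseteq> ?J" using \<rho>(1)[OF a] by blast
      fix t assume t: "t \<in> ?J"
      have "(g a has_real_derivative e (\<rho> a t)) (at (\<rho> a t))"
        unfolding g_def[abs_def] e_def using ds[OF \<rho>(1)[OF a t]]
        by (auto intro!: derivative_eq_intros)
      then have "(g a has_derivative (\<lambda>v. e (\<rho> a t) * v)) (at (\<rho> a t))"
        by (simp add: has_field_derivative_def)
      then show "(\<rho> a has_derivative (\<lambda>v. v * inverse (e (\<rho> a t)))) (at t)"
      proof (rule has_derivative_inverse_basic[where T = ?J and g = "\<rho> a" and y = t])
        show "(\<lambda>v. v * inverse (e (\<rho> a t))) \<circ> (\<lambda>v. e (\<rho> a t) * v) = id"
          using epos[OF \<rho>(1)[OF a t]] by (auto simp: fun_eq_iff)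
        show "isCont (\<rho> a) t" using cont t continuous_on_eq_continuous_at[OF open_greaterThanLessThan] by blast
      qed (use t \<rho>(2)[OF a] in \<open>auto intro: bounded_linear_mult_left\<close>)
    next
      fix k and v :: real
      have "Ck_on k (\<lambda>x. inverse (e x)) ?J"
        by (rule Ck_on_compose[OF _ _ _ e_Ck smooth_inverse_real]) (use epos in force)+
      then show "Ck_on k (\<lambda>x. v * inverse (e x)) ?J" by (intro Ck_on_mult Ck_on_const) auto
    qed (use cont in auto)
    then show ?thesis by (intro smooth_on_open[of ?J]) auto
  qed
  have cont: "continuous_on ?I (\<lambda>a. \<rho> a t)" if t: "t \<in> ?J" for t
    unfolding continuous_on_iff
  proof (intro ballI allI impI)
    fix a e :: real assume a: "a \<in> ?I" and "0 < e"
    let ?u = "\<rho> a t"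
    \<comment> \<open>The bounds keep \<open>?u \<plusminus> \<epsilon>\<close> inside the interval.
      By strict monotonicity \<open>g a\<close> separates these two points from \<open>t\<close>;
      the inequalities persist for parameters near \<open>a\<close> and trap
      \<open>\<rho> b t\<close> between the two points.\<close>
    define \<epsilon> where "\<epsilon> = min e (min (?u / 2) ((1 - ?u) / 2))"
    have u: "?u \<in> ?J" using \<rho>(1)[OF a t] .
    have \<epsilon>: "0 < \<epsilon>" "\<epsilon> \<le> e" "\<epsilon> \<le> ?u / 2" "\<epsilon> \<le> (1 - ?u) / 2"
      using u \<open>0 < e\<close> unfolding \<epsilon>_def by (simp, linarith+)
    then have uJ: "?u - \<epsilon> \<in> ?J" "?u + \<epsilon> \<in> ?J" using u by auto
    have lt: "g a (?u - \<epsilon>) < t" "t < g a (?u + \<epsilon>)"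
      using g_mono[OF a uJ(1) u] g_mono[OF a u uJ(2)] \<rho>(2)[OF a t] \<epsilon>(1) by auto
    have "isCont (\<lambda>a. g a v) a" for v unfolding g_def by (intro continuous_intros)
    then have tend: "(\<lambda>b. g b v) \<midarrow>a\<rightarrow> g a v" for v by (simp add: isCont_def)
    have "\<forall>\<^sub>F b in at a. g b (?u - \<epsilon>) < t" "\<forall>\<^sub>F b in at a. t < g b (?u + \<epsilon>)"
      using order_tendstoD(2)[OF tend lt(1)] order_tendstoD(1)[OF tend lt(2)] .
    then have "\<forall>\<^sub>F b in at a. g b (?u - \<epsilon>) < t \<and> t < g b (?u + \<epsilon>)" by (rule eventually_conj)
    then obtain \<delta> where \<delta>: "\<delta> > 0" "\<And>b. b \<noteq> a \<Longrightarrow> dist b a < \<delta> \<Longrightarrow> g b (?u - \<epsilon>) < t \<and> t < g b (?u + \<epsilon>)"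
      unfolding eventually_at by blast
    have "dist (\<rho> b t) ?u < e" if b: "b \<in> ?I" "dist b a < \<delta>" for b
    proof (cases "b = a")
      case False
      have less: "g b (?u - \<epsilon>) < g b (\<rho> b t)" "g b (\<rho> b t) < g b (?u + \<epsilon>)"
        using \<delta>(2)[OF False b(2)] \<rho>(2)[OF b(1) t] by auto
      have "?u - \<epsilon> < \<rho> b t"
      proof (rule ccontr)
        assume "\<not> ?thesis"
        then have "g b (\<rho> b t) \<le> g b (?u - \<epsilon>)"
          using g_mono[OF b(1) \<rho>(1)[OF b(1) t] uJ(1)] by (cases "\<rho> b t = ?u - \<epsilon>") auto
        then show False using less by simp
      qed
      moreover have "\<rho> b t < ?u + \<epsilon>"
      proof (rule ccontr)
        assume "\<not> ?thesis"
        then have "g b (?u + \<epsilon>) \<le> g b (\<rho> b t)"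
          using g_mono[OF b(1) uJ(2) \<rho>(1)[OF b(1) t]] by (cases "\<rho> b t = ?u + \<epsilon>") auto
        then show False using less by simp
      qed
      ultimately show ?thesis using \<epsilon>(2) by (simp add: dist_real_def)
    qed (use \<open>0 < e\<close> in simp)
    then show "\<exists>d>0. \<forall>b\<in>?I. dist b a < d \<longrightarrow> dist (\<rho> b t) ?u < e" using \<delta>(1) by blast
  qed
  show ?thesis
  proof (intro exI[of _ \<rho>] conjI ballI)
    fix a t assume at: "a \<in> ?I" "t \<in> ?J"
    show "\<rho> a t \<in> ?J" by (rule \<rho>(1)[OF at])
    show "(1 - a) * \<rho> a t + a * s (\<rho> a t) = t" by (rule \<rho>(2)[OF at, unfolded g_def])
    show "\<rho> a ((1 - a) * t + a * s t) = t" by (rule \<rho>g[OF at, unfolded g_def])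
  next
    show "smooth_on ?J (\<rho> a)" if "a \<in> ?I" for a by (rule sm[OF that])
    show "continuous_on ?I (\<lambda>a. \<rho> a t)" if "t \<in> ?J" for t by (rule cont[OF that])
  qed
qed

lemma surface_boundary_diffeomorphism:
  assumes fg: "diffeomorphism S S' f g" and x: "x \<in> surface_boundary S"
  shows "f x \<in> surface_boundary S'"
proof -
  obtain W \<psi> w where w: "local_param S W \<psi>" "w \<in> W" "w $ 2 = 0" "x = \<psi> w"
    using x unfolding surface_boundary_def by blast
  have "openin (top_of_set S') (f ` \<psi> ` W)"
    using homeomorphism_imp_open_map[OF diffeomorphism_imp_homeomorphism[OF fg]] w(1)
    unfolding local_param_def by blast
  moreover have "smooth_embedding W S' (f \<circ> \<psi>)"
    by (rule smooth_embedding_compose[OF _ fg subset_refl]) (use w(1) in \<open>simp add: local_param_def\<close>)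
  ultimately have "local_param S' W (f \<circ> \<psi>)"
    using w(1) unfolding local_param_def by (simp add: image_comp)
  then show ?thesis
    unfolding surface_boundary_def mem_Collect_eq
    by (intro exI[of _ W] exI[of _ "f \<circ> \<psi>"] exI[of _ w]) (use w(2-4) in simp)
qed

text \<open>
  A diffeomorphism that maps levels to levels differs from the product map given by its restriction
  to the middle level by two isotopies: one moves the level at which the surface coordinate is
  evaluated, the other moves the interval coordinate.
\<close>

lemma stably_equivalent_level_preserving:
  fixes S :: "(real^4) set" and \<phi> :: "(real^4) \<times> real \<Rightarrow> (real^4) \<times> real"
  assumes \<phi>: "diffeomorphism (S \<times> {0<..<1}) (S \<times> {0<..<1}) \<phi> \<psi>"
    and s: "\<And>y. y \<in> S \<times> {0<..<1} \<Longrightarrow> snd (\<phi> y) = s (snd y)" "strict_mono_on {0<..<1} s"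
    and r: "\<And>y. y \<in> S \<times> {0<..<1} \<Longrightarrow> snd (\<psi> y) = r (snd y)"
    and int: "openin (top_of_set S) (S - surface_boundary S)"
    and k: "k ` unit_circle \<subseteq> (S - surface_boundary S) \<times> {0<..<1}"
    and k0: "knot_in_thickened_surface (S, A, \<lambda>z. (fst (\<phi> (fst (k z), 1/2)), snd (k z)))"
    and k': "\<And>z. z \<in> unit_circle \<Longrightarrow> k' z = \<phi> (k z)"
  shows "stably_equivalent (S, A, \<lambda>z. (fst (\<phi> (fst (k z), 1/2)), snd (k z))) (S, A, k')"
proof -
  let ?X = "S \<times> {0<..<1::real}" and ?I = "{0..1::real}" and ?J = "{0<..<1::real}"
  obtain z0 :: complex where z0: "z0 \<in> unit_circle" by (auto intro: that[of 1])
  then obtain x0 where x0: "x0 \<in> S" using k by (metis DiffD1 SigmaE image_subset_iff)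
  have \<phi>X: "\<phi> y \<in> ?X" "\<psi> y \<in> ?X" if "y \<in> ?X" for y
    using that diffeomorphism_image[OF \<phi>] diffeomorphism_inverse_image[OF \<phi>] by blast+
  have sJ: "s t \<in> ?J" "r t \<in> ?J" if "t \<in> ?J" for t
    using \<phi>X[of "(x0, t)"] s(1)[of "(x0, t)"] r[of "(x0, t)"] x0 that by (auto simp: mem_Times_iff)
  have rs: "r (s t) = t" "s (r t) = t" if "t \<in> ?J" for t
    using diffeomorphism_inverse[OF \<phi>, of "(x0, t)"] diffeomorphism_inverse'[OF \<phi>, of "(x0, t)"]
      \<phi>X[of "(x0, t)"] s(1) r x0 that by (metis SigmaI snd_conv)+
  define f where "f t x = fst (\<phi> (x, t))" for t x
  \<comment> \<open>Since \<open>\<phi>\<close> maps level \<open>t\<close> to level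
    \<open>s t\<close>, the inverse of \<open>f t\<close> is read off from \<open>\<psi>\<close> on
    level \<open>s t\<close>.\<close>
  define g where "g t x = fst (\<psi> (x, s t))" for t x
  have fS: "f t x \<in> S" "g t x \<in> S" if "t \<in> ?J" "x \<in> S" for t x
    using \<phi>X(1)[of "(x, t)"] \<phi>X(2)[of "(x, s t)"] sJ that by (auto simp: f_def g_def mem_Times_iff)
  have gf: "g t (f t x) = x" if "t \<in> ?J" "x \<in> S" for t x
  proof -
    have "\<phi> (x, t) = (f t x, s t)" using s(1)[of "(x, t)"] that by (simp add: f_def prod_eq_iff)
    then show ?thesis using diffeomorphism_inverse[OF \<phi>, of "(x, t)"] that by (simp add: g_def)
  qed
  have fg: "f t (g t x) = x" if "t \<in> ?J" "x \<in> S" for t x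
  proof -
    have "\<psi> (x, s t) = (g t x, t)" using r[of "(x, s t)"] rs sJ that by (simp add: g_def prod_eq_iff)
    then show ?thesis using diffeomorphism_inverse'[OF \<phi>, of "(x, s t)"] sJ that by (simp add: f_def)
  qed
  have f_smooth: "smooth_on ?X (\<lambda>y. f (snd y) (fst y))"
    unfolding f_def by (rule smooth_on_fst, rule smooth_on_cong[OF diffeomorphism_smooth[OF \<phi>]]) auto
  have s_smooth: "smooth_on ?J s"
  proof (rule smooth_on_cong[of _ "\<lambda>t. snd (\<phi> (x0, t))"])
    show "smooth_on ?J (\<lambda>t. snd (\<phi> (x0, t)))"
      by (rule smooth_on_snd, rule smooth_on_compose[OF diffeomorphism_smooth[OF \<phi>]], intro smooth_on_intros)
        (use x0 in auto)
  qed (use s(1) x0 in auto)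
  have r_smooth: "smooth_on ?J r"
  proof (rule smooth_on_cong[of _ "\<lambda>t. snd (\<psi> (x0, t))"])
    show "smooth_on ?J (\<lambda>t. snd (\<psi> (x0, t)))"
      by (rule smooth_on_snd, rule smooth_on_compose[OF diffeomorphism_smooth_inverse[OF \<phi>]], intro smooth_on_intros)
        (use x0 in auto)
  qed (use r x0 in auto)
  have g_smooth: "smooth_on ?X (\<lambda>y. g (snd y) (fst y))"
    unfolding g_def
    by (rule smooth_on_fst, rule smooth_on_compose[OF diffeomorphism_smooth_inverse[OF \<phi>]],
        intro smooth_on_intros smooth_on_compose[OF s_smooth smooth_on_snd[OF smooth_on_ident]])
      (use sJ in auto)
  have bd: "f t x \<in> S - surface_boundary S" if t: "t \<in> ?J" and x: "x \<in> S - surface_boundary S" for t x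
  proof -
    have "diffeomorphism S S (g t) (f t)"
    proof (rule diffeomorphismI)
      show "smooth_on S (f t)"
        using smooth_on_compose[OF f_smooth smooth_on_Pair[OF smooth_on_ident smooth_on_const[of S t]]] t by fastforce
      show "smooth_on S (g t)"
        using smooth_on_compose[OF g_smooth smooth_on_Pair[OF smooth_on_ident smooth_on_const[of S t]]] t by fastforce
    qed (use fS[OF t] gf[OF t] fg[OF t] in auto)
    \<comment> \<open>If \<open>f t x\<close> were a boundary point, its image \<open>x\<close>
      under the inverse diffeomorphism \<open>g t\<close> would be one, too.\<close>
    from surface_boundary_diffeomorphism[OF this, of "f t x"] show ?thesis
      using gf[OF t] fS[OF t] x by auto
  qed
  \<comment> \<open>The level of evaluation moves linearly from the constant 1/2 at time 0 to the
    actual level \<open>t\<close> at time 1.\<close>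
  define c where "c a t = 1/2 + a * (t - 1/2)" for a t :: real
  have cJ: "c a t \<in> ?J" if "a \<in> ?I" "t \<in> ?J" for a t
  proof -
    have "c a t = (1 - a) * (1/2) + a * t" by (simp add: c_def field_simps)
    then show ?thesis using convexD_alt[of ?J "1/2" t a] that by simp
  qed
  have kX: "k z \<in> ?X" "fst (k z) \<in> S - surface_boundary S" "snd (k z) \<in> ?J" if "z \<in> unit_circle" for z
  proof -
    have "k z \<in> (S - surface_boundary S) \<times> ?J" using k that by blast
    then show "k z \<in> ?X" "fst (k z) \<in> S - surface_boundary S" "snd (k z) \<in> ?J"
      by (simp_all add: mem_Times_iff)
  qed

  \<comment> \<open>The interval coordinate is kept and only the surface coordinate moves, from the
    product map with \<open>f (1/2)\<close> to \<open>(f t x, t)\<close>. Since levels stay fixed,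
    \<open>V1 a\<close> inverts \<open>U1 a\<close> level by level.\<close>
  define U1 where "U1 a y = (f (c a (snd y)) (fst y), snd y)" for a and y :: "(real^4) \<times> real"
  define V1 where "V1 a y = (g (c a (snd y)) (fst y), snd y)" for a and y :: "(real^4) \<times> real"
  have c_smooth: "smooth_on B (\<lambda>y. c (\<alpha> y) (\<beta> y))" if "smooth_on B \<alpha>" "smooth_on B \<beta>"
    for B :: "'z::euclidean_space set" and \<alpha> \<beta>
    unfolding c_def by (intro smooth_on_intros that)
  have T1: "transport ?X (\<lambda>a b y. U1 b (V1 a y))"
  proof (rule conjugate_transport)
    show "smooth_on (?X \<times> ?I) (\<lambda>(y, b). U1 b y)"
    proof -
      have "smooth_on (?X \<times> ?I) (\<lambda>z. (\<lambda>y. f (snd y) (fst y)) (fst (fst z), c (snd z) (snd (fst z))))"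
        by (rule smooth_on_compose[OF f_smooth], intro smooth_on_Pair c_smooth smooth_on_intros)
          (use cJ in auto)
      then have "smooth_on (?X \<times> ?I) (\<lambda>z. (f (c (snd z) (snd (fst z))) (fst (fst z)), snd (fst z)))"
        by (intro smooth_on_intros) simp
      then show ?thesis by (rule smooth_on_cong) (auto simp: U1_def)
    qed
    show "smooth_on ?X (V1 a)" if a: "a \<in> ?I" for a
    proof -
      have "smooth_on ?X (\<lambda>y. (\<lambda>y. g (snd y) (fst y)) (fst y, c a (snd y)))"
        by (rule smooth_on_compose[OF g_smooth], intro smooth_on_Pair c_smooth smooth_on_intros)
          (use cJ a in auto)
      then have "smooth_on ?X (\<lambda>y. (g (c a (snd y)) (fst y), snd y))"
        by (intro smooth_on_intros) simp
      then show ?thesis by (rule smooth_on_cong) (auto simp: V1_def)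
    qed
    show "continuous_on ?I (\<lambda>a. V1 a y)" if y: "y \<in> ?X" for y
    proof -
      have "continuous_on ?I (\<lambda>a. (\<lambda>y. g (snd y) (fst y)) (fst y, c a (snd y)))"
        by (rule continuous_on_compose2[OF smooth_on_imp_continuous_on[OF g_smooth]])
          (use cJ y in \<open>auto simp: c_def intro!: continuous_intros\<close>)
      then show ?thesis unfolding V1_def by (intro continuous_on_Pair continuous_on_const) simp
    qed
    fix a y assume a: "a \<in> ?I" and "y \<in> ?X"
    then have y: "snd y \<in> ?J" "fst y \<in> S" by (auto simp: mem_Times_iff)
    note cy = cJ[OF a y(1)]
    show "U1 a y \<in> ?X" "V1 a y \<in> ?X"
      using fS[OF cy y(2)] y(1) by (simp_all add: U1_def V1_def mem_Times_iff)
    show "U1 a (V1 a y) = y" using fg[OF cy y(2)] by (simp add: U1_def V1_def prod_eq_iff)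
    show "V1 a (U1 a y) = y" using gf[OF cy y(2)] by (simp add: U1_def V1_def prod_eq_iff)
  qed
  have VU1: "V1 a (U1 a y) = y" if "a \<in> ?I" "y \<in> ?X" for a y
  proof -
    have "snd y \<in> ?J" "fst y \<in> S" using that(2) by (auto simp: mem_Times_iff)
    then show ?thesis using gf[OF cJ[OF that(1)]] by (simp add: U1_def V1_def prod_eq_iff)
  qed
  define k1 where "k1 z = (f (snd (k z)) (fst (k z)), snd (k z))" for z
  have U1_0: "(fst (\<phi> (fst (k z), 1/2)), snd (k z)) = U1 0 (k z)" for z by (simp add: U1_def c_def f_def)
  have U1_1: "k1 z = U1 1 (k z)" for z by (simp add: U1_def c_def k1_def)
  have st1: "knot_in_thickened_surface (S, A, k1) \<and>
      stably_equivalent (S, A, \<lambda>z. (fst (\<phi> (fst (k z), 1/2)), snd (k z))) (S, A, k1)"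
  proof (rule stably_equivalent_transport[OF T1 k0 int])
    show "(\<lambda>z. (fst (\<phi> (fst (k z), 1/2)), snd (k z))) ` unit_circle \<subseteq> ?X"
      using fS(1)[of "1/2"] kX by (auto simp: f_def[symmetric])
    show "U1 a (V1 0 (fst (\<phi> (fst (k z), 1/2)), snd (k z))) \<in> (S - surface_boundary S) \<times> ?J"
      if "a \<in> ?I" "z \<in> unit_circle" for a z
    proof -
      have "V1 0 (U1 0 (k z)) = k z" using VU1[OF _ kX(1)[OF that(2)], of 0] by simp
      moreover have "U1 a (k z) \<in> (S - surface_boundary S) \<times> ?J"
        using bd[OF cJ[OF that(1) kX(3)[OF that(2)]] kX(2)[OF that(2)]] kX(3)[OF that(2)]
        by (simp only: U1_def mem_Times_iff fst_conv snd_conv simp_thms)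
      ultimately show ?thesis unfolding U1_0 by (simp only:)
    qed
    show "k1 z = U1 1 (V1 0 (fst (\<phi> (fst (k z), 1/2)), snd (k z)))" if "z \<in> unit_circle" for z
      unfolding U1_0 U1_1 using VU1[OF _ kX(1)[OF that], of 0] by simp
  qed

  \<comment> \<open>The second isotopy slides the interval coordinate from \<open>t\<close> to
    \<open>s t\<close>, turning \<open>(f t x, t)\<close> into \<open>\<phi> (x, t)\<close>. The
    interpolation lemma supplies its inverses.\<close>
  have "\<exists>\<rho>. (\<forall>a\<in>?I. \<forall>t\<in>?J. \<rho> a t \<in> ?J \<and>
      (1 - a) * \<rho> a t + a * s (\<rho> a t) = t \<and> \<rho> a ((1 - a) * t + a * s t) = t) \<and>
      (\<forall>a\<in>?I. smooth_on ?J (\<rho> a)) \<and> (\<forall>t\<in>?J. continuous_on ?I (\<lambda>a. \<rho> a t))"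
    by (rule increasing_diffeomorphism_interpolation[OF s_smooth sJ(1) r_smooth sJ(2) rs s(2)])
  then obtain \<rho> where \<rho>_inv: "\<forall>a\<in>?I. \<forall>t\<in>?J. \<rho> a t \<in> ?J \<and>
      (1 - a) * \<rho> a t + a * s (\<rho> a t) = t \<and> \<rho> a ((1 - a) * t + a * s t) = t"
    and \<rho>_smooth: "\<forall>a\<in>?I. smooth_on ?J (\<rho> a)"
    and \<rho>_cont: "\<forall>t\<in>?J. continuous_on ?I (\<lambda>a. \<rho> a t)"
    by (elim exE conjE) (rule that)
  have \<rho>: "\<rho> a t \<in> ?J" "(1 - a) * \<rho> a t + a * s (\<rho> a t) = t" "\<rho> a ((1 - a) * t + a * s t) = t"
    if "a \<in> ?I" "t \<in> ?J" for a t
    using bspec[OF bspec[OF \<rho>_inv that(1)] that(2)] by (simp_all only:)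
  define U2 where "U2 a y = (fst y, (1 - a) * snd y + a * s (snd y))" for a and y :: "(real^4) \<times> real"
  define V2 where "V2 a y = (fst y, \<rho> a (snd y))" for a and y :: "(real^4) \<times> real"
  have U2J: "(1 - a) * t + a * s t \<in> ?J" if "a \<in> ?I" "t \<in> ?J" for a t
    using convexD_alt[of ?J t "s t" a] sJ(1) that by simp
  have T2: "transport ?X (\<lambda>a b y. U2 b (V2 a y))"
  proof (rule conjugate_transport)
    have "smooth_on (?X \<times> ?I) (\<lambda>z. s (snd (fst z)))"
      by (rule smooth_on_compose[OF s_smooth], intro smooth_on_intros) auto
    then have "smooth_on (?X \<times> ?I) (\<lambda>z. (fst (fst z), (1 - snd z) * snd (fst z) + snd z * s (snd (fst z))))"
      by (intro smooth_on_intros)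
    then show "smooth_on (?X \<times> ?I) (\<lambda>(y, b). U2 b y)"
      by (rule smooth_on_cong) (auto simp: U2_def)
    show "smooth_on ?X (V2 a)" if a: "a \<in> ?I" for a
    proof -
      have "smooth_on ?X (\<lambda>y. (fst y, \<rho> a (snd y)))"
        by (intro smooth_on_intros smooth_on_compose[OF \<rho>_smooth[rule_format, OF a] smooth_on_snd[OF smooth_on_ident]]) auto
      then show ?thesis by (rule smooth_on_cong) (auto simp: V2_def)
    qed
    show "continuous_on ?I (\<lambda>a. V2 a y)" if y: "y \<in> ?X" for y
      unfolding V2_def by (intro continuous_intros \<rho>_cont[rule_format]) (use y in auto)
    fix a y assume a: "a \<in> ?I" and "y \<in> ?X"
    then have y: "fst y \<in> S" "snd y \<in> ?J" by (auto simp: mem_Times_iff)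
    show "U2 a y \<in> ?X" "V2 a y \<in> ?X"
      using U2J[OF a y(2)] \<rho>(1)[OF a y(2)] y(1) by (simp_all add: U2_def V2_def mem_Times_iff)
    show "U2 a (V2 a y) = y" using \<rho>(2)[OF a y(2)] by (simp add: U2_def V2_def prod_eq_iff)
    show "V2 a (U2 a y) = y" using \<rho>(3)[OF a y(2)] by (simp add: U2_def V2_def prod_eq_iff)
  qed
  have V20: "V2 0 y = y" if "y \<in> ?X" for y
    using \<rho>(3)[of 0 "snd y"] that by (auto simp: V2_def)
  have k1X: "k1 z \<in> ?X" "fst (k1 z) \<in> S - surface_boundary S" if "z \<in> unit_circle" for z
    using bd[OF kX(3)[OF that] kX(2)[OF that]] kX(3)[OF that] by (simp_all add: k1_def)
  have "knot_in_thickened_surface (S, A, k') \<and> stably_equivalent (S, A, k1) (S, A, k')"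
  proof (rule stably_equivalent_transport[OF T2 _ int])
    show "knot_in_thickened_surface (S, A, k1)" using st1 by blast
    show "k1 ` unit_circle \<subseteq> ?X" using k1X(1) by blast
    show "U2 a (V2 0 (k1 z)) \<in> (S - surface_boundary S) \<times> ?J" if "a \<in> ?I" "z \<in> unit_circle" for a z
      using V20[OF k1X(1)[OF that(2)]] k1X[OF that(2)] U2J[OF that(1), of "snd (k1 z)"]
      by (simp add: U2_def mem_Times_iff)
    show "k' z = U2 1 (V2 0 (k1 z))" if "z \<in> unit_circle" for z
      using V20[OF k1X(1)[OF that]] s(1)[OF kX(1)[OF that]] k'[OF that] by (simp add: U2_def k1_def f_def prod_eq_iff)
  qed
  then show ?thesis using st1 stably_equivalent_trans by blast
qed

section \<open>Boundary and orientation\<close>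

text \<open>In local coordinates, an open piece of the 3-sphere would map injectively and
  continuously into half-plane times interval. By invariance of domain its image is open in 3-space,
  so it cannot contain a point on the edge of the half-plane.\<close>

lemma (in fibered_cover) boundary_avoids_open:
  assumes G: "openin (top_of_set S3) G" "G \<subseteq> E" and x: "x \<in> surface_boundary S" and t: "t \<in> {0<..<1}"
  shows "q (x, t) \<notin> G"
proof
  assume in_G: "q (x, t) \<in> G"
  obtain W \<psi> w where w: "local_param S W \<psi>" "w \<in> W" "w $ 2 = 0" "x = \<psi> w"
    using x unfolding surface_boundary_def by blast
  obtain \<psi>' where \<psi>: "diffeomorphism W (\<psi> ` W) \<psi> \<psi>'"
    using w(1) unfolding local_param_def smooth_embedding_def by blast
  have W: "W \<subseteq> half_plane" "openin (top_of_set S) (\<psi> ` W)"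
    using w(1) openin_imp_subset unfolding local_param_def by blast+
  have xX: "(x, t) \<in> X" using surface_boundary_subset x t by auto
  obtain U g where U: "openin (top_of_set X) U" "(x, t) \<in> U" "diffeomorphism U (q ` U) q g"
    using local_diffeo[OF xX] by blast
  let ?U = "U \<inter> (\<psi> ` W \<times> {0<..<1})"
  have "openin (top_of_set X) ?U"
    by (intro openin_Int U(1) openin_Times W(2) openin_subtopology_self)
  then have "openin (top_of_set E) (q ` ?U)" by (rule covering_space_open_map[OF cover])
  then obtain O' where O': "open O'" "q ` ?U = E \<inter> O'" by (auto simp: openin_open)
  let ?G = "G \<inter> q ` ?U"
  have G_open: "openin (top_of_set S3) ?G"
  proof -
    have "?G = G \<inter> O'" using O'(2) G(2) by blast
    then show ?thesis using G(1) O'(1) by (auto simp: openin_open)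
  qed
  have gq: "g (q y) = y" if "y \<in> U" for y by (rule diffeomorphism_inverse[OF U(3) that])
  define m where "m e = (\<psi>' (fst (g e)), snd (g e))" for e
  have m: "m e \<in> W \<times> {0<..<1} \<and> q (\<psi> (fst (m e)), snd (m e)) = e" if "e \<in> ?G" for e
  proof -
    obtain y where y: "y \<in> ?U" "e = q y" using \<open>e \<in> ?G\<close> by blast
    then have "fst y \<in> \<psi> ` W" "snd y \<in> {0<..<1}" by (auto simp: mem_Times_iff)
    then show ?thesis
      using diffeomorphism_inverse_image[OF \<psi>] diffeomorphism_inverse'[OF \<psi>] gq y
      by (auto simp: m_def)
  qed
  have "openin (top_of_set UNIV) (m ` ?G)"
  proof (rule invariance_of_domain_sphere_affine_set[OF _ _ _ _ _ _ G_open])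
    have cg: "continuous_on ?G g"
      by (rule continuous_on_subset[OF smooth_on_imp_continuous_on[OF diffeomorphism_smooth_inverse[OF U(3)]]]) auto
    have "(\<lambda>e. fst (g e)) ` ?G \<subseteq> \<psi> ` W" using gq by auto
    then have "continuous_on ?G (\<lambda>e. \<psi>' (fst (g e)))"
      by (rule continuous_on_compose2[OF smooth_on_imp_continuous_on[OF diffeomorphism_smooth_inverse[OF \<psi>]]
            continuous_on_fst[OF cg]])
    then show "continuous_on ?G m" unfolding m_def by (intro continuous_on_Pair continuous_on_snd cg)
    show "inj_on m ?G"
    proof (rule inj_onI)
      fix e e' assume e: "e \<in> ?G" "e' \<in> ?G" "m e = m e'"
      show "e = e'"
        using conjunct2[OF m[OF e(1)]] conjunct2[OF m[OF e(2)]] unfolding e(3) by (rule trans[OF sym])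
    qed
  qed (auto simp: aff_dim_UNIV)
  then have op: "open (m ` ?G)" by simp
  have "(x, t) \<in> ?U" using U(2) w t by auto
  then have "m (q (x, t)) = (w, t)"
    using gq[OF U(2)] diffeomorphism_inverse[OF \<psi> w(2)] w(4) by (simp add: m_def)
  moreover have "q (x, t) \<in> ?G" using in_G \<open>(x, t) \<in> ?U\<close> by blast
  ultimately have "(w, t) \<in> m ` ?G" by (rule image_eqI[OF sym])
  then obtain e where e: "e > 0" "ball (w, t) e \<subseteq> m ` ?G" using op open_contains_ball by blast
  \<comment> \<open>An open image would contain points slightly below the edge, outside the
    half-plane.\<close>
  have "(w - axis 2 (e / 2), t) \<in> ball (w, t) e"
    using e(1) by (simp add: dist_Pair_Pair dist_norm norm_vec_def L2_set_def sum_2 axis_def)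
  then have "(w - axis 2 (e / 2), t) \<in> m ` ?G" using e(2) by blast
  then obtain e' where "e' \<in> ?G" "m e' = (w - axis 2 (e / 2), t)"
    by (elim imageE) (rule that, assumption, rule sym)
  then have "w - axis 2 (e / 2) \<in> W" using conjunct1[OF m[of e']] by simp
  then show False using W(1) w(3) e(1) by (auto simp: half_plane_def axis_def)
qed

section \<open>Frames of the 3-sphere and derivatives at the edge of a half-plane\<close>

lemma vector_4:
  "(vector [x, y, z, u] :: 'a::zero^4) $ 1 = x" "(vector [x, y, z, u] :: 'a::zero^4) $ 2 = y"
  "(vector [x, y, z, u] :: 'a::zero^4) $ 3 = z" "(vector [x, y, z, u] :: 'a::zero^4) $ 4 = u"
  unfolding vector_def by simp_all

lemma det_block_4:
  "det (vector [vector [1, 0, 0, 0], vector [0, a, b, 0], vector [0, c, d, 0], vector [0, e, f, h]] :: real^4^4) =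
    (a * d - b * c) * h"
proof -
  have f: "finite {2::4, 3, 4}" "1 \<notin> {2::4, 3, 4}" "finite {3::4, 4}" "2 \<notin> {3::4, 4}"
      "finite {4::4}" "3 \<notin> {4::4}"
    by auto
  show ?thesis
    unfolding det_def UNIV_4
    unfolding sum_over_permutations_insert[OF f(1,2)]
    unfolding sum_over_permutations_insert[OF f(3,4)]
    unfolding sum_over_permutations_insert[OF f(5,6)]
    unfolding permutes_sing
    by (simp add: sign_swap_id permutation_swap_id sign_compose sign_id swap_id_eq vector_4)
      (simp add: left_diff_distrib mult.assoc)
qed

text \<open>The row \<open>g\<close> is the position vector on the sphere, common to both frames.
  The other rows change by a block triangular matrix, because directions along the surface acquire
  no component along the levels.\<close>

lemma det_change_frame:
  fixes g x y z :: "real^4"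
  shows "det (vector [g, a *\<^sub>R x + b *\<^sub>R y, c *\<^sub>R x + d *\<^sub>R y, e *\<^sub>R x + f *\<^sub>R y + h *\<^sub>R z] :: real^4^4) =
    (a * d - b * c) * h * det (vector [g, x, y, z] :: real^4^4)"
proof -
  let ?N = "vector [vector [1, 0, 0, 0], vector [0, a, b, 0], vector [0, c, d, 0], vector [0, e, f, h]] :: real^4^4"
  have "(vector [g, a *\<^sub>R x + b *\<^sub>R y, c *\<^sub>R x + d *\<^sub>R y, e *\<^sub>R x + f *\<^sub>R y + h *\<^sub>R z] :: real^4^4) =
      ?N ** vector [g, x, y, z]"
    unfolding vec_eq_iff forall_4 matrix_matrix_mult_def by (simp add: sum_4 vector_4)
  then show ?thesis by (simp add: det_mul det_block_4)
qed

text \<open>Charts may lie at the edge of the half-plane, where a derivative within the set is not a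
  derivative at the point. It is still unique, since arbitrarily small steps in every basis
  direction stay in the set.\<close>

lemma half_plane_derivative_unique:
  fixes f :: "(real^2) \<times> real \<Rightarrow> 'b::real_normed_vector"
  assumes Z: "openin (top_of_set (half_plane \<times> UNIV)) Z" "x \<in> Z"
    and f: "(f has_derivative f') (at x within Z)" "(f has_derivative f'') (at x within Z)"
  shows "f' = f''"
proof (rule frechet_derivative_unique_within[OF f])
  fix i :: "(real^2) \<times> real" and e :: real
  assume i: "i \<in> Basis" and e: "e > 0"
  obtain G where G: "open G" "Z = (half_plane \<times> UNIV) \<inter> G" using Z(1) by (auto simp: openin_open)
  then obtain r where r: "r > 0" "ball x r \<subseteq> G" using Z(2) open_contains_ball by blast
  define d where "d = min e r / 2"
  have d: "0 < d" "d < e" "d < r" using e r(1) by (auto simp: d_def min_def)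
  have "norm i = 1" using i by (rule norm_Basis)
  then have *: "x + d *\<^sub>R i \<in> ball x r" using d by (simp add: dist_norm)
  \<comment> \<open>Only positive multiples of the basis vectors are used; these never lead out of
    the half-plane.\<close>
  have "0 \<le> fst i $ 2" using i by (auto simp: Basis_prod_def Basis_vec_def axis_def)
  then have "x + d *\<^sub>R i \<in> half_plane \<times> UNIV"
    using Z(2) G(2) d(1) by (auto simp: half_plane_def mem_Times_iff)
  then have "x + d *\<^sub>R i \<in> Z" unfolding G(2) using subsetD[OF r(2) *] by (rule IntI)
  then show "\<exists>d. 0 < \<bar>d\<bar> \<and> \<bar>d\<bar> < e \<and> x + d *\<^sub>R i \<in> Z" using d by (intro exI[of _ d]) auto
qed

text \<open>
  Compare the frames of the 3-sphere given by the two products: the change of frame is block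
  triangular, with blocks the derivative of the surface map and the positive speed of the levels.
\<close>

lemma level_map_orientation_preserving:
  fixes S :: "(real^4) set"
  assumes q: "orientation_preserving_to_S3 A1 q1" "orientation_preserving_to_S3 A2 q2"
    and S: "oriented_surface S A1" "oriented_surface S A2"
    and \<phi>: "smooth_on (S \<times> {0<..<1}) \<phi>" "\<And>y. y \<in> S \<times> {0<..<1} \<Longrightarrow> \<phi> y \<in> S \<times> {0<..<1}"
      "\<And>y. y \<in> S \<times> {0<..<1} \<Longrightarrow> q2 (\<phi> y) = q1 y"
    and s: "\<And>y. y \<in> S \<times> {0<..<1} \<Longrightarrow> snd (\<phi> y) = s (snd y)" "strict_mono_on {0<..<1} s"
    and c: "c \<in> {0<..<1}"
  shows "orientation_preserving_on S (\<lambda>x. fst (\<phi> (x, c))) A1 A2"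
  unfolding orientation_preserving_on_def split_beta
proof (intro ballI impI, elim conjE)
  fix a b w w'
  assume "a \<in> A1" "b \<in> A2" and w: "w \<in> fst a" "w' \<in> fst b" "snd a w \<in> S" "fst (\<phi> (snd a w, c)) = snd b w'"
  define W \<psi> W' \<eta> where chart: "W = fst a" "\<psi> = snd a" "W' = fst b" "\<eta> = snd b"
  have A: "(W, \<psi>) \<in> A1" "(W', \<eta>) \<in> A2"
    using \<open>a \<in> A1\<close> \<open>b \<in> A2\<close> by (simp_all add: chart)
  note w = w[folded chart]
  let ?J = "{0<..<1::real}" and ?X = "S \<times> {0<..<1::real}"
  have lp: "local_param S W \<psi>" "local_param S W' \<eta>"
    using S A unfolding oriented_surface_def by blast+
  obtain \<psi>' where \<psi>: "diffeomorphism W (\<psi> ` W) \<psi> \<psi>'" and \<psi>S: "\<psi> ` W \<subseteq> S"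
    using lp(1) unfolding local_param_def smooth_embedding_def by blast
  obtain \<eta>' where \<eta>: "diffeomorphism W' (\<eta> ` W') \<eta> \<eta>'"
    using lp(2) unfolding local_param_def smooth_embedding_def by blast
  have W: "openin (top_of_set half_plane) W" "openin (top_of_set S) (\<eta> ` W')"
    using lp unfolding local_param_def by blast+
  let ?Y = "W \<times> ?J"
  define F where "F z = \<phi> (\<psi> (fst z), snd z)" for z :: "(real^2) \<times> real"
  have FX: "(\<psi> (fst z), snd z) \<in> ?X" if "z \<in> ?Y" for z using that \<psi>S by auto
  have F_smooth: "smooth_on ?Y F"
    unfolding F_def
    by (rule smooth_on_compose[OF \<phi>(1)], intro smooth_on_intros
        smooth_on_compose[OF diffeomorphism_smooth[OF \<psi>] smooth_on_fst[OF smooth_on_ident]]) (use FX in auto)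
  define Z where "Z = ?Y \<inter> (\<lambda>z. fst (F z)) -` (\<eta> ` W')"
  have "openin (top_of_set ?Y) Z"
    unfolding Z_def
  proof (rule continuous_openin_preimage[OF _ _ W(2)])
    show "continuous_on ?Y (\<lambda>z. fst (F z))"
      by (rule smooth_on_imp_continuous_on[OF smooth_on_fst[OF F_smooth]])
    have "fst (F z) \<in> S" if "z \<in> ?Y" for z
      using \<phi>(2)[OF FX[OF that]] by (simp only: F_def mem_Times_iff)
    then show "(\<lambda>z. fst (F z)) \<in> ?Y \<rightarrow> S" by blast
  qed
  moreover have "openin (top_of_set (half_plane \<times> UNIV)) ?Y"
    by (intro openin_Times W(1)) auto
  ultimately have Z: "openin (top_of_set (half_plane \<times> UNIV)) Z" using openin_trans by blast
  have wZ: "(w, c) \<in> Z" using w c by (simp add: Z_def F_def)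
  have ZY: "Z \<subseteq> ?Y" by (auto simp: Z_def)
  have FZ: "(\<psi> (fst z), snd z) \<in> ?X" if "z \<in> Z" for z
    by (rule FX[OF subsetD[OF ZY that]])
  \<comment> \<open>The map \<open>\<phi>\<close> in the charts \<open>\<psi>\<close> and
    \<open>\<eta>\<close>, with the interval coordinate kept.\<close>
  define R where "R z = (\<eta>' (fst (F z)), snd (F z))" for z
  have \<eta>R: "\<eta> (fst (R z)) = fst (F z)" "fst (R z) \<in> W'" if "z \<in> Z" for z
    using that diffeomorphism_inverse'[OF \<eta>] diffeomorphism_inverse_image[OF \<eta>]
    by (auto simp: R_def Z_def)
  have sndR: "snd (R z) = s (snd z)" if "z \<in> Z" for z
    using s(1)[OF FZ[OF that]] by (simp add: R_def F_def)
  have R_smooth: "smooth_on Z R"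
    unfolding R_def
    by (intro smooth_on_intros smooth_on_compose[OF diffeomorphism_smooth_inverse[OF \<eta>]]
        smooth_on_fst smooth_on_subset[OF F_smooth ZY]) (auto simp: Z_def)
  obtain DR where DR: "(R has_derivative DR) (at (w, c) within Z)"
    by (rule smooth_on_has_derivative[OF R_smooth wZ])
  have Rw: "R (w, c) = (w', s c)"
    using sndR[OF wZ] diffeomorphism_inverse[OF \<eta> w(2)] w(4) by (simp add: R_def F_def prod_eq_iff)
  have sJ: "snd (R z) \<in> ?J" if "z \<in> Z" for z
    using \<phi>(2)[OF FZ[OF that]] by (simp only: R_def F_def mem_Times_iff snd_conv)
  have sc: "s c \<in> ?J" using sJ[OF wZ] by (simp only: Rw snd_conv)

  have RJ: "R z \<in> W' \<times> ?J" if "z \<in> Z" for z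
    using \<eta>R(2)[OF that] sJ[OF that] by (simp only: mem_Times_iff simp_thms)
  obtain D1 where D1: "((\<lambda>(u, t). q1 (\<psi> u, t)) has_derivative D1) (at (w, c) within ?Y)"
      "det (vector [q1 (\<psi> w, c), D1 (axis 1 1, 0), D1 (axis 2 1, 0), D1 (0, 1)] :: real^4^4) > 0"
    using q(1) A(1) w(1) c unfolding orientation_preserving_to_S3_def by blast
  obtain D2 where D2: "((\<lambda>(u, t). q2 (\<eta> u, t)) has_derivative D2) (at (w', s c) within W' \<times> ?J)"
      "det (vector [q2 (\<eta> w', s c), D2 (axis 1 1, 0), D2 (axis 2 1, 0), D2 (0, 1)] :: real^4^4) > 0"
    using q(2) A(2) w(2) sc unfolding orientation_preserving_to_S3_def by blast
  have q12: "(\<lambda>(u, t). q2 (\<eta> u, t)) (R z) = (\<lambda>(u, t). q1 (\<psi> u, t)) z" if "z \<in> Z" for z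
  proof -
    have "(\<eta> (fst (R z)), snd (R z)) = F z" using \<eta>R(1)[OF that] by (simp add: R_def)
    then show ?thesis using \<phi>(3)[OF FZ[OF that]] by (simp add: F_def split_def)
  qed
  have "((\<lambda>(u, t). q2 (\<eta> u, t)) has_derivative D2) (at (R (w, c)) within R ` Z)"
    unfolding Rw by (rule has_derivative_subset[OF D2(1)]) (rule image_subsetI, rule RJ)
  from diff_chain_within[OF DR this]
  have "((\<lambda>z. (\<lambda>(u, t). q1 (\<psi> u, t)) z) has_derivative (D2 \<circ> DR)) (at (w, c) within Z)"
    by (rule has_derivative_transform[OF wZ, rotated]) (simp add: q12 o_def)
  \<comment> \<open>Both sides are derivatives of \<open>q1\<close> in coordinates, as
    \<open>q2 \<circ> \<phi> = q1\<close>. Uniqueness within \<open>Z\<close> identifies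
    them.\<close>
  then have D12: "D1 = D2 \<circ> DR"
    by (rule half_plane_derivative_unique[OF Z wZ has_derivative_subset[OF D1(1) ZY]])
  have "linear DR" "linear D2"
    using has_derivative_linear DR D2(1) by blast+

  have "smooth_on ?J s"
  proof (rule smooth_on_cong[of _ "\<lambda>t. snd (\<phi> (\<psi> w, t))"])
    show "smooth_on ?J (\<lambda>t. snd (\<phi> (\<psi> w, t)))"
      by (rule smooth_on_snd, rule smooth_on_compose[OF \<phi>(1)], intro smooth_on_intros)
        (use w in auto)
  qed (use s(1) w(3) in auto)
  then obtain s' where "(s has_derivative s') (at c within ?J)" by (rule smooth_on_has_derivative[OF _ c])
  then have s'0: "(s has_derivative s') (at c)" using c by (simp add: at_within_open[of _ ?J])
  define \<nu> where "\<nu> = s' 1"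
  have s'_eq: "s' x = x * \<nu>" for x
    using linear_scale[OF has_derivative_linear[OF s'0], of x 1] by (simp add: \<nu>_def)
  then have "s' = (*) \<nu>" by (simp add: fun_eq_iff mult.commute)
  then have "(s has_real_derivative \<nu>) (at c)"
    using s'0 by (simp add: has_field_derivative_def)
  \<comment> \<open>Only the weak inequality is available from monotonicity. Strictness will come
    from the positive product of determinants.\<close>
  then have s'pos: "\<nu> \<ge> 0"
    using mono_on_imp_deriv_nonneg[OF strict_mono_on_imp_mono_on[OF s(2)]] c by simp
  have "((\<lambda>z. snd (R z)) has_derivative (\<lambda>v. snd (DR v))) (at (w, c) within Z)"
    by (rule has_derivative_snd[OF DR])
  moreover have "((\<lambda>z. snd (R z)) has_derivative (\<lambda>v. s' (snd v))) (at (w, c) within Z)"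
  proof (rule has_derivative_transform[OF wZ])
    show "((\<lambda>z. s (snd z)) has_derivative (\<lambda>v. s' (snd v))) (at (w, c) within Z)"
      by (rule has_derivative_compose[OF has_derivative_snd[OF has_derivative_ident]]) (simp add: s'0)
  qed (use sndR in simp)
  \<comment> \<open>The level of the image depends on the level alone. This is what makes the change
    of frame block triangular.\<close>
  ultimately have sndDR: "snd (DR v) = s' (snd v)" for v
    using half_plane_derivative_unique[OF Z wZ] by metis

  define C where "C v = fst (DR (v, 0))" for v
  have C_lin: "linear C"
  proof -
    have "linear (\<lambda>v::real^2. (v, 0::real))" by (simp add: linear_iff)
    from linear_compose[OF linear_compose[OF this \<open>linear DR\<close>] bounded_linear.linear[OF bounded_linear_fst]]
    show ?thesis by (simp add: C_def[abs_def] o_def)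
  qed
  \<comment> \<open>The points that \<open>\<phi>\<close> sends into the chart \<open>\<eta>\<close>
    on level \<open>c\<close>. They form a neighbourhood of \<open>w\<close> in \<open>W\<close>, so
    derivatives within \<open>W0\<close> and within \<open>W\<close> agree.\<close>
  define W0 where "W0 = {u \<in> W. (u, c) \<in> Z}"
  have w0: "w \<in> W0" using w(1) wZ by (simp add: W0_def)
  have "openin (top_of_set W) W0"
  proof -
    obtain G where "open G" "Z = ?Y \<inter> G" using \<open>openin (top_of_set ?Y) Z\<close> by (auto simp: openin_open)
    then have "W0 = W \<inter> (\<lambda>u. (u, c)) -` G" using c by (auto simp: W0_def)
    moreover have "open ((\<lambda>u::real^2. (u, c)) -` G)"
      using \<open>open G\<close> by (rule open_vimage) (intro continuous_intros)
    ultimately show ?thesis by auto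
  qed
  then obtain G where G: "open G" "W0 = W \<inter> G" by (auto simp: openin_open)
  have atW: "at w within W0 = at w within W"
    by (rule at_within_nhd[of w G]) (use G w0 in auto)
  have DC: "((\<lambda>u. fst (R (u, c))) has_derivative C) (at w within W0)"
  proof -
    have "((\<lambda>u. (u, c)) has_derivative (\<lambda>v. (v, 0))) (at w within W0)"
      by (intro has_derivative_Pair has_derivative_ident has_derivative_const)
    moreover have "(R has_derivative DR) (at (w, c) within (\<lambda>u. (u, c)) ` W0)"
      by (rule has_derivative_subset[OF DR]) (auto simp: W0_def)
    ultimately have "(R \<circ> (\<lambda>u. (u, c)) has_derivative DR \<circ> (\<lambda>v. (v, 0))) (at w within W0)"
      by (rule diff_chain_within)
    from has_derivative_fst[OF this] show ?thesis by (simp add: o_def C_def[abs_def])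
  qed
  obtain B where B: "(\<eta> has_derivative B) (at w' within W')"
    by (rule smooth_on_has_derivative[OF diffeomorphism_smooth[OF \<eta>] w(2)])
  have "(\<eta> has_derivative B) (at (fst (R (w, c))) within (\<lambda>u. fst (R (u, c))) ` W0)"
    unfolding Rw fst_conv by (rule has_derivative_subset[OF B]) (use \<eta>R(2) in \<open>auto simp: W0_def\<close>)
  from diff_chain_within[OF DC this]
  have "((\<lambda>x. fst (\<phi> (x, c))) \<circ> \<psi> has_derivative B \<circ> C) (at w within W0)"
    by (rule has_derivative_transform[OF w0, rotated]) (use \<eta>R(1) in \<open>auto simp: W0_def F_def\<close>)
  then have "((\<lambda>x. fst (\<phi> (x, c))) \<circ> \<psi> has_derivative B \<circ> C) (at w within W)" by (simp only: atW)
  moreover have "det (matrix C) > 0"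
  proof -
    let ?e1 = "axis 1 1 :: real^2" and ?e2 = "axis 2 1 :: real^2"
    have vec2: "v = v $ 1 *\<^sub>R ?e1 + v $ 2 *\<^sub>R ?e2" for v :: "real^2"
      unfolding vec_eq_iff forall_2 by (simp add: axis_def)
    have DRe: "DR (v, 0) = (C v, 0)" for v
      using sndDR[of "(v, 0)"] s'_eq by (simp add: C_def prod_eq_iff)
    have D2e: "D2 (v, t) = v $ 1 *\<^sub>R D2 (?e1, 0) + v $ 2 *\<^sub>R D2 (?e2, 0) + t *\<^sub>R D2 (0, 1)" for v t
    proof -
      have "(v, t) = v $ 1 *\<^sub>R (?e1, 0) + v $ 2 *\<^sub>R (?e2, 0) + t *\<^sub>R (0, 1)"
        using vec2[of v] by simp
      then have "D2 (v, t) = D2 (v $ 1 *\<^sub>R (?e1, 0) + v $ 2 *\<^sub>R (?e2, 0) + t *\<^sub>R (0, 1))"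
        by (rule arg_cong)
      then show ?thesis
        by (simp only: linear_add[OF \<open>linear D2\<close>] linear_scale[OF \<open>linear D2\<close>])
    qed
    have D1v: "D1 (v, 0) = C v $ 1 *\<^sub>R D2 (?e1, 0) + C v $ 2 *\<^sub>R D2 (?e2, 0)" for v
    proof -
      have "D1 (v, 0) = D2 (C v, 0)" by (simp only: D12 o_def DRe)
      also have "\<dots> = C v $ 1 *\<^sub>R D2 (?e1, 0) + C v $ 2 *\<^sub>R D2 (?e2, 0) + 0 *\<^sub>R D2 (0, 1)" by (rule D2e)
      finally show ?thesis by simp
    qed
    define b where "b = fst (DR (0, 1))"
    have DRt: "DR (0, 1) = (b, \<nu>)" using sndDR[of "(0, 1)"] s'_eq[of 1] by (simp add: b_def prod_eq_iff)
    have D1t: "D1 (0, 1) = b $ 1 *\<^sub>R D2 (?e1, 0) + b $ 2 *\<^sub>R D2 (?e2, 0) + \<nu> *\<^sub>R D2 (0, 1)"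
      unfolding D12 o_def DRt by (rule D2e)
    have qq: "q1 (\<psi> w, c) = q2 (\<eta> w', s c)" using q12[OF wZ] Rw by simp
    \<comment> \<open>The first two factors are \<open>det (matrix C)\<close> and the speed of the
      levels. The product and the second frame are positive and the speed is nonnegative, so
      \<open>det (matrix C)\<close> is positive.\<close>
    have "0 < (C ?e1 $ 1 * C ?e2 $ 2 - C ?e1 $ 2 * C ?e2 $ 1) * \<nu> *
        det (vector [q2 (\<eta> w', s c), D2 (?e1, 0), D2 (?e2, 0), D2 (0, 1)] :: real^4^4)"
      using D1(2) unfolding qq D1v D1t det_change_frame .
    then have "0 < (C ?e1 $ 1 * C ?e2 $ 2 - C ?e1 $ 2 * C ?e2 $ 1) * \<nu>"
      using D2(2) by (simp add: zero_less_mult_iff)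
    then have "0 < C ?e1 $ 1 * C ?e2 $ 2 - C ?e1 $ 2 * C ?e2 $ 1"
      using s'pos by (simp add: zero_less_mult_iff)
    then show ?thesis by (simp add: det_2 matrix_def mult.commute)
  qed
  ultimately have "\<exists>A B C. ((\<lambda>x. fst (\<phi> (x, c))) \<circ> \<psi> has_derivative A) (at w within W) \<and>
      (\<eta> has_derivative B) (at w' within W') \<and> linear C \<and> A = B \<circ> C \<and> 0 < det (matrix C)"
    using B C_lin by blast
  then show "\<exists>A B C. ((\<lambda>x. fst (\<phi> (x, c))) \<circ> snd a has_derivative A) (at w within fst a) \<and>
      (snd b has_derivative B) (at w' within fst b) \<and> linear C \<and> A = B \<circ> C \<and> 0 < det (matrix C)"
    unfolding chart .
qed

section \<open>Virtual covers\<close>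

text \<open>Transport of structure along \<open>h\<close>: sheets, local inverses and deck
  transformations are carried over to the product, and \<open>\<pi> \<circ> h'\<close> becomes the
  covering map.\<close>

lemma fibered_cover_of_identification:
  fixes M :: "((real^4) \<times> real) set"
  assumes cov: "infinite_cyclic_cover M \<pi> E" and fib: "fibered_identification p S A M \<pi> h"
    and E: "compact E" and S: "S \<noteq> {}"
  shows "\<exists>h' \<theta> \<sigma>. fibered_cover E p S (\<pi> \<circ> h') \<theta> \<sigma> \<and> diffeomorphism M (S \<times> {0<..<1}) h h' \<and>
    orientation_preserving_to_S3 A (\<pi> \<circ> h')"
proof -
  let ?X = "S \<times> {0<..<1::real}"
  from fib obtain h' \<theta> where h: "diffeomorphism M ?X h h'" and orient: "orientation_preserving_to_S3 A (\<pi> \<circ> h')"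
    and \<theta>: "strict_mono_on {0<..<1} \<theta>" "continuous_on {0<..<1} \<theta>"
    and level: "\<forall>x\<in>S. \<forall>t\<in>{0<..<1}. p (\<pi> (h' (x, t))) = cis (\<theta> t)"
    unfolding fibered_identification_def by (elim exE conjE) (rule that)
  have c: "covering_space M \<pi> E" and M: "connected M"
    and loc: "\<forall>x\<in>M. \<exists>U g. openin (top_of_set M) U \<and> x \<in> U \<and> openin (top_of_set E) (\<pi> ` U) \<and>
        diffeomorphism U (\<pi> ` U) \<pi> g"
    using cov unfolding infinite_cyclic_cover_def by blast+
  from cov obtain \<tau> :: "int \<Rightarrow> (real^4) \<times> real \<Rightarrow> (real^4) \<times> real" where \<tau>: "\<forall>n. continuous_on M (\<tau> n) \<and> \<tau> n ` M \<subseteq> M \<and> (\<forall>x\<in>M. \<pi> (\<tau> n x) = \<pi> x)"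
    and \<tau>_add: "\<forall>m n. \<forall>x\<in>M. \<tau> (m + n) x = \<tau> m (\<tau> n x)"
    and \<tau>_trans: "\<forall>x\<in>M. \<forall>y\<in>M. \<pi> x = \<pi> y \<longrightarrow> (\<exists>!n. \<tau> n x = y)"
    unfolding infinite_cyclic_cover_def by (elim exE conjE) (rule that)
  have homeo: "homeomorphism M ?X h h'" by (rule diffeomorphism_imp_homeomorphism[OF h])
  have hM: "h x \<in> ?X" if "x \<in> M" for x using diffeomorphism_image[OF h] that by blast
  have h'X: "h' y \<in> M" if "y \<in> ?X" for y using diffeomorphism_inverse_image[OF h] that by blast
  have h'h: "h' (h x) = x" if "x \<in> M" for x by (rule diffeomorphism_inverse[OF h that])
  have hh': "h (h' y) = y" if "y \<in> ?X" for y by (rule diffeomorphism_inverse'[OF h that])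
  have hc: "continuous_on M h" "continuous_on ?X h'"
    using homeo unfolding homeomorphism_def by blast+
  have h_open: "openin (top_of_set ?X) (h ` U)" if "openin (top_of_set M) U" for U
    by (rule homeomorphism_imp_open_map[OF homeo that])
  have h_sub: "h ` U \<subseteq> ?X" "h' ` h ` U = U" if "U \<subseteq> M" for U
  proof -
    show "h ` U \<subseteq> ?X" by (rule image_subsetI) (rule hM[OF subsetD[OF that]])
    have "h' (h x) = x" if "x \<in> U" for x by (rule h'h[OF subsetD[OF \<open>U \<subseteq> M\<close> that]])
    then show "h' ` h ` U = U" by (simp add: image_image)
  qed
  have cover: "covering_space ?X (\<pi> \<circ> h') E"
  proof
    show "continuous_on ?X (\<pi> \<circ> h')"
      using continuous_on_compose[OF hc(2)] covering_space_imp_continuous[OF c] diffeomorphism_inverse_image[OF h] by simp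
    show "(\<pi> \<circ> h') ` ?X = E"
      using covering_space_imp_surjective[OF c] diffeomorphism_inverse_image[OF h] by (simp only: image_comp[symmetric])
    fix x assume "x \<in> E"
    from c[unfolded covering_space_def, THEN conjunct2, THEN conjunct2, THEN bspec, OF this]
    obtain T v where T: "x \<in> T" "openin (top_of_set E) T" and v: "\<Union>v = M \<inter> \<pi> -` T"
        "\<forall>u\<in>v. openin (top_of_set M) u" "pairwise disjnt v" "\<forall>u\<in>v. \<exists>q. homeomorphism u T \<pi> q"
      by (elim exE conjE) (rule that)
    have vM: "u \<subseteq> M" if "u \<in> v" for u using v(1) that by blast
    show "\<exists>T. x \<in> T \<and> openin (top_of_set E) T \<and> (\<exists>v. \<Union>v = ?X \<inter> (\<pi> \<circ> h') -` T \<and>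
        (\<forall>u\<in>v. openin (top_of_set ?X) u) \<and> pairwise disjnt v \<and> (\<forall>u\<in>v. \<exists>q. homeomorphism u T (\<pi> \<circ> h') q))"
    proof (intro exI[of _ T] exI[of _ "(`) h ` v"] conjI T)
      show "\<Union> ((`) h ` v) = ?X \<inter> (\<pi> \<circ> h') -` T"
      proof -
        have "\<Union> ((`) h ` v) = h ` (M \<inter> \<pi> -` T)" using v(1) by blast
        also have "\<dots> = ?X \<inter> (\<pi> \<circ> h') -` T"
        proof (intro equalityI subsetI)
          fix y assume "y \<in> h ` (M \<inter> \<pi> -` T)"
          then obtain x where "x \<in> M" "\<pi> x \<in> T" "y = h x" by blast
          then show "y \<in> ?X \<inter> (\<pi> \<circ> h') -` T" using hM[of x] h'h[of x] by (simp only: Int_iff vimage_eq o_apply simp_thms)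
        next
          fix y assume "y \<in> ?X \<inter> (\<pi> \<circ> h') -` T"
          then have y: "y \<in> ?X" "\<pi> (h' y) \<in> T" by (simp_all only: Int_iff vimage_eq o_apply simp_thms)
          then have "h' y \<in> M \<inter> \<pi> -` T" using h'X by blast
          then show "y \<in> h ` (M \<inter> \<pi> -` T)" using hh'[OF y(1)] by (rule image_eqI[OF sym, rotated])
        qed
        finally show ?thesis .
      qed
      show "\<forall>u\<in>(`) h ` v. openin (top_of_set ?X) u" using v(2) h_open by blast
      show "pairwise disjnt ((`) h ` v)"
      proof (rule pairwiseI)
        fix a b assume "a \<in> (`) h ` v" "b \<in> (`) h ` v" "a \<noteq> b"
        then obtain u w where u: "u \<in> v" "a = h ` u" and w: "w \<in> v" "b = h ` w" by blast
        then have "u \<inter> w = {}" using v(3) \<open>a \<noteq> b\<close> unfolding pairwise_def disjnt_def by blast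
        moreover have "inj_on h M" using h'h by (rule inj_on_inverseI)
        ultimately have "h ` u \<inter> h ` w = {}"
          using vM[OF u(1)] vM[OF w(1)] by (metis image_empty inj_on_image_Int)
        then show "disjnt a b" using u w by (simp add: disjnt_def)
      qed
      show "\<forall>u\<in>(`) h ` v. \<exists>q. homeomorphism u T (\<pi> \<circ> h') q"
      proof
        fix a assume "a \<in> (`) h ` v"
        then obtain u where u: "u \<in> v" "a = h ` u" by blast
        obtain q where "homeomorphism u T \<pi> q" using v(4) u(1) by blast
        moreover have "homeomorphism (h ` u) u h' h"
          by (rule homeomorphism_of_subsets[OF homeomorphism_symD[OF homeo]])
            (use h_sub[OF vM[OF u(1)]] vM[OF u(1)] in auto)
        ultimately show "\<exists>q. homeomorphism a T (\<pi> \<circ> h') q"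
          unfolding u(2) using homeomorphism_compose by blast
      qed
    qed
  qed
  have "fibered_cover E p S (\<pi> \<circ> h') \<theta> (\<lambda>n y. h (\<tau> n (h' y)))"
  proof
    show "covering_space ?X (\<pi> \<circ> h') E" by (rule cover)
    show "connected ?X"
      using connected_continuous_image[OF hc(1) M] diffeomorphism_image[OF h] by simp
    show "compact E" "S \<noteq> {}" "strict_mono_on {0<..<1} \<theta>" "continuous_on {0<..<1} \<theta>"
      by (fact E, fact S, fact \<theta>(1), fact \<theta>(2))
  next
    fix y assume y: "y \<in> ?X"
    show "p ((\<pi> \<circ> h') y) = cis (\<theta> (snd y))" using level y by (auto simp: o_def)
    obtain U g where U: "openin (top_of_set M) U" "h' y \<in> U" "openin (top_of_set E) (\<pi> ` U)" "diffeomorphism U (\<pi> ` U) \<pi> g"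
      using loc h'X[OF y] by blast
    have UM: "U \<subseteq> M" using U(1) by (rule openin_imp_subset)
    have img: "(\<pi> \<circ> h') ` h ` U = \<pi> ` U" using h_sub(2)[OF UM] by (simp only: image_comp[symmetric])
    have "diffeomorphism (h ` U) U h' h"
      using diffeomorphism_restrict[OF diffeomorphism_sym[OF h] h_sub(1)[OF UM]] unfolding h_sub(2)[OF UM] .
    from diffeomorphism_compose[OF this U(4)]
    have "diffeomorphism (h ` U) ((\<pi> \<circ> h') ` h ` U) (\<pi> \<circ> h') (h \<circ> g)" unfolding img .
    moreover have "y \<in> h ` U" using U(2) hh'[OF y] by (rule image_eqI[OF sym, rotated])
    ultimately show "\<exists>U g. openin (top_of_set ?X) U \<and> y \<in> U \<and> openin (top_of_set E) ((\<pi> \<circ> h') ` U) \<and>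
        diffeomorphism U ((\<pi> \<circ> h') ` U) (\<pi> \<circ> h') g"
      using h_open[OF U(1)] U(3) unfolding img[symmetric] by blast
  next
    fix n
    have \<tau>M: "\<tau> n x \<in> M" "\<pi> (\<tau> n x) = \<pi> x" if "x \<in> M" for n x using \<tau> that by blast+
    have "continuous_on ?X (\<lambda>y. \<tau> n (h' y))"
      by (rule continuous_on_compose2[of M "\<tau> n"]) (use \<tau> hc(2) h'X in blast)+
    then show "continuous_on ?X (\<lambda>y. h (\<tau> n (h' y)))"
      by (rule continuous_on_compose2[OF hc(1)]) (use \<tau>M(1) h'X in blast)
    fix y assume y: "y \<in> ?X"
    show "h (\<tau> n (h' y)) \<in> ?X" by (intro hM \<tau>M h'X y)
    show "(\<pi> \<circ> h') (h (\<tau> n (h' y))) = (\<pi> \<circ> h') y"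
      using h'h[OF \<tau>M(1)[OF h'X[OF y]]] \<tau>M(2)[OF h'X[OF y]] by simp
    show "h (\<tau> (m + n) (h' y)) = h (\<tau> m (h' (h (\<tau> n (h' y)))))" for m
      using h'h[OF \<tau>M(1)[OF h'X[OF y]]] \<tau>_add h'X[OF y] by simp
    fix y' assume y': "y' \<in> ?X" and eq: "(\<pi> \<circ> h') y = (\<pi> \<circ> h') y'"
    have iff: "h (\<tau> n (h' y)) = y' \<longleftrightarrow> \<tau> n (h' y) = h' y'" for n
      using h'h[OF \<tau>M(1)[OF h'X[OF y]], of n] hh'[OF y'] by metis
    have "\<exists>!n. \<tau> n (h' y) = h' y'"
      using \<tau>_trans h'X[OF y] h'X[OF y'] eq by (simp only: o_apply)
    then show "\<exists>!n. h (\<tau> n (h' y)) = y'" unfolding iff .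
  qed
  then show ?thesis using h orient by blast
qed

text \<open>The covering space disappears from the data. Two virtual covers become knots over one
  and the same product and differ in the covering map, the height, the deck action and the
  atlas.\<close>

lemma virtual_cover_model:
  assumes "virtual_cover V p \<Sigma> K \<kappa>" and \<Sigma>: "compact \<Sigma>" and E: "compact (exterior V)" "\<Sigma> \<noteq> {}"
  shows "\<exists>A q \<theta> \<sigma> k. fibered_cover (exterior V) p \<Sigma> q \<theta> \<sigma> \<and> orientation_preserving_to_S3 A q \<and>
    knot_in_thickened_surface (\<Sigma>, A, k) \<and> k ` unit_circle \<subseteq> \<Sigma> \<times> {0<..<1} \<and>
    (\<forall>z\<in>unit_circle. q (k z) = K z) \<and> \<kappa> = virtual_knot_of (\<Sigma>, A, k)"
proof -
  from assms(1)[unfolded virtual_cover_def] obtain M :: "((real^4) \<times> real) set" and \<pi> A h K'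
    where cov: "infinite_cyclic_cover M \<pi> (exterior V)" and A: "oriented_surface \<Sigma> A"
      and fib: "fibered_identification p \<Sigma> A M \<pi> h" and K': "smooth_embedding unit_circle M K'"
      and lift: "\<forall>z\<in>unit_circle. \<pi> (K' z) = K z" and \<kappa>: "\<kappa> = virtual_knot_of (\<Sigma>, A, h \<circ> K')"
    by (elim exE conjE) (rule that)
  from fibered_cover_of_identification[OF cov fib E] obtain h' \<theta> \<sigma>
    where fc: "fibered_cover (exterior V) p \<Sigma> (\<pi> \<circ> h') \<theta> \<sigma>" and h: "diffeomorphism M (\<Sigma> \<times> {0<..<1}) h h'"
      and orient: "orientation_preserving_to_S3 A (\<pi> \<circ> h')"
    by (elim exE conjE) (rule that)
  have KM: "K' z \<in> M" if "z \<in> unit_circle" for z using K' that unfolding smooth_embedding_def by blast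
  have "smooth_embedding unit_circle (\<Sigma> \<times> {0..1}) (h \<circ> K')"
    by (rule smooth_embedding_compose[OF K' h]) auto
  then have "knot_in_thickened_surface (\<Sigma>, A, h \<circ> K')"
    using A \<Sigma> by (simp add: knot_in_thickened_surface_def)
  moreover have "(h \<circ> K') ` unit_circle \<subseteq> \<Sigma> \<times> {0<..<1}"
    using KM diffeomorphism_image[OF h] by (metis comp_apply image_eqI image_subsetI)
  moreover have "\<forall>z\<in>unit_circle. (\<pi> \<circ> h') ((h \<circ> K') z) = K z"
    using diffeomorphism_inverse[OF h KM] lift by simp
  ultimately show ?thesis using fc orient \<kappa> by blast
qed

text \<open>An ambient isotopy comes with an inverse for each time separately. Joint continuity of
  the inverses holds because \<open>(x, t) \<mapsto> (H t x, t)\<close> is a continuous bijection of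
  a compact space.\<close>

lemma ambient_isotopy_inverse:
  fixes X :: "'a::euclidean_space set"
  assumes X: "compact X" and H: "ambient_isotopy X H"
  shows "\<exists>L. (\<forall>t\<in>{0..1}. diffeomorphism X X (H t) (L t)) \<and> continuous_on (X \<times> {0..1}) (\<lambda>(x, t). L t x)"
proof -
  have "\<forall>t\<in>{0..1}. \<exists>g. diffeomorphism X X (H t) g"
    using H unfolding ambient_isotopy_def by blast
  from bchoice[OF this] obtain L where "\<forall>t\<in>{0..1}. diffeomorphism X X (H t) (L t)" by blast
  then have L: "diffeomorphism X X (H t) (L t)" if "t \<in> {0..1}" for t using that by blast
  have cont: "continuous_on (X \<times> {0..1}) (\<lambda>(x, t). H t x)"
    using H unfolding ambient_isotopy_def by (intro smooth_on_imp_continuous_on) blast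
  have "continuous_on ((\<lambda>z. (H (snd z) (fst z), snd z)) ` (X \<times> {0..1})) (\<lambda>z. (L (snd z) (fst z), snd z))"
  proof (rule continuous_on_inv)
    show "continuous_on (X \<times> {0..1}) (\<lambda>z. (H (snd z) (fst z), snd z))"
      by (intro continuous_on_Pair continuous_on_snd continuous_on_id) (use cont in \<open>simp add: split_def\<close>)
    show "compact (X \<times> {0..1::real})" by (intro compact_Times X compact_Icc)
    show "\<forall>z\<in>X \<times> {0..1}. (L (snd (H (snd z) (fst z), snd z)) (fst (H (snd z) (fst z), snd z)), snd (H (snd z) (fst z), snd z)) = z"
      using diffeomorphism_inverse[OF L] by auto
  qed
  moreover have "(\<lambda>z. (H (snd z) (fst z), snd z)) ` (X \<times> {0..1}) = X \<times> {0..1}"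
  proof (intro equalityI subsetI)
    fix z assume "z \<in> (\<lambda>z. (H (snd z) (fst z), snd z)) ` (X \<times> {0..1})"
    then show "z \<in> X \<times> {0..1}" using diffeomorphism_image[OF L] by fastforce
  next
    fix z assume "z \<in> X \<times> {0..1::real}"
    then have z: "fst z \<in> X" "snd z \<in> {0..1}" by (simp_all only: mem_Times_iff)
    have "z = (H (snd z) (fst (L (snd z) (fst z), snd z)), snd (L (snd z) (fst z), snd z))"
      using diffeomorphism_inverse'[OF L[OF z(2)] z(1)] by (simp add: prod_eq_iff)
    moreover have "L (snd z) (fst z) \<in> X" using diffeomorphism_inverse_image[OF L[OF z(2)]] z(1) by blast
    ultimately show "z \<in> (\<lambda>z. (H (snd z) (fst z), snd z)) ` (X \<times> {0..1})"
      using z(2) by (intro image_eqI[where x = "(L (snd z) (fst z), snd z)"]) auto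
  qed
  ultimately have "continuous_on (X \<times> {0..1}) (\<lambda>z. fst (L (snd z) (fst z), snd z))"
    by (intro continuous_on_fst) simp
  then have "continuous_on (X \<times> {0..1}) (\<lambda>(x, t). L t x)" by (simp add: split_def)
  then show ?thesis using L by blast
qed

theorem theorem4:
  fixes J K1 K2 :: "complex \<Rightarrow> real^4"
    and V \<Sigma> :: "(real^4) set"
    and p :: "real^4 \<Rightarrow> complex"
    and H :: "real \<Rightarrow> real^4 \<Rightarrow> real^4"
    and K1_hat K2_hat :: virtual_knot
  assumes "fibered_triple J V p \<Sigma>"
    and "classical_knot K1" and "V \<inter> K1 ` unit_circle = {}"
    and "classical_knot K2" and "V \<inter> K2 ` unit_circle = {}"
    and "special_seifert_form (K1 ` unit_circle) (V \<inter> \<Sigma>) \<Sigma>"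
    and "special_seifert_form (K2 ` unit_circle) (V \<inter> \<Sigma>) \<Sigma>"
    and "virtual_cover V p \<Sigma> K1 K1_hat"
    and "virtual_cover V p \<Sigma> K2 K2_hat"
    and "ambient_isotopy S3 H"
    and "\<forall>z\<in>unit_circle. H 1 (K1 z) = K2 z"
    and "\<forall>t\<in>{0..1}. \<forall>x\<in>V. H t x = x"
  shows "K1_hat = K2_hat"
proof -
  let ?E = "exterior V" and ?X = "\<Sigma> \<times> {0<..<1::real}" and ?I = "{0..1::real}"
  note triple = assms(1)[unfolded fibered_triple_def]
  have V: "V \<subseteq> S3" "compact V"
  proof -
    have nb: "closed_regular_neighborhood J V" using triple by blast
    then show "V \<subseteq> S3" unfolding closed_regular_neighborhood_def by blast
    obtain \<phi> \<phi>' where "diffeomorphism (unit_circle \<times> cball (0::complex) 1) V \<phi> \<phi>'"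
      using nb unfolding closed_regular_neighborhood_def by blast
    from diffeomorphism_image[OF this] smooth_on_imp_continuous_on[OF diffeomorphism_smooth[OF this]]
    show "compact V" by (metis compact_Times compact_cball compact_continuous_image compact_sphere)
  qed
  have bd: "surface_boundary \<Sigma> = V \<inter> \<Sigma>" and \<Sigma>_compact: "compact \<Sigma>" using triple by blast+
  have fibration: "p ` ?E = unit_circle"
    using triple unfolding smooth_fibration_over_circle_def by blast
  obtain z0 where z0: "z0 \<in> unit_circle" "\<Sigma> = {x \<in> ?E. p x = z0}" using triple by blast
  have \<Sigma>_ne: "\<Sigma> \<noteq> {}"
  proof -
    have "z0 \<in> p ` ?E" using z0(1) unfolding fibration .
    then show ?thesis unfolding z0(2) by blast
  qed
  have E_S3: "?E \<subseteq> S3" and E_compact: "compact ?E"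
  proof -
    have "closure (S3 - V) \<subseteq> S3" by (rule closure_minimal) auto
    then show "?E \<subseteq> S3" by (simp add: exterior_def)
    then show "compact ?E"
      unfolding exterior_def by (meson bounded_sphere bounded_subset closed_closure compact_eq_bounded_closed)
  qed
  have interior_E: "openin (top_of_set S3) (S3 - V)" "S3 - V \<subseteq> ?E"
    using compact_imp_closed[OF V(2)] closure_subset
    by (auto simp: exterior_def Diff_eq openin_open_Int open_Compl intro: closure_subset[THEN subsetD])
  have int: "openin (top_of_set \<Sigma>) (\<Sigma> - surface_boundary \<Sigma>)"
  proof -
    have "\<Sigma> - surface_boundary \<Sigma> = \<Sigma> \<inter> - V" using bd by blast
    then show ?thesis using compact_imp_closed[OF V(2)] by (simp add: openin_open_Int open_Compl)
  qed

  from virtual_cover_model[OF assms(8) \<Sigma>_compact E_compact \<Sigma>_ne] obtain A1 q1 \<theta>1 \<sigma>1 k1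
    where fc1: "fibered_cover ?E p \<Sigma> q1 \<theta>1 \<sigma>1" and orient1: "orientation_preserving_to_S3 A1 q1"
      and k1: "knot_in_thickened_surface (\<Sigma>, A1, k1)" "k1 ` unit_circle \<subseteq> ?X" "\<forall>z\<in>unit_circle. q1 (k1 z) = K1 z"
      and K1_hat: "K1_hat = virtual_knot_of (\<Sigma>, A1, k1)"
    by (elim exE conjE) (rule that)
  from virtual_cover_model[OF assms(9) \<Sigma>_compact E_compact \<Sigma>_ne] obtain A2 q2 \<theta>2 \<sigma>2 k2
    where fc2: "fibered_cover ?E p \<Sigma> q2 \<theta>2 \<sigma>2" and orient2: "orientation_preserving_to_S3 A2 q2"
      and k2: "knot_in_thickened_surface (\<Sigma>, A2, k2)" "k2 ` unit_circle \<subseteq> ?X" "\<forall>z\<in>unit_circle. q2 (k2 z) = K2 z"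
      and K2_hat: "K2_hat = virtual_knot_of (\<Sigma>, A2, k2)"
    by (elim exE conjE) (rule that)
  have A1: "oriented_surface \<Sigma> A1" and A2: "oriented_surface \<Sigma> A2"
    using k1(1) k2(1) by (simp_all add: knot_in_thickened_surface_def)
  note k1 = k1(1,2) k1(3)[rule_format] and k2 = k2(1,2) k2(3)[rule_format]
  interpret c1: fibered_cover ?E p \<Sigma> q1 \<theta>1 \<sigma>1 by (rule fc1)
  interpret c2: fibered_cover ?E p \<Sigma> q2 \<theta>2 \<sigma>2 by (rule fc2)

  from ambient_isotopy_inverse[OF compact_sphere assms(10)] obtain L
    where "\<forall>t\<in>?I. diffeomorphism S3 S3 (H t) (L t)" and L_cont: "continuous_on (S3 \<times> ?I) (\<lambda>(x, t). L t x)"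
    by (elim exE conjE) (rule that)
  then have L: "diffeomorphism S3 S3 (H t) (L t)" if "t \<in> ?I" for t using that by blast
  have H_V: "H t x = x" if "t \<in> ?I" "x \<in> V" for t x using assms(12) that by blast
  \<comment> \<open>Injectivity keeps other points out of \<open>V\<close>, since each point of
    \<open>V\<close> is already its own image.\<close>
  have H_off: "H t x \<in> S3 - V" if t: "t \<in> ?I" and x: "x \<in> S3 - V" for t x
  proof -
    have "H t x \<in> S3" using diffeomorphism_image[OF L[OF t]] x by blast
    moreover have "H t x \<notin> V"
    proof
      assume v: "H t x \<in> V"
      then have "L t (H t (H t x)) = L t (H t x)" using H_V[OF t] by simp
      then have "H t x = x"
        using diffeomorphism_inverse[OF L[OF t]] \<open>H t x \<in> S3\<close> x by simp
      then show False using v x by simp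
    qed
    ultimately show ?thesis by blast
  qed
  have L_off: "L t x \<in> S3 - V" if t: "t \<in> ?I" and x: "x \<in> S3 - V" for t x
  proof -
    have "L t x \<in> S3" using diffeomorphism_inverse_image[OF L[OF t]] x by blast
    moreover have "L t x \<notin> V"
    proof
      assume v: "L t x \<in> V"
      have "x = H t (L t x)" using diffeomorphism_inverse'[OF L[OF t]] x by simp
      also have "\<dots> = L t x" by (rule H_V[OF t v])
      finally show False using v x by simp
    qed
    ultimately show ?thesis by blast
  qed
  \<comment> \<open>The exterior is the closure of the complement of \<open>V\<close>, so a
    continuous map that preserves this complement preserves the exterior.\<close>
  have to_E: "f ` ?E \<subseteq> ?E" if "continuous_on S3 f" "\<And>x. x \<in> S3 - V \<Longrightarrow> f x \<in> S3 - V" for f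
    unfolding exterior_def
    by (rule image_closure_subset)
      (use that E_S3 closure_subset[of "S3 - V"] in \<open>auto simp: exterior_def intro: continuous_on_subset\<close>)
  have H_E: "H t x \<in> ?E" and L_E: "L t x \<in> ?E" if "t \<in> ?I" "x \<in> ?E" for t x
    using to_E[OF smooth_on_imp_continuous_on[OF diffeomorphism_smooth[OF L[OF that(1)]]] H_off[OF that(1)]]
      to_E[OF smooth_on_imp_continuous_on[OF diffeomorphism_smooth_inverse[OF L[OF that(1)]]] L_off[OF that(1)]]
      that(2) by blast+
  have EI: "?E \<times> ?I \<subseteq> S3 \<times> ?I" using E_S3 by blast
  obtain T where T: "transport ?X T" "\<And>a b y. a \<in> ?I \<Longrightarrow> b \<in> ?I \<Longrightarrow> y \<in> ?X \<Longrightarrow> q1 (T a b y) = H b (L a (q1 y))"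
  proof (rule c1.lifted_transport[where F = H and L = L])
    have "smooth_on (S3 \<times> ?I) (\<lambda>(x, t). H t x)" using assms(10) unfolding ambient_isotopy_def by blast
    then show "smooth_on (?E \<times> ?I) (\<lambda>(x, t). H t x)" using EI by (rule smooth_on_subset)
    show "continuous_on (?E \<times> ?I) (\<lambda>(x, t). L t x)" using L_cont EI by (rule continuous_on_subset)
    show "smooth_on ?E (L t)" if "t \<in> ?I" for t
      using diffeomorphism_smooth_inverse[OF L[OF that]] E_S3 by (rule smooth_on_subset)
    show "H t (L t x) = x" "L t (H t x) = x" if "t \<in> ?I" "x \<in> ?E" for t x
      using diffeomorphism_inverse'[OF L[OF that(1)]] diffeomorphism_inverse[OF L[OF that(1)]] that(2) E_S3 by blast+
  qed (use H_E L_E in blast)+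
  have L0: "L 0 x = x" if "x \<in> S3" for x
    using diffeomorphism_inverse[OF L[of 0] that] assms(10) that unfolding ambient_isotopy_def by simp
  have K1_off: "K1 z \<in> S3 - V" if "z \<in> unit_circle" for z
    using assms(2,3) that unfolding classical_knot_def smooth_embedding_def by blast
  have k1X: "k1 z \<in> ?X" if "z \<in> unit_circle" for z using k1(2) that by blast
  have q1T: "q1 (T 0 a (k1 z)) = H a (K1 z)" if "a \<in> ?I" "z \<in> unit_circle" for a z
    using T(2)[OF _ that(1) k1X[OF that(2)], of 0] k1(3)[OF that(2)] L0[of "K1 z"] K1_off[OF that(2)] by simp
  have T_in: "T 0 a (k1 z) \<in> ?X" if "a \<in> ?I" "z \<in> unit_circle" for a z
    using transport.transport_in[OF T(1) _ that(1) k1X[OF that(2)], of 0] by simp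
  \<comment> \<open>The isotopy moves \<open>K1\<close> within the complement of \<open>V\<close>,
    which is open in the 3-sphere. So the lifted track never meets the boundary of
    \<open>\<Sigma>\<close>.\<close>
  have track: "T 0 a (k1 z) \<in> (\<Sigma> - surface_boundary \<Sigma>) \<times> {0<..<1}" if a: "a \<in> ?I" and z: "z \<in> unit_circle" for a z
  proof -
    have X: "fst (T 0 a (k1 z)) \<in> \<Sigma>" "snd (T 0 a (k1 z)) \<in> {0<..<1}"
      using T_in[OF a z] by (simp_all only: mem_Times_iff)
    have "fst (T 0 a (k1 z)) \<notin> surface_boundary \<Sigma>"
    proof
      assume "fst (T 0 a (k1 z)) \<in> surface_boundary \<Sigma>"
      from c1.boundary_avoids_open[OF interior_E this X(2)] show False
        using q1T[OF a z] H_off[OF a K1_off[OF z]] by simp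
    qed
    then show ?thesis using X by (simp add: mem_Times_iff)
  qed
  \<comment> \<open>The end of the lifted isotopy is a lift of \<open>K2\<close> to the first cover,
    generally unrelated to the lift \<open>k2\<close> in the second.\<close>
  define k where "k z = T 0 1 (k1 z)" for z
  have st1: "knot_in_thickened_surface (\<Sigma>, A1, k) \<and> stably_equivalent (\<Sigma>, A1, k1) (\<Sigma>, A1, k)"
    by (rule stably_equivalent_transport[OF T(1) k1(1) int k1(2) track]) (simp_all add: k_def)
  have kX: "k z \<in> ?X" and k_int: "k z \<in> (\<Sigma> - surface_boundary \<Sigma>) \<times> {0<..<1}" and qk: "q1 (k z) = K2 z"
    if "z \<in> unit_circle" for z
    using T_in[OF _ that, of 1] track[OF _ that, of 1] q1T[OF _ that, of 1] assms(11) that by (simp_all add: k_def)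

  have one: "1 \<in> unit_circle" by simp
  have k2X: "k2 z \<in> ?X" if "z \<in> unit_circle" for z using k2(2) that by blast
  \<comment> \<open>The comparison map is normalized to take \<open>k 1\<close> to
    \<open>k2 1\<close>. Uniqueness of lifts along the connected circle then makes it take all of
    \<open>k\<close> to \<open>k2\<close>.\<close>
  have qq: "q2 (k2 1) = q1 (k 1)" using k2(3)[OF one] qk[OF one] by simp
  obtain \<phi> \<psi> n where \<phi>: "diffeomorphism ?X ?X \<phi> \<psi>" "\<phi> (k 1) = k2 1" "\<And>y. y \<in> ?X \<Longrightarrow> q2 (\<phi> y) = q1 y"
      "\<And>y. y \<in> ?X \<Longrightarrow> \<theta>2 (snd (\<phi> y)) = \<theta>1 (snd y) + 2 * pi * of_int n"
    by (rule comparison_diffeomorphism[OF fc1 fc2 kX[OF one] k2X[OF one] qq]) blast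
  have \<phi>X: "\<phi> y \<in> ?X" "\<psi> y \<in> ?X" if "y \<in> ?X" for y
    using that diffeomorphism_image[OF \<phi>(1)] diffeomorphism_inverse_image[OF \<phi>(1)] by blast+
  obtain x0 where x0: "x0 \<in> \<Sigma>" using \<Sigma>_ne by blast
  define s where "s t = snd (\<phi> (x0, t))" for t
  define r where "r t = snd (\<psi> (x0, t))" for t
  have x0X: "(x0, snd y) \<in> ?X" if "y \<in> ?X" for y using x0 that by (auto simp: mem_Times_iff)
  \<comment> \<open>Points on one level have equal height, so their images have equal height in the
    second cover, hence lie on one level. Any fixed \<open>x0\<close> may therefore serve to define
    the level map.\<close>
  have s: "snd (\<phi> y) = s (snd y)" if "y \<in> ?X" for y
    unfolding s_def
    by (rule c2.height_inj[OF \<phi>X(1)[OF that] \<phi>X(1)[OF x0X[OF that]]])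
      (use \<phi>(4)[OF that] \<phi>(4)[OF x0X[OF that]] in simp)
  have s_mono: "strict_mono_on {0<..<1} s"
  proof (rule strict_mono_onI)
    fix t u :: real assume tu: "t \<in> {0<..<1}" "u \<in> {0<..<1}" "t < u"
    have X: "(x0, t) \<in> ?X" "(x0, u) \<in> ?X" using tu x0 by auto
    have sJ: "s t \<in> {0<..<1}" "s u \<in> {0<..<1}"
      using \<phi>X(1)[OF X(1)] \<phi>X(1)[OF X(2)] unfolding s_def by (simp_all only: mem_Times_iff)
    have "\<theta>1 t < \<theta>1 u" using c1.\<theta>_mono tu by (simp add: strict_mono_on_def)
    then have "\<theta>2 (s t) < \<theta>2 (s u)" using \<phi>(4)[OF X(1)] \<phi>(4)[OF X(2)] by (simp add: s_def)
    then show "s t < s u"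
      using strict_mono_on_less[OF c2.\<theta>_mono sJ] by simp
  qed
  have r: "snd (\<psi> y) = r (snd y)" if "y \<in> ?X" for y
  proof -
    have shift: "\<theta>1 (snd (\<psi> y)) = \<theta>2 (snd y) - 2 * pi * of_int n" if "y \<in> ?X" for y
      using \<phi>(4)[OF \<phi>X(2)[OF that]] diffeomorphism_inverse'[OF \<phi>(1) that] by simp
    show ?thesis
      unfolding r_def
      by (rule c1.height_inj[OF \<phi>X(2)[OF that] \<phi>X(2)[OF x0X[OF that]]])
        (use shift[OF that] shift[OF x0X[OF that]] in simp)
  qed
  have \<phi>k: "\<phi> (k z) = k2 z" if z: "z \<in> unit_circle" for z
  proof (rule covering_space_lift_unique[OF c2.cover, where T = unit_circle and a = 1 and f = K2
        and ?g1.0 = "\<lambda>z. \<phi> (k z)" and ?g2.0 = k2])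
    have emb: "continuous_on unit_circle c" if "knot_in_thickened_surface (\<Sigma>, A, c)" for A c
      using that unfolding knot_in_thickened_surface_def smooth_embedding_def
      by (auto intro: smooth_on_imp_continuous_on diffeomorphism_smooth)
    show "continuous_on unit_circle K2"
      using assms(4) unfolding classical_knot_def smooth_embedding_def
      by (auto intro: smooth_on_imp_continuous_on diffeomorphism_smooth)
    show "continuous_on unit_circle k2" by (rule emb[OF k2(1)])
    show "continuous_on unit_circle (\<lambda>z. \<phi> (k z))"
      by (rule continuous_on_compose2[OF smooth_on_imp_continuous_on[OF diffeomorphism_smooth[OF \<phi>(1)]] emb])
        (use st1 kX in blast)+
    show "connected unit_circle" by (rule connected_sphere) simp
    show "K2 \<in> unit_circle \<rightarrow> ?E"
    proof (rule Pi_I)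
      show "K2 z \<in> ?E" if "z \<in> unit_circle" for z using c2.q_in[OF k2X[OF that]] k2(3)[OF that] by simp
    qed
    show "(\<lambda>z. \<phi> (k z)) \<in> unit_circle \<rightarrow> ?X" by (intro Pi_I \<phi>X(1) kX)
    show "k2 \<in> unit_circle \<rightarrow> ?X" by (intro Pi_I k2X)
    show "K2 z = q2 (\<phi> (k z))" "K2 z = q2 (k2 z)" if "z \<in> unit_circle" for z
      using \<phi>(3)[OF kX[OF that]] qk[OF that] k2(3)[OF that] by simp_all
  qed (use \<phi>(2) one z in simp_all)

  define f where "f x = fst (\<phi> (x, 1/2))" for x
  \<comment> \<open>The middle level is mapped to the level \<open>s (1/2)\<close>, so the inverse
    of \<open>f\<close> is read off there.\<close>
  define g where "g x = fst (\<psi> (x, s (1/2)))" for x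
  have half: "(x, 1/2) \<in> ?X" "(x, s (1/2)) \<in> ?X" if "x \<in> \<Sigma>" for x
  proof -
    show X: "(x, 1/2) \<in> ?X" using that by simp
    have "snd (\<phi> (x, 1/2)) \<in> {0<..<1}" using \<phi>X(1)[OF X] by (simp only: mem_Times_iff)
    then show "(x, s (1/2)) \<in> ?X" using that s[OF X] by simp
  qed
  have \<phi>_half: "\<phi> (x, 1/2) = (f x, s (1/2))" if "x \<in> \<Sigma>" for x
    using s[OF half(1)[OF that]] by (simp add: f_def prod_eq_iff)
  have \<psi>_half: "\<psi> (x, s (1/2)) = (g x, 1/2)" if "x \<in> \<Sigma>" for x
  proof -
    have "r (s (1/2)) = snd (\<psi> (\<phi> (x, 1/2)))" using r[OF \<phi>X(1)[OF half(1)[OF that]]] s[OF half(1)[OF that]] by simp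
    also have "\<dots> = 1/2" using diffeomorphism_inverse[OF \<phi>(1) half(1)[OF that]] by simp
    finally show ?thesis using r[OF half(2)[OF that]] by (simp add: g_def prod_eq_iff)
  qed
  have fg: "diffeomorphism \<Sigma> \<Sigma> f g"
  proof (rule diffeomorphismI)
    show "smooth_on \<Sigma> f"
      unfolding f_def by (rule smooth_on_fst, rule smooth_on_compose[OF diffeomorphism_smooth[OF \<phi>(1)]],
          intro smooth_on_intros) (use half(1) in blast)
    show "smooth_on \<Sigma> g"
      unfolding g_def by (rule smooth_on_fst, rule smooth_on_compose[OF diffeomorphism_smooth_inverse[OF \<phi>(1)]],
          intro smooth_on_intros) (use half(2) in blast)
    show "f ` \<Sigma> \<subseteq> \<Sigma>"
      using \<phi>X(1)[OF half(1)] unfolding f_def by (auto simp only: mem_Times_iff)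
    show "g ` \<Sigma> \<subseteq> \<Sigma>"
      using \<phi>X(2)[OF half(2)] unfolding g_def by (auto simp only: mem_Times_iff)
    show "g (f x) = x" if "x \<in> \<Sigma>" for x
      using diffeomorphism_inverse[OF \<phi>(1) half(1)[OF that]] unfolding \<phi>_half[OF that] by (simp add: g_def)
    show "f (g x) = x" if "x \<in> \<Sigma>" for x
      using diffeomorphism_inverse'[OF \<phi>(1) half(2)[OF that]] unfolding \<psi>_half[OF that] by (simp add: f_def)
  qed
  have f_orient: "orientation_preserving_on \<Sigma> f A1 A2"
    using level_map_orientation_preserving[OF orient1 orient2 A1 A2
        diffeomorphism_smooth[OF \<phi>(1)] \<phi>X(1) \<phi>(3) s s_mono, of "1/2"] unfolding f_def by simp
  \<comment> \<open>The product map applied to \<open>k\<close>. It is reached from \<open>k\<close>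
    by a surface diffeomorphism, which also replaces the atlas \<open>A1\<close> by
    \<open>A2\<close>; the remaining way to \<open>k2\<close> is by isotopies.\<close>
  define m where "m z = (fst (\<phi> (fst (k z), 1/2)), snd (k z))" for z
  have m_knot: "knot_in_thickened_surface (\<Sigma>, A2, m)"
  proof -
    have prod: "diffeomorphism (\<Sigma> \<times> {0..1::real}) (\<Sigma> \<times> {0..1}) (\<lambda>y. (f (fst y), snd y)) (\<lambda>y. (g (fst y), snd y))"
    proof (rule diffeomorphismI)
      show "smooth_on (\<Sigma> \<times> {0..1::real}) (\<lambda>y. (f (fst y), snd y))"
        by (intro smooth_on_intros
            smooth_on_compose[OF diffeomorphism_smooth[OF fg] smooth_on_fst[OF smooth_on_ident]]) auto
      show "smooth_on (\<Sigma> \<times> {0..1::real}) (\<lambda>y. (g (fst y), snd y))"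
        by (intro smooth_on_intros
            smooth_on_compose[OF diffeomorphism_smooth_inverse[OF fg] smooth_on_fst[OF smooth_on_ident]]) auto
      show "(\<lambda>y. (f (fst y), snd y)) ` (\<Sigma> \<times> {0..1::real}) \<subseteq> \<Sigma> \<times> {0..1}"
        using diffeomorphism_image[OF fg] by auto
      show "(\<lambda>y. (g (fst y), snd y)) ` (\<Sigma> \<times> {0..1::real}) \<subseteq> \<Sigma> \<times> {0..1}"
        using diffeomorphism_inverse_image[OF fg] by auto
    qed (use diffeomorphism_inverse[OF fg] diffeomorphism_inverse'[OF fg] in auto)
    have "smooth_embedding unit_circle (\<Sigma> \<times> {0..1}) k"
      using st1 unfolding knot_in_thickened_surface_def by simp
    then have "smooth_embedding unit_circle (\<Sigma> \<times> {0..1}) ((\<lambda>y. (f (fst y), snd y)) \<circ> k)"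
      by (rule smooth_embedding_compose[OF _ prod subset_refl])
    then have "smooth_embedding unit_circle (\<Sigma> \<times> {0..1}) m"
      by (rule smooth_embedding_cong) (simp add: m_def f_def)
    then show ?thesis using A2 \<Sigma>_compact by (simp add: knot_in_thickened_surface_def)
  qed
  have "related_by_surface_diffeomorphism (\<Sigma>, A1, k) (\<Sigma>, A2, m)"
    unfolding related_by_surface_diffeomorphism_def prod.case
    by (intro exI[of _ f] exI[of _ g] conjI fg f_orient) (simp add: m_def f_def)
  then have st2: "stably_equivalent (\<Sigma>, A1, k) (\<Sigma>, A2, m)"
    using st1 m_knot by (intro stable_move_stably_equivalent stable_move.diffeo) blast+
  have k_img: "k ` unit_circle \<subseteq> (\<Sigma> - surface_boundary \<Sigma>) \<times> {0<..<1}"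
    by (rule image_subsetI) (rule k_int)
  have "stably_equivalent (\<Sigma>, A2, m) (\<Sigma>, A2, k2)"
    unfolding m_def
    by (rule stably_equivalent_level_preserving[OF \<phi>(1) s s_mono r int k_img m_knot[unfolded m_def] \<phi>k[symmetric]])
  then have "stably_equivalent (\<Sigma>, A1, k1) (\<Sigma>, A2, k2)"
    using st1 st2 stably_equivalent_trans by blast
  then show ?thesis
    unfolding K1_hat K2_hat by (rule virtual_knot_of_eqI)
qed

end
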